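(* For every integer $n\ge 5$ there exists an origin-symmetric convex body $K$ in $\mathbb{R}^n$ such that $K$ is not an intersection body in $\mathbb{R}^n$, but for every $(n-1)$-dimensional linear subspace $V$ of $\mathbb{R}^n$ the section $K\cap V$ is an intersection body in $V$.
   Context: A convex body is a compact convex set having the origin as an interior point. A star body in $\mathbb{R}^m$ is a compact set, star-shaped about the origin, whose radial function $\rho_K(x)=\max\{a>0: ax\in K\}$, $x\in\mathbb{R}^m\setminus\{0\}$, is positive and continuous; its Minkowski functional is $\|x\|_K=\min\{a\ge 0: x\in aK\}$, so $\rho_K(x)=\|x\|_K^{-1}$. For origin-symmetric star bodies $K,L$ in $\mathbb{R}^m$, $K$ is called the intersection body of $L$ if $\|\xi\|_K^{-1}=\mathrm{vol}_{m-1}(L\cap\xi^\perp)$ for every $\xi\in S^{m-1}$, where $\xi^\perp$ is the hyperplane through the origin orthogonal to $\xi$. The class of intersection bodies in $\mathbb{R}^m$ is the closure, in the radial metric $\max_{\xi\in S^{m-1}}|\rho_K(\xi)-\rho_L(\xi)|$, of the class of intersection bodies of origin-symmetric star bodies in $\mathbb{R}^m$. For an $(n-1)$-dimensional subspace $V$ of $\mathbb{R}^n$, being an intersection body in $V$ is understood by identifying $V$ isometrically with $\mathbb{R}^{n-1}$. *)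

theory Defs
  imports "HOL-Analysis.Analysis"
begin

text \<open>All notions below are relative to a linear subspace \<open>V\<close> of a Euclidean space, with the
  inner product inherited from the ambient space; \<open>V = UNIV\<close> gives the notions for the whole space.
  They are invariant under linear isometries, see \<open>intersection_body_in_isometry\<close> at the end, so
  this agrees with identifying \<open>V\<close> isometrically with \<open>\<real>\<^sup>m\<close>, where \<open>m = dim V\<close>.\<close>

subsection \<open>Lebesgue measure on a linear subspace\<close>

definition orthonormal_basis_of :: "'a::euclidean_space set \<Rightarrow> 'a set \<Rightarrow> bool" where
  "orthonormal_basis_of B W \<longleftrightarrow>
     pairwise orthogonal B \<and> (\<forall>b\<in>B. norm b = 1) \<and> span B = W"

definition coord_measure :: "'a::euclidean_space set \<Rightarrow> 'a measure" where
  "coord_measure B = distr (\<Pi>\<^sub>M b\<in>B. lborel) borel (\<lambda>f. \<Sum>b\<in>B. f b *\<^sub>R b)"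

text \<open>The \<open>dim W\<close>-dimensional Lebesgue measure on \<open>W\<close>, as a Borel measure on the ambient space that
  is concentrated on \<open>W\<close>. The choice of the basis is immaterial, see \<open>subspace_lborel_eq\<close>.\<close>

definition subspace_lborel :: "'a::euclidean_space set \<Rightarrow> 'a measure" where
  "subspace_lborel W = coord_measure (SOME B. orthonormal_basis_of B W)"

subsection \<open>Star bodies and intersection bodies\<close>

text \<open>The maximum and the minimum defining \<open>radial\<close> and \<open>minkowski_functional\<close> are attained for
  star bodies and nonzero arguments, so \<open>Sup\<close> and \<open>Inf\<close> are the intended values there.\<close>

definition radial :: "'a::euclidean_space set \<Rightarrow> 'a \<Rightarrow> real" where
  "radial K x = Sup {a. a > 0 \<and> a *\<^sub>R x \<in> K}"

definition minkowski_functional :: "'a::euclidean_space set \<Rightarrow> 'a \<Rightarrow> real" where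
  "minkowski_functional K x = Inf {a. a \<ge> 0 \<and> x \<in> (\<lambda>y. a *\<^sub>R y) ` K}"

text \<open>Positivity of the radial function at \<open>x\<close> is expressed by nonemptiness of the set
  \<open>{a. a > 0 \<and> a *\<^sub>R x \<in> K}\<close>, since \<open>Sup\<close> of the empty set is unspecified.\<close>

definition star_body_in :: "'a::euclidean_space set \<Rightarrow> 'a set \<Rightarrow> bool" where
  "star_body_in V K \<longleftrightarrow>
     compact K \<and> K \<subseteq> V \<and> 0 \<in> K \<and> (\<forall>x\<in>K. closed_segment 0 x \<subseteq> K) \<and>
     (\<forall>x\<in>V - {0}. \<exists>a>0. a *\<^sub>R x \<in> K) \<and>
     continuous_on (V - {0}) (radial K)"

definition origin_symmetric :: "'a::euclidean_space set \<Rightarrow> bool" where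
  "origin_symmetric K \<longleftrightarrow> (\<forall>x\<in>K. - x \<in> K)"

definition convex_body :: "'a::euclidean_space set \<Rightarrow> bool" where
  "convex_body K \<longleftrightarrow> compact K \<and> convex K \<and> 0 \<in> interior K"

definition is_intersection_body_of_in ::
    "'a::euclidean_space set \<Rightarrow> 'a set \<Rightarrow> 'a set \<Rightarrow> bool" where
  "is_intersection_body_of_in V K L \<longleftrightarrow>
     star_body_in V K \<and> origin_symmetric K \<and> star_body_in V L \<and> origin_symmetric L \<and>
     (\<forall>\<xi>\<in>sphere 0 1 \<inter> V. inverse (minkowski_functional K \<xi>) =
        measure (subspace_lborel (V \<inter> {x. orthogonal \<xi> x})) (L \<inter> {x. orthogonal \<xi> x}))"

definition radial_dist :: "'a::euclidean_space set \<Rightarrow> 'a set \<Rightarrow> 'a set \<Rightarrow> real" where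
  "radial_dist V K L = (SUP \<xi>\<in>sphere 0 1 \<inter> V. \<bar>radial K \<xi> - radial L \<xi>\<bar>)"

text \<open>Membership in the closure, in the radial metric on star bodies in \<open>V\<close>, of the class of
  intersection bodies of origin-symmetric star bodies.\<close>

definition intersection_body_in :: "'a::euclidean_space set \<Rightarrow> 'a set \<Rightarrow> bool" where
  "intersection_body_in V K \<longleftrightarrow>
     star_body_in V K \<and>
     (\<forall>\<epsilon>>0. \<exists>K' L. is_intersection_body_of_in V K' L \<and> radial_dist V K K' < \<epsilon>)"

subsection \<open>Independence of the orthonormal basis\<close>

lemma orthonormal_basis_of_finite:
  assumes "orthonormal_basis_of B W"
  shows "finite B" "card B = dim W" "independent B"
proof -
  have "0 \<notin> B" using assms unfolding orthonormal_basis_of_def by force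
  then show i: "independent B"
    using assms pairwise_orthogonal_independent unfolding orthonormal_basis_of_def by blast
  then show "finite B" by (rule independent_imp_finite)
  show "card B = dim W"
    using assms dim_span_eq_card_independent[OF i] unfolding orthonormal_basis_of_def by auto
qed

lemma orthonormal_basis_of_exists:
  assumes "subspace W"
  obtains B where "orthonormal_basis_of B W"
  using orthonormal_basis_subspace[OF assms] unfolding orthonormal_basis_of_def by metis

lemma coord_sum_measurable [measurable]:
  "(\<lambda>f. \<Sum>b\<in>B. f b *\<^sub>R b) \<in> borel_measurable (\<Pi>\<^sub>M b\<in>B. (lborel :: real measure))"
  for B :: "'a::euclidean_space set"
  by measurable

lemma nn_integral_coord_measure:
  assumes "h \<in> borel_measurable borel"
  shows "nn_integral (coord_measure B) h =
    (\<integral>\<^sup>+ f. h (\<Sum>b\<in>B. f b *\<^sub>R b) \<partial>(\<Pi>\<^sub>M b\<in>B. (lborel :: real measure)))"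
  unfolding coord_measure_def using assms by (subst nn_integral_distr) auto

lemma PiM_lborel_translate:
  fixes t :: "'i \<Rightarrow> real"
  assumes fin: "finite I"
  shows "distr (\<Pi>\<^sub>M i\<in>I. lborel) (\<Pi>\<^sub>M i\<in>I. lborel) (\<lambda>f. \<lambda>i\<in>I. t i + f i) = (\<Pi>\<^sub>M i\<in>I. lborel)"
proof -
  interpret product_sigma_finite "\<lambda>i::'i. lborel :: real measure" by standard
  show ?thesis
  proof (rule PiM_eqI[OF fin])
    fix A :: "'i \<Rightarrow> real set" assume A: "\<And>i. i \<in> I \<Longrightarrow> A i \<in> sets lborel"
    have m: "(+) (t i) -` A i \<in> sets lborel" if "i \<in> I" for i
      using A[OF that] measurable_sets[of "(+) (t i)" borel borel "A i"] by auto
    have "emeasure (distr (\<Pi>\<^sub>M i\<in>I. lborel) (\<Pi>\<^sub>M i\<in>I. lborel) (\<lambda>f. \<lambda>i\<in>I. t i + f i)) (Pi\<^sub>E I A) =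
          emeasure (\<Pi>\<^sub>M i\<in>I. lborel) (Pi\<^sub>E I (\<lambda>i. (+) (t i) -` A i))"
      using A fin
      by (subst emeasure_distr)
         (force intro!: sets_PiM_I_finite arg_cong2[where f=emeasure] simp: space_PiM PiE_def Pi_def)+
    also have "\<dots> = (\<Prod>i\<in>I. emeasure lborel ((+) (t i) -` A i))"
      using m fin by (subst emeasure_PiM) auto
    also have "\<dots> = (\<Prod>i\<in>I. emeasure lborel (A i))"
    proof (rule prod.cong[OF refl])
      fix i assume "i \<in> I"
      have "emeasure (distr lborel borel ((+) (t i))) (A i) = emeasure lborel ((+) (t i) -` A i)"
        using A[OF \<open>i \<in> I\<close>] by (subst emeasure_distr) auto
      then show "emeasure lborel ((+) (t i) -` A i) = emeasure lborel (A i)"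
        by (simp add: lborel_distr_plus)
    qed
    finally show "emeasure (distr (\<Pi>\<^sub>M i\<in>I. lborel) (\<Pi>\<^sub>M i\<in>I. lborel) (\<lambda>f. \<lambda>i\<in>I. t i + f i)) (Pi\<^sub>E I A) =
      (\<Prod>i\<in>I. emeasure lborel (A i))" .
  qed simp
qed

lemma PiM_lborel_reindex:
  assumes "bij_betw g I J" "finite I"
  shows "distr (\<Pi>\<^sub>M j\<in>J. (lborel :: real measure)) (\<Pi>\<^sub>M i\<in>I. lborel) (\<lambda>f. \<lambda>i\<in>I. f (g i)) = (\<Pi>\<^sub>M i\<in>I. lborel)"
proof -
  have finJ: "finite J" using assms bij_betw_finite by blast
  have gJ: "g i \<in> J" if "i \<in> I" for i using assms that bij_betwE by blast
  interpret product_sigma_finite "\<lambda>_. lborel :: real measure" by standard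
  have mm: "(\<lambda>f. \<lambda>i\<in>I. f (g i)) \<in> (\<Pi>\<^sub>M j\<in>J. (lborel :: real measure)) \<rightarrow>\<^sub>M (\<Pi>\<^sub>M i\<in>I. lborel)"
    by (rule measurable_restrict) (use gJ in auto)
  show ?thesis
  proof (rule PiM_eqI[OF assms(2)])
    fix A :: "_ \<Rightarrow> real set" assume A: "\<And>i. i \<in> I \<Longrightarrow> A i \<in> sets lborel"
    let ?h = "inv_into I g"
    have h: "?h j \<in> I" "g (?h j) = j" if "j \<in> J" for j
      using assms that by (auto simp: bij_betw_def inv_into_into f_inv_into_f)
    have hg: "?h (g i) = i" if "i \<in> I" for i
      using assms that by (auto simp: bij_betw_def)
    have "(\<lambda>f. \<lambda>i\<in>I. f (g i)) -` Pi\<^sub>E I A \<inter> space (\<Pi>\<^sub>M j\<in>J. (lborel :: real measure)) = Pi\<^sub>E J (\<lambda>j. A (?h j))"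
      unfolding space_PiM
    proof (intro set_eqI iffI)
      fix f assume "f \<in> (\<lambda>f. \<lambda>i\<in>I. f (g i)) -` Pi\<^sub>E I A \<inter> (\<Pi>\<^sub>E j\<in>J. space ((lborel :: real measure)))"
      then have 1: "\<forall>i\<in>I. f (g i) \<in> A i" and 2: "f \<in> extensional J"
        by (auto simp: PiE_def Pi_def)
      have "f j \<in> A (?h j)" if "j \<in> J" for j
        using 1 h[OF that] by metis
      with 2 show "f \<in> Pi\<^sub>E J (\<lambda>j. A (?h j))"
        by (auto simp: PiE_def)
    next
      fix f assume f: "f \<in> Pi\<^sub>E J (\<lambda>j. A (?h j))"
      have "f (g i) \<in> A i" if "i \<in> I" for i
        using PiE_mem[OF f gJ[OF that]] hg[OF that] by simp
      with f show "f \<in> (\<lambda>f. \<lambda>i\<in>I. f (g i)) -` Pi\<^sub>E I A \<inter> (\<Pi>\<^sub>E j\<in>J. space ((lborel :: real measure)))"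
        by (auto simp: PiE_def)
    qed
    then have "emeasure (distr (\<Pi>\<^sub>M j\<in>J. (lborel :: real measure)) (\<Pi>\<^sub>M i\<in>I. lborel) (\<lambda>f. \<lambda>i\<in>I. f (g i))) (Pi\<^sub>E I A) =
        emeasure (\<Pi>\<^sub>M j\<in>J. (lborel :: real measure)) (Pi\<^sub>E J (\<lambda>j. A (?h j)))"
      using A assms(2) by (subst emeasure_distr[OF mm]) (auto intro!: sets_PiM_I_finite)
    also have "\<dots> = (\<Prod>j\<in>J. emeasure lborel (A (?h j)))"
      using A h finJ by (subst emeasure_PiM) auto
    also have "\<dots> = (\<Prod>i\<in>I. emeasure lborel (A i))"
      using assms(1) hg by (subst prod.reindex_bij_betw[OF assms(1), symmetric]) simp
    finally show "emeasure (distr (\<Pi>\<^sub>M j\<in>J. (lborel :: real measure)) (\<Pi>\<^sub>M i\<in>I. lborel) (\<lambda>f. \<lambda>i\<in>I. f (g i))) (Pi\<^sub>E I A) =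
        (\<Prod>i\<in>I. emeasure lborel (A i))" .
  qed simp
qed

lemma nn_integral_PiM_reindex:
  assumes "bij_betw g I J" "finite I" "h \<in> borel_measurable (\<Pi>\<^sub>M i\<in>I. (lborel :: real measure))"
  shows "(\<integral>\<^sup>+ f. h f \<partial>(\<Pi>\<^sub>M i\<in>I. (lborel :: real measure))) =
         (\<integral>\<^sup>+ f. h (\<lambda>i\<in>I. f (g i)) \<partial>(\<Pi>\<^sub>M j\<in>J. (lborel :: real measure)))"
proof -
  have gJ: "g i \<in> J" if "i \<in> I" for i using assms that bij_betwE by blast
  have mm: "(\<lambda>f. \<lambda>i\<in>I. f (g i)) \<in> (\<Pi>\<^sub>M j\<in>J. (lborel :: real measure)) \<rightarrow>\<^sub>M (\<Pi>\<^sub>M i\<in>I. lborel)"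
    by (rule measurable_restrict) (use gJ in auto)
  show ?thesis
    by (subst PiM_lborel_reindex[OF assms(1,2), symmetric], subst nn_integral_distr[OF mm])
       (use assms(3) in auto)
qed

lemma nn_integral_coord_translate:
  fixes B :: "'a::euclidean_space set"
  assumes B: "finite B" and w: "w \<in> span B" and h: "h \<in> borel_measurable borel"
  shows "nn_integral (coord_measure B) (\<lambda>x. h (w + x)) = nn_integral (coord_measure B) h"
proof -
  obtain t where t: "w = (\<Sum>b\<in>B. t b *\<^sub>R b)"
    using w unfolding span_finite[OF B] by auto
  have [measurable]: "h \<in> borel_measurable borel" by (rule h)
  have mm: "(\<lambda>f. \<lambda>b\<in>B. t b + f b) \<in> (\<Pi>\<^sub>M b\<in>B. lborel) \<rightarrow>\<^sub>M (\<Pi>\<^sub>M b\<in>B. (lborel :: real measure))"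
    by measurable
  have "nn_integral (coord_measure B) h =
     (\<integral>\<^sup>+ f. h (\<Sum>b\<in>B. f b *\<^sub>R b) \<partial>distr (\<Pi>\<^sub>M b\<in>B. lborel) (\<Pi>\<^sub>M b\<in>B. lborel) (\<lambda>f. \<lambda>b\<in>B. t b + f b))"
    unfolding PiM_lborel_translate[OF B] by (rule nn_integral_coord_measure[OF h])
  also have "\<dots> = (\<integral>\<^sup>+ f. h (w + (\<Sum>b\<in>B. f b *\<^sub>R b)) \<partial>(\<Pi>\<^sub>M b\<in>B. (lborel :: real measure)))"
    by (subst nn_integral_distr[OF mm])
       (auto simp: t scaleR_left_distrib sum.distrib intro!: nn_integral_cong)
  also have "\<dots> = nn_integral (coord_measure B) (\<lambda>x. h (w + x))"
    by (subst nn_integral_coord_measure) auto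
  finally show ?thesis ..
qed

lemma norm_coord_sum:
  assumes "orthonormal_basis_of B W"
  shows "(norm (\<Sum>b\<in>B. f b *\<^sub>R b))\<^sup>2 = (\<Sum>b\<in>B. (f b)\<^sup>2)"
proof -
  note fin = orthonormal_basis_of_finite(1)[OF assms]
  have o: "b \<bullet> c = (if b = c then 1 else 0)" if "b \<in> B" "c \<in> B" for b c
    using assms that unfolding orthonormal_basis_of_def pairwise_def orthogonal_def
    by (auto simp: norm_eq_1)
  have "(norm (\<Sum>b\<in>B. f b *\<^sub>R b))\<^sup>2 = (\<Sum>c\<in>B. f c * (\<Sum>b\<in>B. f b * (b \<bullet> c)))"
    unfolding power2_norm_eq_inner by (simp add: inner_sum_right inner_sum_left)
  also have "\<dots> = (\<Sum>c\<in>B. f c * (\<Sum>b\<in>B. if b = c then f b else 0))"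
    by (intro sum.cong refl arg_cong2[where f="(*)"]) (auto simp: o)
  also have "\<dots> = (\<Sum>c\<in>B. (f c)\<^sup>2)"
    using fin by (simp add: power2_eq_square)
  finally show ?thesis .
qed

lemma coord_measure_ball:
  fixes B :: "'a::euclidean_space set" and C :: "'b::euclidean_space set"
  assumes B: "orthonormal_basis_of B W" and C: "orthonormal_basis_of C U" and d: "dim W = dim U"
  shows "emeasure (coord_measure B) (ball 0 1) = emeasure (coord_measure C) (ball 0 1)"
proof -
  note finB = orthonormal_basis_of_finite[OF B] and finC = orthonormal_basis_of_finite[OF C]
  obtain g where g: "bij_betw g B C"
    using finite_same_card_bij[OF finB(1) finC(1)] finB(2) finC(2) d by auto
  have gm: "g b \<in> C" if "b \<in> B" for b using g that bij_betwE by blast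
  have ballB: "(\<Sum>b\<in>B. f b *\<^sub>R b) \<in> ball 0 1 \<longleftrightarrow> (\<Sum>b\<in>B. (f b)\<^sup>2) < 1" for f
    by (simp add: norm_coord_sum[OF B, symmetric] abs_square_less_1)
  have ballC: "(\<Sum>b\<in>C. f b *\<^sub>R b) \<in> ball 0 1 \<longleftrightarrow> (\<Sum>b\<in>C. (f b)\<^sup>2) < 1" for f
    by (simp add: norm_coord_sum[OF C, symmetric] abs_square_less_1)
  let ?hB = "\<lambda>f. indicator {..<1::real} (\<Sum>b\<in>B. (f b)\<^sup>2) :: ennreal"
  have "emeasure (coord_measure B) (ball 0 1) = nn_integral (coord_measure B) (indicator (ball 0 1))"
    by (subst nn_integral_indicator) (auto simp: coord_measure_def)
  also have "\<dots> = (\<integral>\<^sup>+ f. ?hB f \<partial>(\<Pi>\<^sub>M b\<in>B. (lborel :: real measure)))"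
    by (subst nn_integral_coord_measure) (auto intro!: nn_integral_cong simp: indicator_def ballB simp del: mem_ball mem_ball_0)
  also have "\<dots> = (\<integral>\<^sup>+ f. ?hB (\<lambda>b\<in>B. f (g b)) \<partial>(\<Pi>\<^sub>M c\<in>C. (lborel :: real measure)))"
    by (rule nn_integral_PiM_reindex[OF g finB(1)]) measurable
  also have "\<dots> = (\<integral>\<^sup>+ f. indicator {..<1::real} (\<Sum>c\<in>C. (f c)\<^sup>2) \<partial>(\<Pi>\<^sub>M c\<in>C. (lborel :: real measure)))"
    by (intro nn_integral_cong arg_cong[where f="indicator {..<1}"])
       (simp add: sum.reindex_bij_betw[OF g, of "\<lambda>c. (_ c)\<^sup>2", symmetric])
  also have "\<dots> = nn_integral (coord_measure C) (indicator (ball 0 1))"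
    by (subst nn_integral_coord_measure) (auto intro!: nn_integral_cong simp: indicator_def ballC simp del: mem_ball mem_ball_0)
  also have "\<dots> = emeasure (coord_measure C) (ball 0 1)"
    by (subst nn_integral_indicator) (auto simp: coord_measure_def)
  finally show ?thesis .
qed

lemma coord_measure_ball_pos_finite:
  assumes B: "orthonormal_basis_of B W"
  shows "emeasure (coord_measure B) (ball 0 1) \<noteq> 0" "emeasure (coord_measure B) (ball 0 1) \<noteq> \<infinity>"
proof -
  note fin = orthonormal_basis_of_finite[OF B]
  interpret product_sigma_finite "\<lambda>b. lborel :: real measure" by standard
  let ?P = "\<Pi>\<^sub>M b\<in>B. (lborel :: real measure)"
  let ?S = "(\<lambda>f. \<Sum>b\<in>B. f b *\<^sub>R b) -` ball 0 1 \<inter> space ?P"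
  have eq: "emeasure (coord_measure B) (ball 0 1) = emeasure ?P ?S"
    unfolding coord_measure_def by (subst emeasure_distr) auto
  have S: "?S \<in> sets ?P" by measurable
  have mem: "f \<in> ?S \<longleftrightarrow> f \<in> extensional B \<and> (\<Sum>b\<in>B. (f b)\<^sup>2) < 1" for f
    by (auto simp: norm_coord_sum[OF B, symmetric] abs_square_less_1 space_PiM PiE_def)
  define r :: real where "r = 1 / (1 + real (card B))"
  have r: "0 < r" "r \<le> 1" "real (card B) * r < 1" unfolding r_def by (auto simp: field_simps)
  have "Pi\<^sub>E B (\<lambda>_. {-r..r}) \<subseteq> ?S"
  proof
    fix f assume f: "f \<in> Pi\<^sub>E B (\<lambda>_. {-r..r})"
    have "(f b)\<^sup>2 \<le> r" if "b \<in> B" for b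
    proof -
      have "\<bar>f b\<bar> \<le> r" using f that by (force simp: PiE_def Pi_def)
      then have "(f b)\<^sup>2 \<le> r\<^sup>2" by (metis abs_ge_zero power2_abs power_mono)
      also have "\<dots> \<le> r" using r by (simp add: power2_eq_square mult_left_le)
      finally show ?thesis .
    qed
    then have "(\<Sum>b\<in>B. (f b)\<^sup>2) \<le> real (card B) * r" by (rule sum_bounded_above)
    with r f show "f \<in> ?S" unfolding mem by (auto simp: PiE_def)
  qed
  then have "emeasure ?P (Pi\<^sub>E B (\<lambda>_. {-r..r})) \<le> emeasure ?P ?S"
    by (rule emeasure_mono[OF _ S])
  moreover have "emeasure ?P (Pi\<^sub>E B (\<lambda>_. {-r..r})) \<noteq> 0"
    using fin r by (subst emeasure_PiM) auto
  ultimately show "emeasure (coord_measure B) (ball 0 1) \<noteq> 0"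
    unfolding eq by auto
  have "?S \<subseteq> Pi\<^sub>E B (\<lambda>_. {-1..1})"
  proof
    fix f assume f: "f \<in> ?S"
    have "f b \<in> {-1..1}" if "b \<in> B" for b
    proof -
      have "(f b)\<^sup>2 \<le> (\<Sum>b\<in>B. (f b)\<^sup>2)" using fin that by (intro member_le_sum) auto
      also have "\<dots> < 1" using f unfolding mem by auto
      finally show ?thesis by (auto simp: abs_square_less_1)
    qed
    with f show "f \<in> Pi\<^sub>E B (\<lambda>_. {-1..1})" unfolding mem by (auto simp: PiE_def)
  qed
  then have "emeasure ?P ?S \<le> emeasure ?P (Pi\<^sub>E B (\<lambda>_. {-1..1}))"
    using fin by (intro emeasure_mono sets_PiM_I_finite) auto
  also have "\<dots> = (\<Prod>b\<in>B. 2)"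
    using fin by (subst emeasure_PiM) auto
  also have "\<dots> < \<infinity>" by (simp add: power_less_top_ennreal)
  finally show "emeasure (coord_measure B) (ball 0 1) \<noteq> \<infinity>" unfolding eq by simp
qed

lemma sigma_finite_PiM_lborel:
  "finite I \<Longrightarrow> sigma_finite_measure (\<Pi>\<^sub>M i\<in>I. (lborel :: real measure))"
proof -
  assume "finite I"
  interpret product_sigma_finite "\<lambda>i. lborel :: real measure" by standard
  show ?thesis by (rule sigma_finite[OF \<open>finite I\<close>])
qed

lemma coord_measure_swap:
  fixes B C :: "'a::euclidean_space set" and f g :: "'a \<Rightarrow> ennreal"
  assumes B: "finite B" and C: "finite C" and sp: "span B = span C"
    and f [measurable]: "f \<in> borel_measurable borel"
    and g [measurable]: "g \<in> borel_measurable borel"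
  shows "nn_integral (coord_measure B) f * nn_integral (coord_measure C) g =
         nn_integral (coord_measure C) f * nn_integral (coord_measure B) (\<lambda>x. g (- x))"
proof -
  let ?P = "\<Pi>\<^sub>M b\<in>B. (lborel :: real measure)"
  let ?Q = "\<Pi>\<^sub>M b\<in>C. (lborel :: real measure)"
  let ?s = "\<lambda>f. \<Sum>b\<in>B. f b *\<^sub>R b" and ?t = "\<lambda>f. \<Sum>b\<in>C. f b *\<^sub>R b"
  let ?\<mu> = "coord_measure B" and ?\<nu> = "coord_measure C"
  interpret P: sigma_finite_measure ?P by (rule sigma_finite_PiM_lborel[OF B])
  interpret Q: sigma_finite_measure ?Q by (rule sigma_finite_PiM_lborel[OF C])
  interpret PQ: pair_sigma_finite ?P ?Q ..
  have s: "?s u \<in> span C" for u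
    using sp by (metis (no_types, lifting) span_base span_scale span_sum)
  have t: "?t u \<in> span B" for u
    using sp by (metis (no_types, lifting) span_base span_scale span_sum)
  have iB: "nn_integral ?\<mu> h = nn_integral ?P (\<lambda>u. h (?s u))"
    if "h \<in> borel_measurable borel" for h
    using that by (rule nn_integral_coord_measure)
  have iC: "nn_integral ?\<nu> h = nn_integral ?Q (\<lambda>u. h (?t u))"
    if "h \<in> borel_measurable borel" for h
    using that by (rule nn_integral_coord_measure)
  have 1: "nn_integral ?Q (\<lambda>v. f (?s u) * g (?t v - ?s u)) = f (?s u) * nn_integral ?\<nu> g" for u
  proof -
    have "nn_integral ?Q (\<lambda>v. f (?s u) * g (?t v - ?s u)) = nn_integral ?\<nu> (\<lambda>y. f (?s u) * g (y - ?s u))"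
      by (rule iC[symmetric]) measurable
    also have "\<dots> = f (?s u) * nn_integral ?\<nu> (\<lambda>y. g (y - ?s u))"
      by (rule nn_integral_cmult) (simp add: coord_measure_def)
    also have "nn_integral ?\<nu> (\<lambda>y. g (y - ?s u)) = nn_integral ?\<nu> g"
      using nn_integral_coord_translate[OF C span_neg[OF s] g, of u] by simp
    finally show ?thesis .
  qed
  have 2: "nn_integral ?P (\<lambda>u. f (?s u) * g (?t v - ?s u)) =
           nn_integral ?P (\<lambda>u. f (?t v + ?s u) * g (- ?s u))" for v
  proof -
    let ?h = "\<lambda>x. f x * g (?t v - x)"
    have h: "?h \<in> borel_measurable borel" by measurable
    have "nn_integral ?P (\<lambda>u. ?h (?s u)) = nn_integral ?\<mu> ?h"
      by (rule iB[OF h, symmetric])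
    also have "\<dots> = nn_integral ?\<mu> (\<lambda>x. ?h (?t v + x))"
      by (rule nn_integral_coord_translate[OF B t h, symmetric])
    also have "\<dots> = nn_integral ?P (\<lambda>u. ?h (?t v + ?s u))"
      by (rule iB) measurable
    finally show ?thesis by simp
  qed
  have 3: "nn_integral ?Q (\<lambda>v. f (?t v + ?s u) * g (- ?s u)) = nn_integral ?\<nu> f * g (- ?s u)" for u
  proof -
    have "nn_integral ?Q (\<lambda>v. f (?t v + ?s u) * g (- ?s u)) = nn_integral ?\<nu> (\<lambda>y. f (?s u + y) * g (- ?s u))"
      by (subst iC) (measurable, simp add: add.commute)
    also have "\<dots> = nn_integral ?\<nu> (\<lambda>y. f (?s u + y)) * g (- ?s u)"
      by (rule nn_integral_multc) (simp add: coord_measure_def)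
    also have "nn_integral ?\<nu> (\<lambda>y. f (?s u + y)) = nn_integral ?\<nu> f"
      by (rule nn_integral_coord_translate[OF C s f])
    finally show ?thesis .
  qed
  have "nn_integral ?\<mu> f * nn_integral ?\<nu> g = (\<integral>\<^sup>+ u. f (?s u) * nn_integral ?\<nu> g \<partial>?P)"
    by (subst nn_integral_multc) (measurable, simp add: iB[OF f])
  also have "\<dots> = (\<integral>\<^sup>+ u. (\<integral>\<^sup>+ v. f (?s u) * g (?t v - ?s u) \<partial>?Q) \<partial>?P)"
    by (simp only: 1)
  also have "\<dots> = (\<integral>\<^sup>+ v. (\<integral>\<^sup>+ u. f (?s u) * g (?t v - ?s u) \<partial>?P) \<partial>?Q)"
    by (rule PQ.Fubini'[symmetric]) measurable
  also have "\<dots> = (\<integral>\<^sup>+ v. (\<integral>\<^sup>+ u. f (?t v + ?s u) * g (- ?s u) \<partial>?P) \<partial>?Q)"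
    by (simp only: 2)
  also have "\<dots> = (\<integral>\<^sup>+ u. (\<integral>\<^sup>+ v. f (?t v + ?s u) * g (- ?s u) \<partial>?Q) \<partial>?P)"
    by (rule PQ.Fubini') measurable
  also have "\<dots> = (\<integral>\<^sup>+ u. nn_integral ?\<nu> f * g (- ?s u) \<partial>?P)"
    by (simp only: 3)
  also have "\<dots> = nn_integral ?\<nu> f * (\<integral>\<^sup>+ u. g (- ?s u) \<partial>?P)"
    by (rule nn_integral_cmult) measurable
  also have "(\<integral>\<^sup>+ u. g (- ?s u) \<partial>?P) = nn_integral ?\<mu> (\<lambda>x. g (- x))"
    by (rule iB[symmetric]) measurable
  finally show ?thesis .
qed

lemma coord_measure_eq:
  fixes B C :: "'a::euclidean_space set"
  assumes B: "orthonormal_basis_of B W" and C: "orthonormal_basis_of C W"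
  shows "coord_measure B = coord_measure C"
proof (rule measure_eqI)
  show "sets (coord_measure B) = sets (coord_measure C)" by (simp add: coord_measure_def)
next
  fix A assume "A \<in> sets (coord_measure B)"
  then have A: "A \<in> sets borel" by (simp add: coord_measure_def)
  note finB = orthonormal_basis_of_finite(1)[OF B] and finC = orthonormal_basis_of_finite(1)[OF C]
  have sp: "span B = span C" using B C unfolding orthonormal_basis_of_def by auto
  have sym: "(\<lambda>x::'a. indicator (ball 0 1) (- x) :: ennreal) = indicator (ball 0 1)"
    by (auto simp: indicator_def fun_eq_iff)
  have m: "(indicator S :: 'a \<Rightarrow> ennreal) \<in> borel_measurable borel" if "S \<in> sets borel" for S
    using that by (rule borel_measurable_indicator)
  have i: "nn_integral (coord_measure E) (indicator S) = emeasure (coord_measure E) S"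
    if "S \<in> sets borel" for E S :: "'a set"
    using that by (intro nn_integral_indicator) (simp add: coord_measure_def)
  have b: "ball (0::'a) 1 \<in> sets borel" by simp
  have "emeasure (coord_measure B) A * emeasure (coord_measure C) (ball 0 1) =
        emeasure (coord_measure C) A * emeasure (coord_measure B) (ball 0 1)"
    using coord_measure_swap[OF finB finC sp m[OF A] m[OF b]] unfolding sym i[OF A] i[OF b] .
  also have "emeasure (coord_measure B) (ball 0 1) = emeasure (coord_measure C) (ball 0 1)"
    by (rule coord_measure_ball[OF B C refl])
  finally show "emeasure (coord_measure B) A = emeasure (coord_measure C) A"
    using coord_measure_ball_pos_finite[OF C]
    unfolding mult.commute[of _ "emeasure (coord_measure C) (ball 0 1)"] ennreal_mult_cancel_left
    by simp
qed

lemma subspace_lborel_eq: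
  assumes "orthonormal_basis_of B W"
  shows "subspace_lborel W = distr (\<Pi>\<^sub>M b\<in>B. lborel) borel (\<lambda>f. \<Sum>b\<in>B. f b *\<^sub>R b)"
  unfolding subspace_lborel_def coord_measure_def[symmetric]
  by (rule coord_measure_eq[OF someI[of "\<lambda>B. orthonormal_basis_of B W"]]) fact+

lemma subspace_lborel_UNIV: "subspace_lborel UNIV = lborel"
proof -
  have "orthonormal_basis_of Basis (UNIV :: 'a set)"
    by (auto simp: orthonormal_basis_of_def pairwise_def orthogonal_def inner_not_same_Basis)
  then show ?thesis
    by (rule subspace_lborel_eq[THEN trans, OF _ lborel_eq[symmetric]])
qed

subsection \<open>Invariance under linear isometries\<close>

locale isometry_on =
  fixes f :: "'a::euclidean_space \<Rightarrow> 'b::euclidean_space" and V :: "'a set"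
  assumes linear_f: "linear f" and subspace_V: "subspace V"
    and norm_f: "\<And>x. x \<in> V \<Longrightarrow> norm (f x) = norm x"
begin

lemma compact_image: "compact S \<Longrightarrow> compact (f ` S)"
  using linear_f by (intro compact_continuous_image linear_continuous_on)
    (simp add: linear_conv_bounded_linear)

lemma inner_f: "x \<in> V \<Longrightarrow> y \<in> V \<Longrightarrow> f x \<bullet> f y = x \<bullet> y"
  using norm_f[of x] norm_f[of y] norm_f[of "x + y"] subspace_add[OF subspace_V, of x y]
  by (simp add: dot_norm linear_add[OF linear_f])

lemma inj_f: "inj_on f V"
proof (rule inj_onI)
  fix x y assume "x \<in> V" "y \<in> V" "f x = f y"
  then show "x = y"
    using norm_f[of "x - y"] subspace_diff[OF subspace_V, of x y]
    by (simp add: linear_diff[OF linear_f])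
qed

lemma f_in_image_iff: "x \<in> V \<Longrightarrow> K \<subseteq> V \<Longrightarrow> f x \<in> f ` K \<longleftrightarrow> x \<in> K"
  by (rule inj_on_image_mem_iff[OF inj_f])

lemma zero_in_V: "0 \<in> V"
  by (rule subspace_0[OF subspace_V])

lemma f_eq_0_iff: "x \<in> V \<Longrightarrow> f x = 0 \<longleftrightarrow> x = 0"
  using norm_f[of x] by auto

lemma scaleR_in_image_iff:
  assumes "x \<in> V" "K \<subseteq> V"
  shows "a *\<^sub>R f x \<in> f ` K \<longleftrightarrow> a *\<^sub>R x \<in> K"
  using f_in_image_iff[OF subspace_scale[OF subspace_V assms(1)] assms(2), of a]
  by (simp add: linear_scale[OF linear_f])

lemma radial_image: "x \<in> V \<Longrightarrow> K \<subseteq> V \<Longrightarrow> radial (f ` K) (f x) = radial K x"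
  unfolding radial_def by (simp add: scaleR_in_image_iff)

lemma minkowski_functional_image:
  assumes "x \<in> V" "K \<subseteq> V"
  shows "minkowski_functional (f ` K) (f x) = minkowski_functional K x"
proof -
  have "f x \<in> (\<lambda>y. a *\<^sub>R y) ` f ` K \<longleftrightarrow> x \<in> (\<lambda>y. a *\<^sub>R y) ` K" for a
  proof -
    have "(\<lambda>y. a *\<^sub>R y) ` f ` K = f ` (\<lambda>y. a *\<^sub>R y) ` K"
      by (simp add: image_image linear_scale[OF linear_f])
    moreover have "(\<lambda>y. a *\<^sub>R y) ` K \<subseteq> V"
      using assms(2) subspace_scale[OF subspace_V] by auto
    ultimately show ?thesis using f_in_image_iff[OF assms(1)] by simp
  qed
  then show ?thesis unfolding minkowski_functional_def by simp
qed

lemma inverse_isometry: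
  obtains g where "isometry_on g (f ` V)" "\<And>x. x \<in> V \<Longrightarrow> g (f x) = x"
proof -
  obtain g where g: "linear g" "\<forall>x\<in>V. g (f x) = x"
    using linear_exists_left_inverse_on[OF linear_f subspace_V inj_f] by auto
  have "isometry_on g (f ` V)"
    by (rule isometry_on.intro)
       (use g norm_f linear_subspace_image[OF linear_f subspace_V] in auto)
  then show thesis using g that by blast
qed

lemma star_body_in_image:
  assumes "star_body_in V K"
  shows "star_body_in (f ` V) (f ` K)"
proof -
  have K: "compact K" "K \<subseteq> V" "0 \<in> K" "\<And>x. x \<in> K \<Longrightarrow> closed_segment 0 x \<subseteq> K"
      "\<And>x. x \<in> V - {0} \<Longrightarrow> \<exists>a>0. a *\<^sub>R x \<in> K" "continuous_on (V - {0}) (radial K)"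
    using assms unfolding star_body_in_def by auto
  obtain g where g: "isometry_on g (f ` V)" "\<And>x. x \<in> V \<Longrightarrow> g (f x) = x"
    using inverse_isometry by blast
  have f0: "f 0 = 0" by (rule linear_0[OF linear_f])
  have "closed_segment 0 (f x) \<subseteq> f ` K" if "x \<in> K" for x
    using closed_segment_linear_image[OF linear_f, of 0 x] K(4)[OF that] f0 by auto
  moreover have "\<exists>a>0. a *\<^sub>R f x \<in> f ` K" if "x \<in> V" "f x \<noteq> 0" for x
    using K(5)[of x] that f0 scaleR_in_image_iff[OF that(1) K(2)] by auto
  moreover have "continuous_on (f ` V - {0}) (radial (f ` K))"
  proof (rule continuous_on_eq)
    have "linear g" using g(1) by (rule isometry_on.linear_f)
    moreover have "g ` (f ` V - {0}) \<subseteq> V - {0}" using g(2) f0 by auto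
    ultimately show "continuous_on (f ` V - {0}) (radial K \<circ> g)"
      using K(6) linear_continuous_on[of g]
      by (intro continuous_on_compose)
         (auto simp: linear_conv_bounded_linear elim: continuous_on_subset)
  qed (use g(2) K(2) radial_image in auto)
  moreover have "0 \<in> f ` K" using K(3) f0 by (metis imageI)
  ultimately show ?thesis
    using K(2) compact_image[OF K(1)] unfolding star_body_in_def by auto
qed

lemma origin_symmetric_image: "origin_symmetric K \<Longrightarrow> origin_symmetric (f ` K)"
  unfolding origin_symmetric_def by (auto simp: linear_neg[OF linear_f, symmetric])

lemma orthonormal_basis_of_image:
  assumes "orthonormal_basis_of B W" "W \<subseteq> V"
  shows "orthonormal_basis_of (f ` B) (f ` W)"
proof -
  have "B \<subseteq> V" using assms span_superset[of B] unfolding orthonormal_basis_of_def by auto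
  then show ?thesis
    using assms norm_f inner_f linear_span_image[OF linear_f, of B]
    unfolding orthonormal_basis_of_def pairwise_def orthogonal_def by (auto simp: subset_iff)
qed

lemma measure_subspace_lborel_image:
  assumes W: "subspace W" "W \<subseteq> V" and S: "compact S" "S \<subseteq> W"
  shows "measure (subspace_lborel (f ` W)) (f ` S) = measure (subspace_lborel W) S"
proof -
  obtain B where B: "orthonormal_basis_of B W" using orthonormal_basis_of_exists[OF W(1)] .
  have finB: "finite B" by (rule orthonormal_basis_of_finite[OF B])
  have BW: "span B = W" using B unfolding orthonormal_basis_of_def by simp
  have injB: "inj_on f B" using BW W(2) span_superset[of B] inj_f by (meson inj_on_subset order_trans subset_eq)
  have bij: "bij_betw f B (f ` B)" using injB by (simp add: bij_betw_def)
  let ?P = "\<Pi>\<^sub>M b\<in>B. (lborel :: real measure)"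
  let ?Q = "\<Pi>\<^sub>M b\<in>f ` B. (lborel :: real measure)"
  let ?r = "\<lambda>h. \<lambda>b\<in>B. h (f b)"
  have S': "S \<in> sets borel" "f ` S \<in> sets borel"
    using S(1) compact_image[OF S(1)] by (auto intro!: borel_closed compact_imp_closed)
  have r: "?r \<in> ?Q \<rightarrow>\<^sub>M ?P" by (rule measurable_restrict) auto
  have s: "(\<lambda>u. \<Sum>b\<in>B. u b *\<^sub>R b) \<in> borel_measurable ?P" by measurable
  have sW: "(\<Sum>b\<in>B. u b *\<^sub>R b) \<in> W" for u
    unfolding BW[symmetric] by (intro span_sum span_scale span_base)
  have fs: "f (\<Sum>b\<in>B. u (f b) *\<^sub>R b) = (\<Sum>c\<in>f ` B. u c *\<^sub>R c)" for u
    by (simp add: linear_sum[OF linear_f] linear_scale[OF linear_f] sum.reindex[OF injB])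
  have mem: "(\<Sum>c\<in>f ` B. u c *\<^sub>R c) \<in> f ` S \<longleftrightarrow> (\<Sum>b\<in>B. u (f b) *\<^sub>R b) \<in> S" for u
    unfolding fs[symmetric] using f_in_image_iff sW W(2) S(2) by (meson order_trans subsetD)
  have "measure (subspace_lborel W) S =
      measure ?P ((\<lambda>u. \<Sum>b\<in>B. u b *\<^sub>R b) -` S \<inter> space ?P)"
    unfolding subspace_lborel_eq[OF B] by (rule measure_distr[OF s]) (use S' in simp)
  also have "\<dots> = measure (distr ?Q ?P ?r) ((\<lambda>u. \<Sum>b\<in>B. u b *\<^sub>R b) -` S \<inter> space ?P)"
    by (simp only: PiM_lborel_reindex[OF bij finB])
  also have "\<dots> = measure ?Q (?r -` ((\<lambda>u. \<Sum>b\<in>B. u b *\<^sub>R b) -` S \<inter> space ?P) \<inter> space ?Q)"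
    by (rule measure_distr[OF r measurable_sets[OF s]]) (use S' in simp)
  also have "\<dots> = measure ?Q ((\<lambda>u. \<Sum>c\<in>f ` B. u c *\<^sub>R c) -` f ` S \<inter> space ?Q)"
    by (intro arg_cong[where f="measure ?Q"] set_eqI)
       (use measurable_space[OF r] mem in \<open>simp, blast\<close>)
  also have "\<dots> = measure (subspace_lborel (f ` W)) (f ` S)"
    unfolding subspace_lborel_eq[OF orthonormal_basis_of_image[OF B W(2)]]
    by (rule measure_distr[symmetric]) (use S' in \<open>auto intro: coord_sum_measurable\<close>)
  finally show ?thesis ..
qed

lemma is_intersection_body_of_in_image:
  assumes "is_intersection_body_of_in V K L"
  shows "is_intersection_body_of_in (f ` V) (f ` K) (f ` L)"
proof -
  have K: "star_body_in V K" "origin_symmetric K" and L: "star_body_in V L" "origin_symmetric L"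
    and eq: "\<And>\<xi>. \<xi> \<in> V \<Longrightarrow> norm \<xi> = 1 \<Longrightarrow> inverse (minkowski_functional K \<xi>) =
        measure (subspace_lborel (V \<inter> {x. orthogonal \<xi> x})) (L \<inter> {x. orthogonal \<xi> x})"
    using assms unfolding is_intersection_body_of_in_def by auto
  have KL: "K \<subseteq> V" "L \<subseteq> V" "compact L" using K L unfolding star_body_in_def by auto
  have "inverse (minkowski_functional (f ` K) (f \<xi>)) =
      measure (subspace_lborel (f ` V \<inter> {x. orthogonal (f \<xi>) x})) (f ` L \<inter> {x. orthogonal (f \<xi>) x})"
    if \<xi>: "\<xi> \<in> V" "norm \<xi> = 1" for \<xi>
  proof -
    have im: "f ` A \<inter> {x. orthogonal (f \<xi>) x} = f ` (A \<inter> {x. orthogonal \<xi> x})" if "A \<subseteq> V" for A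
      using that inner_f[OF \<xi>(1)] unfolding orthogonal_def by auto
    have "subspace (V \<inter> {x. orthogonal \<xi> x})"
      by (intro subspace_inter subspace_V subspace_orthogonal_to_vector)
    moreover have "compact (L \<inter> {x. orthogonal \<xi> x})"
      using KL(3) closed_hyperplane[of \<xi> 0] unfolding orthogonal_def by (rule compact_Int_closed)
    ultimately show ?thesis
      unfolding im[OF order_refl] im[OF KL(2)] minkowski_functional_image[OF \<xi>(1) KL(1)] eq[OF \<xi>]
      by (intro measure_subspace_lborel_image[symmetric]) (use KL in auto)
  qed
  then show ?thesis
    using K L star_body_in_image origin_symmetric_image norm_f
    unfolding is_intersection_body_of_in_def by auto
qed

lemma radial_dist_image:
  assumes "K \<subseteq> V" "L \<subseteq> V"
  shows "radial_dist (f ` V) (f ` K) (f ` L) = radial_dist V K L"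
proof -
  have "sphere 0 1 \<inter> f ` V = f ` (sphere 0 1 \<inter> V)" using norm_f by auto
  then show ?thesis
    unfolding radial_dist_def using assms by (simp add: image_image radial_image cong: image_cong_simp)
qed

lemma intersection_body_in_image:
  assumes "intersection_body_in V K"
  shows "intersection_body_in (f ` V) (f ` K)"
proof -
  have K: "star_body_in V K" using assms unfolding intersection_body_in_def by blast
  have "\<exists>K' L. is_intersection_body_of_in (f ` V) K' L \<and> radial_dist (f ` V) (f ` K) K' < \<epsilon>"
    if "\<epsilon> > 0" for \<epsilon>
  proof -
    obtain K' L where *: "is_intersection_body_of_in V K' L" "radial_dist V K K' < \<epsilon>"
      using assms \<open>\<epsilon> > 0\<close> unfolding intersection_body_in_def by meson
    have "K \<subseteq> V" "K' \<subseteq> V"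
      using K *(1) unfolding is_intersection_body_of_in_def star_body_in_def by auto
    then show ?thesis
      using is_intersection_body_of_in_image[OF *(1)] *(2) radial_dist_image by metis
  qed
  then show ?thesis
    using star_body_in_image[OF K] unfolding intersection_body_in_def by blast
qed

end

theorem intersection_body_in_isometry:
  assumes "linear f" "subspace V" "\<And>x. x \<in> V \<Longrightarrow> norm (f x) = norm x" "K \<subseteq> V"
  shows "intersection_body_in (f ` V) (f ` K) \<longleftrightarrow> intersection_body_in V K"
proof
  interpret isometry_on f V using assms(1-3) by (rule isometry_on.intro)
  show "intersection_body_in V K \<Longrightarrow> intersection_body_in (f ` V) (f ` K)"
    by (rule intersection_body_in_image)
  assume *: "intersection_body_in (f ` V) (f ` K)"
  obtain g where g: "isometry_on g (f ` V)" "\<And>x. x \<in> V \<Longrightarrow> g (f x) = x"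
    using inverse_isometry by blast
  have "g ` f ` A = A" if "A \<subseteq> V" for A
    using g(2) that by (force simp: image_image)
  then show "intersection_body_in V K"
    using isometry_on.intersection_body_in_image[OF g(1) *] assms(4) by simp
qed

end

theory Submission
  imports Defs
begin

text \<open>
  For \<open>\<delta> > 0\<close> and \<open>a\<close> large let \<open>K\<close> be the body of revolution with radial function
  \<open>\<rho>\<^sub>K(x) = |x|\<^sup>-\<^sup>1 - \<delta> (|x|\<^sup>2 + (a\<^sup>2 - 1) \<langle>x, e\<rangle>\<^sup>2)\<^sup>-\<^sup>1\<^sup>/\<^sup>2\<close>, where \<open>e\<close> is a unit vector.
  Both terms are section functions: in a space of dimension \<open>m\<close> that contains \<open>e\<close>, the function
  \<open>(1 + (a\<^sup>2 - 1) \<langle>\<xi>, e\<rangle>\<^sup>2)\<^sup>-\<^sup>1\<^sup>/\<^sup>2\<close> of the unit vector \<open>\<xi>\<close> is proportional to the volume of the section by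
  \<open>\<xi>\<^sup>\<bottom>\<close> of the ellipsoid that is elongated by the factor \<open>a\<close> along \<open>e\<close>. Since the volume of a central
  section of \<open>L\<close> is proportional to the integral of \<open>\<rho>\<^sub>L\<^sup>m\<^sup>-\<^sup>1\<close> over a great sphere, \<open>K\<close> is formally the
  intersection body of an \<open>L\<close> with \<open>\<rho>\<^sub>L\<^sup>m\<^sup>-\<^sup>1\<close> proportional to a function, called the density below, that is
  smallest at the pole \<open>e\<close>, where it equals \<open>1 - \<delta> a\<^sup>m\<^sup>-\<^sup>2\<close>. So \<open>\<delta>\<close> is chosen between \<open>a\<^sup>-\<^sup>(\<^sup>n\<^sup>-\<^sup>2\<^sup>)\<close> and
  \<open>a\<^sup>-\<^sup>(\<^sup>n\<^sup>-\<^sup>3\<^sup>)\<close>.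

  For a hyperplane \<open>V\<close> we have \<open>m = n - 1\<close>, and \<open>\<rho>\<^sub>K\<close> restricted to \<open>V\<close> has the same form, with \<open>e\<close>
  replaced by the direction of its projection to \<open>V\<close> and \<open>a\<close> by a number in \<open>[1, a]\<close>. Hence the density
  is positive and \<open>K \<inter> V\<close> is the intersection body
  of an explicit star body (\<open>dented_is_intersection_body\<close>). What has to be shown is that the volume of
  a section of \<open>L\<close> is linear in \<open>\<rho>\<^sub>L\<^sup>m\<^sup>-\<^sup>1\<close>; instead of polar coordinates this uses the integral of a
  homogeneous function over a spherical shell (\<open>nn_integral_homogeneous_shell\<close>).

  In dimension \<open>n\<close> the density is negative near the pole. To see that this excludes approximation by
  intersection bodies of star bodies, the density is tested against \<open>cos\<^sup>2\<^sup>k\<close> of the angle to \<open>e\<close>. This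
  function is itself the Radon transform of a polynomial in the cosine, and the Radon transform is
  symmetric (\<open>section_transform_symmetric\<close>), so the integral against the density is a continuous
  functional of \<open>\<rho>\<^sub>K\<close> which is nonnegative on intersection bodies
  (\<open>axial_moment_le_if_intersection_body\<close>). For large \<open>k\<close> the test function concentrates at the pole and
  the functional becomes negative at \<open>K\<close> (\<open>axial_moment_ball_le_thin_ellipsoid\<close>).

  Finally, \<open>K\<close> is convex as soon as \<open>\<delta> (a\<^sup>2 + 1) \<le> 1\<close> (\<open>convex_dented\<close>). This is compatible with
  \<open>\<delta> > a\<^sup>-\<^sup>(\<^sup>n\<^sup>-\<^sup>2\<^sup>)\<close> for large \<open>a\<close> because \<open>n \<ge> 5\<close>.
\<close>

section \<open>Integration on subspaces\<close>

lemma sets_subspace_lborel [simp, measurable_cong]: "sets (subspace_lborel W) = sets borel"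
  by (simp add: subspace_lborel_def coord_measure_def)

lemma space_subspace_lborel [simp]: "space (subspace_lborel W) = UNIV"
  by (simp add: subspace_lborel_def coord_measure_def)

lemma nn_integral_subspace_lborel:
  assumes "orthonormal_basis_of B W" "h \<in> borel_measurable borel"
  shows "nn_integral (subspace_lborel W) h =
    (\<integral>\<^sup>+ f. h (\<Sum>b\<in>B. f b *\<^sub>R b) \<partial>(\<Pi>\<^sub>M b\<in>B. (lborel :: real measure)))"
  unfolding subspace_lborel_eq[OF assms(1)]
  by (rule nn_integral_coord_measure[OF assms(2), unfolded coord_measure_def])

abbreviation perp_in :: "'a::euclidean_space set \<Rightarrow> 'a \<Rightarrow> 'a set" where
  "perp_in V x \<equiv> V \<inter> {y. orthogonal x y}"

lemma subspace_perp_in: "subspace V \<Longrightarrow> subspace (perp_in V x)"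
  by (intro subspace_inter subspace_orthogonal_to_vector)

lemma orthonormal_basis_insert:
  assumes V: "subspace V" and b: "b \<in> V" "norm b = 1"
    and B: "orthonormal_basis_of B (perp_in V b)"
  shows "orthonormal_basis_of (insert b B) V" "b \<notin> B"
proof -
  have BP: "B \<subseteq> perp_in V b" using B span_superset[of B] unfolding orthonormal_basis_of_def by auto
  show "b \<notin> B"
    using BP b by (auto simp: orthogonal_def)
  have "span (insert b B) = V"
  proof
    show "span (insert b B) \<subseteq> V"
      using V BP b by (intro span_minimal) auto
    show "V \<subseteq> span (insert b B)"
    proof
      fix x assume x: "x \<in> V"
      have "x - (b \<bullet> x) *\<^sub>R b \<in> perp_in V b"
        using V b x by (auto simp: orthogonal_def inner_diff_right norm_eq_1 subspace_diff subspace_scale)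
      then have "x - (b \<bullet> x) *\<^sub>R b \<in> span B" using B unfolding orthonormal_basis_of_def by auto
      then show "x \<in> span (insert b B)" unfolding span_insert by blast
    qed
  qed
  then show "orthonormal_basis_of (insert b B) V"
    using B BP b unfolding orthonormal_basis_of_def pairwise_insert
    by (auto simp: orthogonal_commute)
qed

lemma dim_perp_in:
  assumes "subspace V" "b \<in> V" "b \<noteq> 0"
  shows "dim V = Suc (dim (perp_in V b))"
proof -
  let ?b = "b /\<^sub>R norm b"
  have P: "perp_in V b = perp_in V ?b" using assms by (auto simp: orthogonal_def)
  obtain B where B: "orthonormal_basis_of B (perp_in V ?b)"
    using orthonormal_basis_of_exists[OF subspace_perp_in[OF assms(1)]] .
  have "?b \<in> V" "norm ?b = 1" using assms by (auto simp: subspace_scale)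
  from orthonormal_basis_insert[OF assms(1) this B] show ?thesis
    unfolding P using orthonormal_basis_of_finite[OF B]
    by (metis card_insert_disjoint orthonormal_basis_of_finite(2))
qed

text \<open>Fubini for \<open>V = b\<^sup>\<bottom> \<oplus> \<real> b\<close>; nearly everything below about Lebesgue measure on subspaces is
  obtained by splitting off a well chosen direction.\<close>

lemma nn_integral_subspace_split:
  assumes V: "subspace V" and b: "b \<in> V" "norm b = 1"
    and h [measurable]: "h \<in> borel_measurable borel"
  shows "nn_integral (subspace_lborel V) h =
    (\<integral>\<^sup>+ y. (\<integral>\<^sup>+ s. h (y + s *\<^sub>R b) \<partial>lborel) \<partial>subspace_lborel (perp_in V b))"
proof -
  interpret product_sigma_finite "\<lambda>b. lborel :: real measure" by standard
  obtain B where B: "orthonormal_basis_of B (perp_in V b)"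
    using orthonormal_basis_of_exists[OF subspace_perp_in[OF V]] .
  note I = orthonormal_basis_insert[OF V b B] and fin = orthonormal_basis_of_finite(1)[OF B]
  have s: "(\<Sum>c\<in>insert b B. (f(b := s)) c *\<^sub>R c) = (\<Sum>c\<in>B. f c *\<^sub>R c) + s *\<^sub>R b" for f s
  proof -
    have "(\<Sum>c\<in>B. (f(b := s)) c *\<^sub>R c) = (\<Sum>c\<in>B. f c *\<^sub>R c)"
      using I(2) by (intro sum.cong) auto
    then show ?thesis using fin I(2) by (simp add: add.commute)
  qed
  have "nn_integral (subspace_lborel V) h =
     (\<integral>\<^sup>+ f. (\<integral>\<^sup>+ s. h (\<Sum>c\<in>insert b B. (f(b := s)) c *\<^sub>R c) \<partial>lborel) \<partial>(\<Pi>\<^sub>M b\<in>B. lborel))"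
    unfolding nn_integral_subspace_lborel[OF I(1) h]
    by (rule product_nn_integral_insert[OF fin I(2)]) measurable
  also have "\<dots> = (\<integral>\<^sup>+ f. (\<integral>\<^sup>+ s. h ((\<Sum>c\<in>B. f c *\<^sub>R c) + s *\<^sub>R b) \<partial>lborel) \<partial>(\<Pi>\<^sub>M b\<in>B. lborel))"
    unfolding s ..
  also have "\<dots> = (\<integral>\<^sup>+ y. (\<integral>\<^sup>+ s. h (y + s *\<^sub>R b) \<partial>lborel) \<partial>subspace_lborel (perp_in V b))"
    by (subst nn_integral_subspace_lborel[OF B]) simp_all
  finally show ?thesis .
qed

lemma nn_integral_subspace_zero:
  assumes "h \<in> borel_measurable borel"
  shows "nn_integral (subspace_lborel {0}) h = h 0"
proof -
  have "orthonormal_basis_of {} ({0} :: 'a set)" by (simp add: orthonormal_basis_of_def)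
  from nn_integral_subspace_lborel[OF this assms] show ?thesis
    by (simp add: PiM_empty nn_integral_count_space_finite)
qed

lemma subspace_unit_vector:
  fixes V :: "'a::euclidean_space set"
  assumes "subspace V" "dim V > 0"
  obtains b where "b \<in> V" "norm b = 1"
proof -
  have "\<not> V \<subseteq> {0}" using assms(2) dim_eq_0[of V] by (metis less_irrefl)
  then obtain x where x: "x \<in> V" "x \<noteq> 0" by auto
  show thesis by (rule that[of "x /\<^sub>R norm x"]) (use x assms in \<open>auto simp: subspace_scale\<close>)
qed

lemma subspace_induct [consumes 1, case_names zero perp]:
  fixes V :: "'a::euclidean_space set"
  assumes V: "subspace V" and 0: "P {0}"
    and step: "\<And>V b. subspace V \<Longrightarrow> b \<in> V \<Longrightarrow> norm b = 1 \<Longrightarrow> P (perp_in V b) \<Longrightarrow> P V"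
  shows "P V"
  using V
proof (induction "dim V" arbitrary: V)
  case 0
  then have "V = {0}" using subspace_0 by (metis dim_eq_0 subset_singletonD empty_iff)
  then show ?case using assms(2) by simp
next
  case (Suc n)
  then obtain b where b: "b \<in> V" "norm b = 1" using subspace_unit_vector by (metis zero_less_Suc)
  have "dim V = Suc (dim (perp_in V b))" by (rule dim_perp_in) (use Suc b in auto)
  then have "P (perp_in V b)" using Suc.hyps by (intro Suc.hyps(1) subspace_perp_in Suc.prems) simp
  then show ?case by (rule step[OF Suc.prems b])
qed

lemma AE_subspace_lborel:
  assumes V: "subspace V"
  shows "AE x in subspace_lborel V. x \<in> V"
proof -
  obtain B where B: "orthonormal_basis_of B V" using orthonormal_basis_of_exists[OF V] .
  have cl [measurable]: "V \<in> sets borel" using V by (simp add: closed_subspace)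
  have sp: "span B = V" using B unfolding orthonormal_basis_of_def by simp
  have "(\<Sum>b\<in>B. f b *\<^sub>R b) \<in> V" for f
    unfolding sp[symmetric] by (intro span_sum span_scale span_base)
  moreover have m: "{x \<in> space borel. x \<in> V} \<in> sets borel" using cl by simp
  ultimately show ?thesis
    unfolding subspace_lborel_eq[OF B] AE_distr_iff[OF coord_sum_measurable m]
    by (intro AE_I2) simp
qed

lemma nn_integral_subspace_cong:
  assumes "subspace V" "\<And>x. x \<in> V \<Longrightarrow> g x = h x"
  shows "nn_integral (subspace_lborel V) g = nn_integral (subspace_lborel V) h"
  using AE_subspace_lborel[OF assms(1)] by (intro nn_integral_cong_AE) (auto simp: assms(2))

lemma nn_integral_subspace_scale:
  assumes V: "subspace V" and "h \<in> borel_measurable borel" and c: "c > 0"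
  shows "nn_integral (subspace_lborel V) h =
    ennreal (c ^ dim V) * (\<integral>\<^sup>+ x. h (c *\<^sub>R x) \<partial>subspace_lborel V)"
  using V assms(2)
proof (induction V arbitrary: h rule: subspace_induct)
  case zero
  then show ?case by (simp add: nn_integral_subspace_zero)
next
  case (perp V b)
  note [measurable] = perp.prems
  have s: "(\<integral>\<^sup>+ s. h (y + s *\<^sub>R b) \<partial>lborel) = c * (\<integral>\<^sup>+ s. h (y + (c * s) *\<^sub>R b) \<partial>lborel)" for y
    by (subst nn_integral_real_affine[where c = c and t = 0]) (use c in auto)
  have d: "dim V = Suc (dim (perp_in V b))" by (rule dim_perp_in) (use perp in auto)
  have "nn_integral (subspace_lborel V) h =
     (\<integral>\<^sup>+ y. c * (\<integral>\<^sup>+ s. h (y + (c * s) *\<^sub>R b) \<partial>lborel) \<partial>subspace_lborel (perp_in V b))"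
    unfolding s[symmetric] by (rule nn_integral_subspace_split) fact+
  also have "\<dots> = ennreal (c ^ dim (perp_in V b)) *
     (\<integral>\<^sup>+ y. c * (\<integral>\<^sup>+ s. h (c *\<^sub>R y + (c * s) *\<^sub>R b) \<partial>lborel) \<partial>subspace_lborel (perp_in V b))"
    by (rule perp.IH) measurable
  also have "\<dots> = ennreal (c ^ dim (perp_in V b)) *
     (c * (\<integral>\<^sup>+ y. (\<integral>\<^sup>+ s. h (c *\<^sub>R (y + s *\<^sub>R b)) \<partial>lborel) \<partial>subspace_lborel (perp_in V b)))"
    by (subst nn_integral_cmult) (auto simp: scaleR_right_distrib)
  also have "\<dots> = ennreal (c ^ dim V) * (\<integral>\<^sup>+ x. h (c *\<^sub>R x) \<partial>subspace_lborel V)"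
    unfolding d using c
    by (subst nn_integral_subspace_split[OF perp.hyps]) (auto simp: ennreal_mult mult_ac)
  finally show ?case .
qed

text \<open>A radial function has the same integral over all subspaces of the same dimension.
  The recursion makes this integral a function of the dimension alone.\<close>

primrec radial_integral :: "nat \<Rightarrow> (real \<Rightarrow> ennreal) \<Rightarrow> ennreal" where
  "radial_integral 0 g = g 0"
| "radial_integral (Suc d) g = radial_integral d (\<lambda>q. \<integral>\<^sup>+ s. g (q + s\<^sup>2) \<partial>lborel)"

lemma norm_add_orthogonal_unit:
  assumes "orthogonal b y" "norm b = 1"
  shows "(norm (y + s *\<^sub>R b))\<^sup>2 = (norm y)\<^sup>2 + s\<^sup>2"
  using assms norm_add_Pythagorean[of y "s *\<^sub>R b"] by (simp add: orthogonal_def inner_commute)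

lemma nn_integral_subspace_radial:
  assumes "subspace V" "g \<in> borel_measurable borel"
  shows "(\<integral>\<^sup>+ x. g ((norm x)\<^sup>2) \<partial>subspace_lborel V) = radial_integral (dim V) g"
  using assms
proof (induction V arbitrary: g rule: subspace_induct)
  case zero
  then show ?case by (simp add: nn_integral_subspace_zero)
next
  case (perp V b)
  note [measurable] = perp.prems
  have d: "dim V = Suc (dim (perp_in V b))" by (rule dim_perp_in) (use perp in auto)
  have "(\<integral>\<^sup>+ x. g ((norm x)\<^sup>2) \<partial>subspace_lborel V) =
     (\<integral>\<^sup>+ y. (\<integral>\<^sup>+ s. g ((norm (y + s *\<^sub>R b))\<^sup>2) \<partial>lborel) \<partial>subspace_lborel (perp_in V b))"
    by (rule nn_integral_subspace_split) (use perp in measurable)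
  also have "\<dots> = (\<integral>\<^sup>+ y. (\<integral>\<^sup>+ s. g ((norm y)\<^sup>2 + s\<^sup>2) \<partial>lborel) \<partial>subspace_lborel (perp_in V b))"
    by (rule nn_integral_subspace_cong)
       (use perp in \<open>auto simp: norm_add_orthogonal_unit subspace_perp_in\<close>)
  also have "\<dots> = radial_integral (dim V) g"
    unfolding d radial_integral.simps by (rule perp.IH) measurable
  finally show ?case .
qed

definition ball_volume :: "nat \<Rightarrow> ennreal" where
  "ball_volume d = radial_integral d (indicator {..1})"

lemma emeasure_subspace_cball:
  assumes "subspace V"
  shows "emeasure (subspace_lborel V) (cball 0 1) = ball_volume (dim V)"
proof -
  have "emeasure (subspace_lborel V) (cball 0 1) = (\<integral>\<^sup>+ x. indicator (cball 0 1) x \<partial>subspace_lborel V)"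
    by simp
  also have "\<dots> = (\<integral>\<^sup>+ x. indicator {..1} ((norm x)\<^sup>2) \<partial>subspace_lborel V)"
    by (intro nn_integral_cong) (auto simp: indicator_def abs_square_le_1)
  finally show ?thesis
    unfolding ball_volume_def using assms by (subst (asm) nn_integral_subspace_radial) auto
qed

lemma emeasure_subspace_cball_scale:
  assumes "subspace V" "c > 0"
  shows "emeasure (subspace_lborel V) (cball 0 c) = ennreal (c ^ dim V) * emeasure (subspace_lborel V) (cball 0 1)"
proof -
  have "emeasure (subspace_lborel V) (cball 0 c) = (\<integral>\<^sup>+ x. indicator (cball 0 c) x \<partial>subspace_lborel V)"
    by simp
  also have "\<dots> = ennreal (c ^ dim V) * (\<integral>\<^sup>+ x. indicator (cball 0 c) (c *\<^sub>R x) \<partial>subspace_lborel V)"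
    by (rule nn_integral_subspace_scale[OF assms(1) _ assms(2)]) (intro borel_measurable_indicator, simp)
  also have "(\<integral>\<^sup>+ x. indicator (cball 0 c) (c *\<^sub>R x) \<partial>subspace_lborel V) =
     (\<integral>\<^sup>+ x. indicator (cball 0 1) x \<partial>subspace_lborel V)"
    using assms by (intro nn_integral_cong) (auto simp: indicator_def)
  finally show ?thesis by simp
qed

lemma emeasure_subspace_ball_1:
  assumes "subspace V"
  shows "emeasure (subspace_lborel V) (ball 0 1) \<noteq> 0" "emeasure (subspace_lborel V) (ball 0 1) \<noteq> \<infinity>"
proof -
  obtain B where B: "orthonormal_basis_of B V" using orthonormal_basis_of_exists[OF assms] .
  show "emeasure (subspace_lborel V) (ball 0 1) \<noteq> 0" "emeasure (subspace_lborel V) (ball 0 1) \<noteq> \<infinity>"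
    using coord_measure_ball_pos_finite[OF B] unfolding subspace_lborel_eq[OF B] coord_measure_def
    by auto
qed

lemma emeasure_subspace_cball_finite:
  assumes "subspace V" "c > 0"
  shows "emeasure (subspace_lborel V) (cball 0 c) < \<infinity>"
proof -
  have "emeasure (subspace_lborel V) (cball 0 (1/2)) \<le> emeasure (subspace_lborel V) (ball 0 1)"
    by (intro emeasure_mono) auto
  then have "emeasure (subspace_lborel V) (cball 0 (1/2)) < \<infinity>"
    using emeasure_subspace_ball_1(2)[OF assms(1)] by (auto simp: top.not_eq_extremum dest: le_less_trans)
  then have "emeasure (subspace_lborel V) (cball 0 1) < \<infinity>"
    using emeasure_subspace_cball_scale[OF assms(1), of "1/2"]
    by (auto simp: ennreal_mult_less_top ennreal_mult_eq_top_iff top.not_eq_extremum)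
  then show ?thesis
    unfolding emeasure_subspace_cball_scale[OF assms] by (auto simp: ennreal_mult_less_top)
qed

lemma emeasure_subspace_bounded:
  assumes "subspace V" "bounded S"
  shows "emeasure (subspace_lborel V) S < \<infinity>"
proof -
  obtain c where c: "c > 0" "S \<subseteq> cball 0 c"
    using assms(2) by (metis bounded_pos mem_cball_0 subsetI)
  have "emeasure (subspace_lborel V) S \<le> emeasure (subspace_lborel V) (cball 0 c)"
    using c by (intro emeasure_mono) auto
  then show ?thesis using emeasure_subspace_cball_finite[OF assms(1) c(1)] by (auto dest: le_less_trans)
qed

lemma ball_volume_pos_finite:
  fixes V :: "'a::euclidean_space set"
  assumes "subspace V"
  shows "ball_volume (dim V) \<noteq> 0" "ball_volume (dim V) \<noteq> \<infinity>"
proof -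
  have "emeasure (subspace_lborel V) (ball 0 1) \<le> emeasure (subspace_lborel V) (cball 0 1)"
    by (intro emeasure_mono) auto
  then show "ball_volume (dim V) \<noteq> 0" "ball_volume (dim V) \<noteq> \<infinity>"
    using emeasure_subspace_ball_1(1)[OF assms] emeasure_subspace_cball_finite[OF assms, of 1]
    unfolding emeasure_subspace_cball[OF assms] by auto
qed

lemma sigma_finite_subspace_lborel:
  fixes V :: "'a::euclidean_space set"
  assumes "subspace V"
  shows "sigma_finite_measure (subspace_lborel V)"
proof (rule sigma_finite_measure.intro, intro exI conjI)
  let ?C = "\<lambda>n. cball (0::'a) (real (Suc n))"
  show "countable (range ?C)" by simp
  show "range ?C \<subseteq> sets (subspace_lborel V)" by auto
  have "\<exists>n. x \<in> ?C n" for x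
  proof -
    obtain n where "norm x < real n" using reals_Archimedean2 by blast
    then show ?thesis by (intro exI[of _ n]) simp
  qed
  then show "\<Union> (range ?C) = space (subspace_lborel V)" by auto
  show "\<forall>a\<in>range ?C. emeasure (subspace_lborel V) a \<noteq> \<infinity>"
  proof
    fix a assume "a \<in> range ?C"
    then obtain n where a: "a = ?C n" by blast
    show "emeasure (subspace_lborel V) a \<noteq> \<infinity>"
      unfolding a using emeasure_subspace_cball_finite[OF assms, of "real (Suc n)"] by simp
  qed
qed

text \<open>Lines in the direction of \<open>b\<close> meet the hyperplane \<open>b\<^sup>\<bottom>\<close> in a single point.\<close>

lemma AE_subspace_hyperplane:
  fixes V :: "'a::euclidean_space set"
  assumes V: "subspace V" and b: "b \<in> V" "b \<noteq> 0"
  shows "AE x in subspace_lborel V. b \<bullet> x \<noteq> 0"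
proof -
  let ?b = "b /\<^sub>R norm b" and ?N = "{x. b \<bullet> x = 0}"
  have [measurable]: "?N \<in> sets borel" by measurable
  have b': "?b \<in> V" "norm ?b = 1" using V b by (auto simp: subspace_scale)
  have "emeasure (subspace_lborel V) ?N = (\<integral>\<^sup>+ x. indicator ?N x \<partial>subspace_lborel V)"
    by simp
  also have "\<dots> = (\<integral>\<^sup>+ y. (\<integral>\<^sup>+ s. indicator ?N (y + s *\<^sub>R ?b) \<partial>lborel) \<partial>subspace_lborel (perp_in V ?b))"
    by (rule nn_integral_subspace_split[OF V b']) measurable
  also have "\<dots> = (\<integral>\<^sup>+ y. (\<integral>\<^sup>+ s. indicator {0} s \<partial>(lborel :: real measure)) \<partial>subspace_lborel (perp_in V ?b))"
    by (rule nn_integral_subspace_cong[OF subspace_perp_in[OF V]])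
       (use b in \<open>auto simp: orthogonal_def inner_add_right indicator_def intro!: nn_integral_cong\<close>)
  finally have "emeasure (subspace_lborel V) ?N = 0" by simp
  then show ?thesis
    by (intro AE_I[of _ _ ?N]) auto
qed

section \<open>Ellipsoids, moments and homogeneous functions\<close>

lemma subspace_direction:
  fixes z :: "'a::euclidean_space"
  assumes "subspace W" "dim W > 0" "z \<in> W"
  obtains b where "b \<in> W" "norm b = 1" "z = norm z *\<^sub>R b"
proof (cases "z = 0")
  case True
  obtain b where "b \<in> W" "norm b = 1" using subspace_unit_vector[OF assms(1,2)] .
  then show thesis using that True by simp
next
  case False
  show thesis
    by (rule that[of "z /\<^sub>R norm z"]) (use False assms in \<open>auto simp: subspace_scale\<close>)
qed

text \<open>Splitting off the direction of \<open>z\<close> turns a function of \<open>\<langle>x, z\<rangle>\<close> and \<open>|x|\<close> into a function of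
  two variables.\<close>

lemma nn_integral_subspace_axial:
  fixes z :: "'a::euclidean_space"
  assumes W: "subspace W" "dim W > 0" and z: "z \<in> W"
    and [measurable]: "(\<lambda>(t, q). g t q) \<in> borel_measurable (borel \<Otimes>\<^sub>M borel)"
  shows "(\<integral>\<^sup>+ x. g (x \<bullet> z) ((norm x)\<^sup>2) \<partial>subspace_lborel W) =
    radial_integral (dim W - 1) (\<lambda>q. \<integral>\<^sup>+ s. g (norm z * s) (q + s\<^sup>2) \<partial>lborel)"
proof -
  obtain b where b: "b \<in> W" "norm b = 1" "z = norm z *\<^sub>R b" using subspace_direction[OF W z] .
  have d: "dim W = Suc (dim (perp_in W b))" by (rule dim_perp_in) (use W b in auto)
  have "(\<integral>\<^sup>+ x. g (x \<bullet> z) ((norm x)\<^sup>2) \<partial>subspace_lborel W) =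
    (\<integral>\<^sup>+ y. (\<integral>\<^sup>+ s. g ((y + s *\<^sub>R b) \<bullet> z) ((norm (y + s *\<^sub>R b))\<^sup>2) \<partial>lborel) \<partial>subspace_lborel (perp_in W b))"
    by (rule nn_integral_subspace_split[OF W(1) b(1,2)]) measurable
  also have "\<dots> = (\<integral>\<^sup>+ y. (\<integral>\<^sup>+ s. g (norm z * s) ((norm y)\<^sup>2 + s\<^sup>2) \<partial>lborel) \<partial>subspace_lborel (perp_in W b))"
  proof (rule nn_integral_subspace_cong[OF subspace_perp_in[OF W(1)]], rule nn_integral_cong)
    fix y s assume y: "y \<in> perp_in W b"
    have "(y + s *\<^sub>R b) \<bullet> z = norm z * s"
    proof -
      have "(y + s *\<^sub>R b) \<bullet> b = s"
        using y b(2) by (simp add: orthogonal_def inner_add_left inner_commute[of y b] norm_eq_1)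
      then show ?thesis by (subst b(3)) simp
    qed
    moreover have "(norm (y + s *\<^sub>R b))\<^sup>2 = (norm y)\<^sup>2 + s\<^sup>2"
      using y b(2) by (intro norm_add_orthogonal_unit) auto
    ultimately show "g ((y + s *\<^sub>R b) \<bullet> z) ((norm (y + s *\<^sub>R b))\<^sup>2) = g (norm z * s) ((norm y)\<^sup>2 + s\<^sup>2)"
      by simp
  qed
  also have "\<dots> = radial_integral (dim (perp_in W b)) (\<lambda>q. \<integral>\<^sup>+ s. g (norm z * s) (q + s\<^sup>2) \<partial>lborel)"
    by (rule nn_integral_subspace_radial[OF subspace_perp_in[OF W(1)]]) measurable
  finally show ?thesis using d by simp
qed

lemma radial_integral_cmult:
  assumes "g \<in> borel_measurable borel"
  shows "radial_integral d (\<lambda>q. c * g q) = c * radial_integral d g"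
  using assms
proof (induction d arbitrary: g)
  case (Suc d)
  note [measurable] = Suc.prems
  show ?case
    unfolding radial_integral.simps
    by (subst Suc.IH[symmetric]) (auto simp: nn_integral_cmult)
qed simp

text \<open>Rescaling the direction of \<open>z\<close> turns this ellipsoid of revolution into the unit ball.\<close>

lemma emeasure_ellipsoid:
  fixes z :: "'a::euclidean_space"
  assumes W: "subspace W" "dim W > 0" and z: "z \<in> W" and g: "\<gamma> * (norm z)\<^sup>2 < 1"
  shows "emeasure (subspace_lborel W) {x. (norm x)\<^sup>2 - \<gamma> * (x \<bullet> z)\<^sup>2 \<le> 1} =
    ennreal (1 / sqrt (1 - \<gamma> * (norm z)\<^sup>2)) * ball_volume (dim W)"
proof -
  define l where "l = sqrt (1 - \<gamma> * (norm z)\<^sup>2)"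
  have l: "l > 0" "l\<^sup>2 = 1 - \<gamma> * (norm z)\<^sup>2" using g unfolding l_def by auto
  define g where "g t q = (indicator {..1} (q - \<gamma> * t\<^sup>2) :: ennreal)" for t q :: real
  have [measurable]: "{x. (norm x)\<^sup>2 - \<gamma> * (x \<bullet> z)\<^sup>2 \<le> 1} \<in> sets borel" by measurable
  have "emeasure (subspace_lborel W) {x. (norm x)\<^sup>2 - \<gamma> * (x \<bullet> z)\<^sup>2 \<le> 1} =
     (\<integral>\<^sup>+ x. indicator {x. (norm x)\<^sup>2 - \<gamma> * (x \<bullet> z)\<^sup>2 \<le> 1} x \<partial>subspace_lborel W)" by simp
  also have "\<dots> = (\<integral>\<^sup>+ x. g (x \<bullet> z) ((norm x)\<^sup>2) \<partial>subspace_lborel W)"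
    by (intro nn_integral_cong) (auto simp: g_def indicator_def)
  also have "\<dots> = radial_integral (dim W - 1) (\<lambda>q. \<integral>\<^sup>+ s. g (norm z * s) (q + s\<^sup>2) \<partial>lborel)"
    by (rule nn_integral_subspace_axial[OF W z]) (simp add: g_def)
  also have "(\<lambda>q. \<integral>\<^sup>+ s. g (norm z * s) (q + s\<^sup>2) \<partial>lborel) =
      (\<lambda>q. ennreal (1 / l) * (\<integral>\<^sup>+ s. indicator {..1} (q + s\<^sup>2) \<partial>lborel))"
  proof
    fix q
    have "(\<integral>\<^sup>+ s. g (norm z * s) (q + s\<^sup>2) \<partial>lborel) = (\<integral>\<^sup>+ s. indicator {..1} (q + (l * s)\<^sup>2) \<partial>lborel)"
      unfolding g_def power_mult_distrib l(2) by (simp add: algebra_simps)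
    also have "\<dots> = ennreal (1 / l) * (\<integral>\<^sup>+ s. indicator {..1} (q + s\<^sup>2) \<partial>lborel)"
      by (subst nn_integral_real_affine[where c = "1 / l" and t = 0]) (use l in auto)
    finally show "(\<integral>\<^sup>+ s. g (norm z * s) (q + s\<^sup>2) \<partial>lborel) =
      ennreal (1 / l) * (\<integral>\<^sup>+ s. indicator {..1} (q + s\<^sup>2) \<partial>lborel)" .
  qed
  also have "radial_integral (dim W - 1) \<dots> = ennreal (1 / l) *
      radial_integral (dim W - 1) (\<lambda>q. \<integral>\<^sup>+ s. indicator {..1} (q + s\<^sup>2) \<partial>lborel)"
    by (rule radial_integral_cmult) measurable
  also have "radial_integral (dim W - 1) (\<lambda>q. \<integral>\<^sup>+ s. indicator {..1} (q + s\<^sup>2) \<partial>lborel) = ball_volume (dim W)"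
    using W(2) unfolding ball_volume_def by (metis radial_integral.simps(2) Suc_diff_1)
  finally show ?thesis unfolding l_def .
qed

text \<open>A radial weight, as a function of \<open>q = |x|\<^sup>2\<close>. Any weight with finite positive integrals would give
  an identity like \<open>nn_integral_moment\<close>; this one vanishes at the origin to first order, which later
  compensates for the singularity of a function that is homogeneous of degree \<open>-1\<close>.\<close>

definition moment_weight :: "real \<Rightarrow> ennreal" where
  "moment_weight q = ennreal (sqrt q) * indicator {..1} q"

definition moment_const :: "nat \<Rightarrow> nat \<Rightarrow> ennreal" where
  "moment_const d j =
     radial_integral (d - 1) (\<lambda>q. \<integral>\<^sup>+ s. ennreal (s ^ (2 * j)) * moment_weight (q + s\<^sup>2) \<partial>lborel)"

lemma measurable_moment_weight [measurable]: "moment_weight \<in> borel_measurable borel"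
  unfolding moment_weight_def by measurable

text \<open>On \<open>W\<close> only the length of \<open>z\<close> matters, and it enters through homogeneity. For \<open>W = x\<^sup>\<bottom>\<close> and \<open>z\<close> the
  projection of a fixed vector to \<open>W\<close> this computes the spherical Radon transform of a power.\<close>

lemma nn_integral_moment:
  fixes z :: "'a::euclidean_space"
  assumes W: "subspace W" "dim W > 0" and z: "z \<in> W"
  shows "(\<integral>\<^sup>+ x. ennreal ((x \<bullet> z) ^ (2 * j)) * moment_weight ((norm x)\<^sup>2) \<partial>subspace_lborel W) =
    ennreal (norm z ^ (2 * j)) * moment_const (dim W) j"
proof -
  have "(\<integral>\<^sup>+ x. ennreal ((x \<bullet> z) ^ (2 * j)) * moment_weight ((norm x)\<^sup>2) \<partial>subspace_lborel W) =
    radial_integral (dim W - 1) (\<lambda>q. \<integral>\<^sup>+ s. ennreal ((norm z * s) ^ (2 * j)) * moment_weight (q + s\<^sup>2) \<partial>lborel)"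
    by (rule nn_integral_subspace_axial[OF W z]) measurable
  also have "\<dots> = radial_integral (dim W - 1) (\<lambda>q. ennreal (norm z ^ (2 * j)) *
      (\<integral>\<^sup>+ s. ennreal (s ^ (2 * j)) * moment_weight (q + s\<^sup>2) \<partial>lborel))"
    by (subst nn_integral_cmult[symmetric]) (auto simp: power_mult_distrib ennreal_mult' mult.assoc)
  also have "\<dots> = ennreal (norm z ^ (2 * j)) * moment_const (dim W) j"
    unfolding moment_const_def by (rule radial_integral_cmult) measurable
  finally show ?thesis .
qed

lemma moment_const_pos_finite:
  fixes W :: "'a::euclidean_space set"
  assumes W: "subspace W" "dim W > 0"
  shows "moment_const (dim W) j \<noteq> 0" "moment_const (dim W) j \<noteq> \<infinity>"
proof -
  obtain b where b: "b \<in> W" "norm b = 1" using subspace_unit_vector[OF W] .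
  let ?h = "\<lambda>x. ennreal ((x \<bullet> b) ^ (2 * j)) * moment_weight ((norm x)\<^sup>2)"
  have C: "moment_const (dim W) j = (\<integral>\<^sup>+ x. ?h x \<partial>subspace_lborel W)"
    unfolding nn_integral_moment[OF W b(1)] by (simp add: b)
  show "moment_const (dim W) j \<noteq> 0"
  proof
    assume "moment_const (dim W) j = 0"
    then have "AE x in subspace_lborel W. ?h x = 0"
      unfolding C by (subst (asm) nn_integral_0_iff_AE) auto
    moreover have "AE x in subspace_lborel W. b \<bullet> x \<noteq> 0"
      by (rule AE_subspace_hyperplane) (use W b in auto)
    ultimately have "AE x in subspace_lborel W. x \<notin> ball 0 1"
    proof eventually_elim
      case (elim x)
      then have "x \<noteq> 0" "x \<bullet> b \<noteq> 0" by (auto simp: inner_commute)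
      then have "x \<noteq> 0" "0 < (x \<bullet> b) ^ (2 * j)" by (auto simp: zero_less_power_eq)
      with elim(1) have "(norm x)\<^sup>2 > 1"
        by (cases "(norm x)\<^sup>2 \<le> 1") (simp_all add: moment_weight_def ennreal_eq_0_iff not_le del: zero_less_power)
      then have "\<not> norm x < 1" by (metis abs_norm_cancel abs_square_less_1 not_less_iff_gr_or_eq)
      then show ?case by simp
    qed
    then have "emeasure (subspace_lborel W) (ball 0 1) = 0"
      by (subst (asm) AE_iff_measurable[of "ball 0 1"]) auto
    then show False using emeasure_subspace_ball_1(1)[OF W(1)] by simp
  qed
  have "(\<integral>\<^sup>+ x. ?h x \<partial>subspace_lborel W) \<le> (\<integral>\<^sup>+ x. indicator (cball 0 1) x \<partial>subspace_lborel W)"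
  proof (intro nn_integral_mono)
    fix x :: 'a
    show "?h x \<le> indicator (cball 0 1) x"
    proof (cases "norm x \<le> 1")
      case True
      then have "(norm x)\<^sup>2 \<le> 1" by (simp add: abs_square_le_1)
      have "\<bar>x \<bullet> b\<bar> \<le> 1" using Cauchy_Schwarz_ineq2[of x b] b True by simp
      then have "(x \<bullet> b) ^ (2 * j) \<le> 1"
        by (metis abs_ge_zero power_even_abs_numeral power_le_one power_mult power_even_abs even_mult_iff even_numeral)
      then have "ennreal ((x \<bullet> b) ^ (2 * j)) * ennreal (norm x) \<le> 1 * 1"
        using True by (intro mult_mono) (auto simp: ennreal_le_1)
      then show ?thesis using True \<open>(norm x)\<^sup>2 \<le> 1\<close> by (simp add: moment_weight_def)
    next
      case False
      then have "\<not> (norm x)\<^sup>2 \<le> 1" by (simp add: abs_square_le_1)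
      then show ?thesis by (simp add: moment_weight_def)
    qed
  qed
  also have "\<dots> < \<infinity>" using emeasure_subspace_cball_finite[OF W(1), of 1] by simp
  finally show "moment_const (dim W) j \<noteq> \<infinity>" unfolding C by simp
qed

text \<open>Integration of a homogeneous function over a spherical shell. By homogeneity the level sets
  \<open>{f \<ge> s}\<close> are homothetic to \<open>{f \<ge> 1}\<close>; the shell is chosen so that the resulting constant is the
  dimension. This makes the volume of \<open>{f \<ge> 1}\<close> linear in \<open>f\<close>.\<close>

lemma nn_integral_homogeneous_shell:
  fixes f :: "'a::euclidean_space \<Rightarrow> real"
  assumes W: "subspace W" and d: "d = dim W" "d > 0"
    and [measurable]: "f \<in> borel_measurable borel"
    and hom: "\<And>x t. x \<in> W \<Longrightarrow> x \<noteq> 0 \<Longrightarrow> t > 0 \<Longrightarrow> f (t *\<^sub>R x) = f x / t ^ d"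
    and pos: "\<And>x. x \<in> W \<Longrightarrow> x \<noteq> 0 \<Longrightarrow> f x \<ge> 0"
  shows "(\<integral>\<^sup>+ x. ennreal (f x) * indicator {1..<exp 1} (norm x) \<partial>subspace_lborel W) =
    ennreal d * emeasure (subspace_lborel W) {x. x \<noteq> 0 \<and> f x \<ge> 1}"
proof -
  let ?M = "subspace_lborel W"
  interpret M: sigma_finite_measure ?M by (rule sigma_finite_subspace_lborel[OF W])
  interpret P: pair_sigma_finite ?M "lborel :: real measure" ..
  define A where "A x = (indicator {1..<exp 1} (norm x) :: ennreal)" for x :: 'a
  define L where "L x = (indicator {x. x \<noteq> 0 \<and> f x \<ge> 1} x :: ennreal)" for x :: 'a
  have [measurable]: "A \<in> borel_measurable borel" "L \<in> borel_measurable borel"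
    unfolding A_def L_def by measurable
  have 1: "ennreal (f x) * A x = (\<integral>\<^sup>+ s. indicator {0<..f x} s * A x \<partial>lborel)" if "x \<in> W" for x
  proof (cases "x = 0")
    case False
    then have "ennreal (f x) = (\<integral>\<^sup>+ s. indicator {0<..f x} s \<partial>lborel)" using pos[OF that] by simp
    then show ?thesis by (simp add: nn_integral_multc)
  qed (simp add: A_def)
  have 2: "indicator {0<..f x} s * A x = indicator {0<..} s * (A x * L (root d s *\<^sub>R x))"
    if x: "x \<in> W" for x s
  proof (cases "x \<noteq> 0 \<and> s > 0")
    case True
    then have "f (root d s *\<^sub>R x) = f x / s" using x d by (subst hom) auto
    then have "s \<le> f x \<longleftrightarrow> 1 \<le> f (root d s *\<^sub>R x)" using True by (simp add: le_divide_eq)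
    then show ?thesis using True d by (auto simp: indicator_def L_def)
  qed (auto simp: A_def)
  have 3: "(\<integral>\<^sup>+ x. A x * L (root d s *\<^sub>R x) \<partial>?M) = ennreal (1 / s) * (\<integral>\<^sup>+ x. A ((1 / root d s) *\<^sub>R x) * L x \<partial>?M)"
    if s: "s > 0" for s
  proof -
    have r: "root d s > 0" using s d by simp
    have "(1 / root d s) ^ d = 1 / s" using s d by (simp add: power_one_over)
    then show ?thesis
      using nn_integral_subspace_scale[OF W, of "\<lambda>x. A x * L (root d s *\<^sub>R x)" "1 / root d s"] r s d
      by simp
  qed
  have 4: "(\<integral>\<^sup>+ s. indicator {0<..} s * ennreal (1 / s) * A ((1 / root d s) *\<^sub>R x) \<partial>lborel) = ennreal d"
    if "x \<noteq> 0" for x :: 'a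
  proof -
    have n: "norm x > 0" using that by simp
    let ?l = "(norm x / exp 1) ^ d" and ?u = "norm x ^ d"
    have l: "0 < ?l" "?l \<le> ?u" using n d by (auto intro!: power_mono divide_le_eq[THEN iffD2])
    have "ln ?u - ln ?l = d" using n by (simp add: ln_realpow ln_div algebra_simps)
    have "indicator {0<..} s * ennreal (1 / s) * A ((1 / root d s) *\<^sub>R x) =
        ennreal (1 / s) * indicator {?l<..?u} s" for s
    proof (cases "s > 0")
      case True
      then have r: "root d s > 0" "root d s ^ d = s" using d by auto
      have "1 \<le> norm x / root d s \<longleftrightarrow> root d s \<le> norm x" using r by (simp add: field_simps)
      also have "\<dots> \<longleftrightarrow> s \<le> ?u" using r d n by (metis power_mono_iff less_imp_le)
      finally have u: "1 \<le> norm x / root d s \<longleftrightarrow> s \<le> ?u" .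
      have "norm x / root d s < exp 1 \<longleftrightarrow> norm x / exp 1 < root d s" using r by (simp add: field_simps)
      also have "\<dots> \<longleftrightarrow> ?l < s"
        using r d n by (metis power_mono_iff less_imp_le not_le zero_le_divide_iff exp_ge_zero norm_ge_zero)
      finally show ?thesis using True u r by (auto simp: A_def indicator_def)
    next
      case False
      then show ?thesis using l by (auto simp: indicator_def)
    qed
    then have "(\<integral>\<^sup>+ s. indicator {0<..} s * ennreal (1 / s) * A ((1 / root d s) *\<^sub>R x) \<partial>lborel) =
       (\<integral>\<^sup>+ s. ennreal (1 / s) * indicator {?l<..?u} s \<partial>lborel)" by simp
    also have "\<dots> = (\<integral>\<^sup>+ s. ennreal (1 / s) * indicator {?l..?u} s \<partial>lborel)"
    proof (rule nn_integral_cong_AE)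
      have "AE s in lborel. s \<noteq> ?l" by (rule AE_lborel_singleton)
      then show "AE s in lborel. ennreal (1 / s) * indicator {?l<..?u} s = ennreal (1 / s) * indicator {?l..?u} s"
        by eventually_elim (auto simp: indicator_def)
    qed
    also have "\<dots> = ennreal (ln ?u - ln ?l)"
      by (rule nn_integral_FTC_Icc) (use l in \<open>auto intro!: derivative_eq_intros simp: has_real_derivative_iff_has_vector_derivative[symmetric]\<close>)
    finally show ?thesis using \<open>ln ?u - ln ?l = d\<close> by simp
  qed
  have "(\<integral>\<^sup>+ x. ennreal (f x) * A x \<partial>?M) =
      (\<integral>\<^sup>+ x. (\<integral>\<^sup>+ s. indicator {0<..} s * (A x * L (root d s *\<^sub>R x)) \<partial>lborel) \<partial>?M)"
    by (intro nn_integral_subspace_cong[OF W]) (simp add: 1 2)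
  also have "\<dots> = (\<integral>\<^sup>+ s. (\<integral>\<^sup>+ x. indicator {0<..} s * (A x * L (root d s *\<^sub>R x)) \<partial>?M) \<partial>lborel)"
    by (rule P.Fubini'[symmetric]) measurable
  also have "\<dots> = (\<integral>\<^sup>+ s. indicator {0<..} s * (\<integral>\<^sup>+ x. A x * L (root d s *\<^sub>R x) \<partial>?M) \<partial>lborel)"
    by (intro nn_integral_cong nn_integral_cmult) measurable
  also have "\<dots> = (\<integral>\<^sup>+ s. indicator {0<..} s * (ennreal (1 / s) * (\<integral>\<^sup>+ x. A ((1 / root d s) *\<^sub>R x) * L x \<partial>?M)) \<partial>lborel)"
    by (intro nn_integral_cong) (auto simp: indicator_def 3)
  also have "\<dots> = (\<integral>\<^sup>+ s. (\<integral>\<^sup>+ x. indicator {0<..} s * ennreal (1 / s) * A ((1 / root d s) *\<^sub>R x) * L x \<partial>?M) \<partial>lborel)"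
    by (intro nn_integral_cong) (simp add: nn_integral_cmult[symmetric] mult.assoc)
  also have "\<dots> = (\<integral>\<^sup>+ x. (\<integral>\<^sup>+ s. indicator {0<..} s * ennreal (1 / s) * A ((1 / root d s) *\<^sub>R x) * L x \<partial>lborel) \<partial>?M)"
    by (rule P.Fubini') measurable
  also have "\<dots> = (\<integral>\<^sup>+ x. ennreal d * L x \<partial>?M)"
  proof (intro nn_integral_cong)
    fix x
    show "(\<integral>\<^sup>+ s. indicator {0<..} s * ennreal (1 / s) * A ((1 / root d s) *\<^sub>R x) * L x \<partial>lborel) = ennreal d * L x"
      by (cases "x = 0") (simp add: L_def, simp add: nn_integral_multc 4)
  qed
  also have "\<dots> = ennreal d * emeasure ?M {x. x \<noteq> 0 \<and> f x \<ge> 1}"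
    unfolding L_def by (subst nn_integral_cmult) auto
  finally show ?thesis unfolding A_def .
qed

section \<open>Star bodies from homogeneous functions\<close>

definition star_set :: "'a::euclidean_space set \<Rightarrow> ('a \<Rightarrow> real) \<Rightarrow> 'a set" where
  "star_set V \<rho> = {x \<in> V. x = 0 \<or> 1 \<le> \<rho> x}"

text \<open>A star body in \<open>V\<close> is given by its radial function, which extends to a function on \<open>V - {0}\<close> that is
  homogeneous of degree \<open>-1\<close>.\<close>

locale radial_function =
  fixes V :: "'a::euclidean_space set" and \<rho> :: "'a \<Rightarrow> real"
  assumes V: "subspace V"
    and cont: "continuous_on (V - {0}) \<rho>"
    and pos: "\<And>x. x \<in> V \<Longrightarrow> x \<noteq> 0 \<Longrightarrow> \<rho> x > 0"
    and hom: "\<And>x t. x \<in> V \<Longrightarrow> x \<noteq> 0 \<Longrightarrow> t > 0 \<Longrightarrow> \<rho> (t *\<^sub>R x) = \<rho> x / t"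
begin

lemma scale_mem_iff:
  assumes "x \<in> V" "x \<noteq> 0" "a > 0"
  shows "a *\<^sub>R x \<in> star_set V \<rho> \<longleftrightarrow> a \<le> \<rho> x"
  using assms V by (auto simp: star_set_def hom subspace_scale le_divide_eq)

lemma radial_star_set:
  assumes "x \<in> V" "x \<noteq> 0"
  shows "radial (star_set V \<rho>) x = \<rho> x"
proof -
  have "{a. a > 0 \<and> a *\<^sub>R x \<in> star_set V \<rho>} = {0<..\<rho> x}"
    using scale_mem_iff[OF assms] by auto
  then show ?thesis unfolding radial_def using pos[OF assms] by simp
qed

lemma bounded_star_set: "bounded (star_set V \<rho>)"
proof -
  have "compact (sphere 0 1 \<inter> V)" using V by (simp add: closed_subspace compact_Int_closed)
  moreover have "continuous_on (sphere 0 1 \<inter> V) \<rho>"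
    by (rule continuous_on_subset[OF cont]) auto
  ultimately have "bounded (\<rho> ` (sphere 0 1 \<inter> V))"
    by (intro compact_imp_bounded compact_continuous_image)
  then obtain M where M: "\<And>x. x \<in> sphere 0 1 \<inter> V \<Longrightarrow> \<bar>\<rho> x\<bar> \<le> M"
    unfolding bounded_iff real_norm_def by blast
  have "norm x \<le> max M 0" if "x \<in> star_set V \<rho>" for x
  proof (cases "x = 0")
    case False
    let ?u = "x /\<^sub>R norm x"
    have u: "?u \<in> V" "norm ?u = 1" using that False V by (auto simp: star_set_def subspace_scale)
    have "norm x *\<^sub>R ?u \<in> star_set V \<rho>" using that False by simp
    then have "norm x \<le> \<rho> ?u"
      using scale_mem_iff[OF u(1), of "norm x"] False by auto
    also have "\<dots> \<le> M" using M[of ?u] u by auto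
    finally show ?thesis by simp
  qed simp
  then show ?thesis unfolding bounded_iff by blast
qed

lemma closed_star_set: "closed (star_set V \<rho>)"
  unfolding closed_sequential_limits
proof (intro allI impI, elim conjE)
  fix x l assume x: "\<forall>n. x n \<in> star_set V \<rho>" and lim: "x \<longlonglongrightarrow> l"
  have "l \<in> V"
    using x lim closed_subspace[OF V] unfolding closed_sequential_limits star_set_def by blast
  show "l \<in> star_set V \<rho>"
  proof (cases "l = 0")
    case False
    have "\<forall>\<^sub>F n in sequentially. x n \<in> V - {0}"
      using tendsto_imp_eventually_ne[OF lim False] by eventually_elim (use x in \<open>auto simp: star_set_def\<close>)
    then have "(\<lambda>n. \<rho> (x n)) \<longlonglongrightarrow> \<rho> l"
      by (intro continuous_on_tendsto_compose[OF cont lim]) (use False \<open>l \<in> V\<close> in auto)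
    moreover have "\<forall>\<^sub>F n in sequentially. 1 \<le> \<rho> (x n)"
      using tendsto_imp_eventually_ne[OF lim False] by eventually_elim (use x in \<open>auto simp: star_set_def\<close>)
    ultimately have "1 \<le> \<rho> l" by (rule tendsto_lowerbound) simp
    then show ?thesis using \<open>l \<in> V\<close> by (simp add: star_set_def)
  qed (use \<open>l \<in> V\<close> in \<open>simp add: star_set_def\<close>)
qed

lemma star_body_star_set: "star_body_in V (star_set V \<rho>)"
  unfolding star_body_in_def
proof (intro conjI ballI)
  show "compact (star_set V \<rho>)"
    using bounded_star_set closed_star_set by (simp add: compact_eq_bounded_closed)
  show "star_set V \<rho> \<subseteq> V" "0 \<in> star_set V \<rho>"
    using V by (auto simp: star_set_def subspace_0)
  show "closed_segment 0 x \<subseteq> star_set V \<rho>" if x: "x \<in> star_set V \<rho>" for x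
  proof
    fix y assume "y \<in> closed_segment 0 x"
    then obtain u where u: "0 \<le> u" "u \<le> 1" "y = u *\<^sub>R x" by (auto simp: in_segment)
    show "y \<in> star_set V \<rho>"
    proof (cases "u = 0 \<or> x = 0")
      case True
      then show ?thesis using u V by (auto simp: star_set_def subspace_0)
    next
      case False
      then show ?thesis using x u scale_mem_iff[of x u] by (auto simp: star_set_def)
    qed
  qed
  show "\<exists>a>0. a *\<^sub>R x \<in> star_set V \<rho>" if "x \<in> V - {0}" for x
    using that pos[of x] scale_mem_iff[of x "\<rho> x"] by auto
  show "continuous_on (V - {0}) (radial (star_set V \<rho>))"
    by (rule continuous_on_eq[OF cont]) (simp add: radial_star_set)
qed

lemma origin_symmetric_star_set:
  assumes "\<And>x. x \<in> V \<Longrightarrow> \<rho> (- x) = \<rho> x"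
  shows "origin_symmetric (star_set V \<rho>)"
  using assms V by (auto simp: origin_symmetric_def star_set_def subspace_neg)

end

lemma inverse_minkowski_functional:
  assumes K: "star_body_in V K" and x: "x \<in> V" "x \<noteq> 0"
  shows "inverse (minkowski_functional K x) = radial K x" "radial K x > 0"
proof -
  let ?S = "{a. a > 0 \<and> a *\<^sub>R x \<in> K}"
  define r where "r = radial K x"
  have comp: "compact K" and seg: "\<And>y. y \<in> K \<Longrightarrow> closed_segment 0 y \<subseteq> K"
    using K unfolding star_body_in_def by auto
  obtain a0 where a0: "a0 > 0" "a0 *\<^sub>R x \<in> K" using K x unfolding star_body_in_def by blast
  obtain M where M: "\<And>y. y \<in> K \<Longrightarrow> norm y \<le> M"
    using compact_imp_bounded[OF comp] unfolding bounded_iff by blast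
  have bdd: "bdd_above ?S"
  proof (rule bdd_aboveI)
    fix a assume "a \<in> ?S"
    then have "a * norm x \<le> M" using M[of "a *\<^sub>R x"] by simp
    then show "a \<le> M / norm x" using x by (simp add: field_simps)
  qed
  have "a0 \<le> r" unfolding r_def radial_def by (rule cSup_upper) (use a0 bdd in auto)
  then have r: "r > 0" using a0 by simp
  then show "radial K x > 0" unfolding r_def .
  have rK: "r *\<^sub>R x \<in> K"
  proof -
    let ?T = "(\<lambda>a. a *\<^sub>R x) -` K"
    have "closed ?T" using comp by (intro continuous_closed_vimage compact_imp_closed) (auto intro!: continuous_intros)
    moreover have "r \<in> closure ?S"
      unfolding r_def radial_def by (rule closure_contains_Sup) (use a0 bdd in auto)
    moreover have "closure ?S \<subseteq> closure ?T" by (rule closure_mono) auto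
    ultimately show ?thesis by (auto simp: closure_closed)
  qed
  have down: "a *\<^sub>R x \<in> K \<longleftrightarrow> a \<le> r" if "a > 0" for a
  proof
    assume "a *\<^sub>R x \<in> K"
    then show "a \<le> r" unfolding r_def radial_def using bdd that by (intro cSup_upper) auto
  next
    assume "a \<le> r"
    then have "a *\<^sub>R x \<in> closed_segment 0 (r *\<^sub>R x)"
      using that r unfolding in_segment by (intro exI[of _ "a / r"]) auto
    then show "a *\<^sub>R x \<in> K" using seg[OF rK] by auto
  qed
  have "{a. a \<ge> 0 \<and> x \<in> (\<lambda>y. a *\<^sub>R y) ` K} = {1 / r..}"
  proof (intro set_eqI iffI)
    fix a assume a: "a \<in> {a. a \<ge> 0 \<and> x \<in> (\<lambda>y. a *\<^sub>R y) ` K}"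
    then obtain y where y: "y \<in> K" "x = a *\<^sub>R y" "a \<ge> 0" by auto
    then have "a > 0" using x by (cases "a = 0") auto
    then have "(1 / a) *\<^sub>R x \<in> K" using y by simp
    then have "1 / a \<le> r" using down[of "1 / a"] \<open>a > 0\<close> by simp
    then show "a \<in> {1 / r..}" using \<open>a > 0\<close> r by (simp add: field_simps)
  next
    fix a assume a: "a \<in> {1 / r..}"
    then have "a > 0" using r by (meson atLeast_iff less_le_trans zero_less_divide_1_iff)
    moreover have "1 / a \<le> r" using a \<open>a > 0\<close> r by (simp add: field_simps)
    ultimately have "(1 / a) *\<^sub>R x \<in> K" using down[of "1 / a"] by simp
    then have "x \<in> (\<lambda>y. a *\<^sub>R y) ` K" using \<open>a > 0\<close> by (intro image_eqI[of _ _ "(1 / a) *\<^sub>R x"]) auto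
    then show "a \<in> {a. a \<ge> 0 \<and> x \<in> (\<lambda>y. a *\<^sub>R y) ` K}" using \<open>a > 0\<close> by simp
  qed
  then have "minkowski_functional K x = 1 / r" unfolding minkowski_functional_def by simp
  then show "inverse (minkowski_functional K x) = radial K x" unfolding r_def by (simp add: inverse_eq_divide)
qed

section \<open>The dented ball and its hyperplane sections\<close>

text \<open>The radial function of the unit ball minus a multiple of that of the flat ellipsoid with half-axis
  \<open>(1 + p)\<^sup>-\<^sup>1\<^sup>/\<^sup>2\<close> in the direction of the unit vector \<open>e\<close> and half-axes \<open>1\<close> orthogonal to it. For large \<open>p\<close>
  this is a ball with a shallow narrow groove along the equator \<open>e\<^sup>\<bottom>\<close>.\<close>

definition dented_radial :: "real \<Rightarrow> real \<Rightarrow> 'a::euclidean_space \<Rightarrow> 'a \<Rightarrow> real" where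
  "dented_radial \<delta> p e x = 1 / norm x - \<delta> / sqrt ((norm x)\<^sup>2 + p * (x \<bullet> e)\<^sup>2)"

lemma dented_radial_lower:
  assumes "0 \<le> \<delta>" "0 \<le> p" "x \<noteq> 0"
  shows "(1 - \<delta>) / norm x \<le> dented_radial \<delta> p e x"
proof -
  have "norm x \<le> sqrt ((norm x)\<^sup>2 + p * (x \<bullet> e)\<^sup>2)" using assms by (intro real_le_rsqrt) simp
  then have "\<delta> / sqrt ((norm x)\<^sup>2 + p * (x \<bullet> e)\<^sup>2) \<le> \<delta> / norm x"
    using assms by (intro divide_left_mono mult_pos_pos) (auto intro: add_pos_nonneg)
  then show ?thesis unfolding dented_radial_def by (simp add: diff_divide_distrib)
qed

lemma dented_radial_minus: "dented_radial \<delta> p e (- x) = dented_radial \<delta> p e x"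
  by (simp add: dented_radial_def)

lemma radial_function_dented:
  assumes V: "subspace V" and "0 \<le> \<delta>" "\<delta> < 1" "0 \<le> p"
  shows "radial_function V (dented_radial \<delta> p e)"
proof
  have q: "(norm x)\<^sup>2 + p * (x \<bullet> e)\<^sup>2 > 0" if "x \<noteq> 0" for x
    using that assms by (intro add_pos_nonneg) auto
  show "continuous_on (V - {0}) (dented_radial \<delta> p e)"
    unfolding dented_radial_def using q by (intro continuous_intros) (auto simp: less_le)
  show "dented_radial \<delta> p e x > 0" if "x \<in> V" "x \<noteq> 0" for x
    using dented_radial_lower[of \<delta> p x e] assms that by (auto intro: less_le_trans[rotated])
  show "dented_radial \<delta> p e (t *\<^sub>R x) = dented_radial \<delta> p e x / t" if "t > 0" for x t
  proof -
    have "(norm (t *\<^sub>R x))\<^sup>2 + p * (t *\<^sub>R x \<bullet> e)\<^sup>2 = t\<^sup>2 * ((norm x)\<^sup>2 + p * (x \<bullet> e)\<^sup>2)"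
      by (simp add: power_mult_distrib algebra_simps)
    then have "sqrt ((norm (t *\<^sub>R x))\<^sup>2 + p * (t *\<^sub>R x \<bullet> e)\<^sup>2) = t * sqrt ((norm x)\<^sup>2 + p * (x \<bullet> e)\<^sup>2)"
      using that by (simp add: real_sqrt_mult)
    then show ?thesis using that unfolding dented_radial_def by (simp add: diff_divide_distrib mult.commute)
  qed
qed (rule V)

text \<open>On \<open>V\<close> the vector \<open>e\<close> can be replaced by its projection \<open>z\<close> to \<open>V\<close>. As a function of \<open>\<xi>\<close>, the volume
  of the section of this ellipsoid by \<open>\<xi>\<^sup>\<bottom>\<close> is proportional to the second term of \<open>dented_radial\<close>.\<close>

lemma emeasure_section_ellipsoid:
  fixes \<xi> :: "'a::euclidean_space"
  assumes V: "subspace V" and \<xi>: "\<xi> \<in> V" "norm \<xi> = 1" and z: "z \<in> V" and dim: "dim V \<ge> 2" and p: "p \<ge> 0"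
  shows "emeasure (subspace_lborel (perp_in V \<xi>)) {x. (norm x)\<^sup>2 - p / (1 + p * (norm z)\<^sup>2) * (x \<bullet> z)\<^sup>2 \<le> 1} =
    ennreal (sqrt (1 + p * (norm z)\<^sup>2) / sqrt (1 + p * (\<xi> \<bullet> z)\<^sup>2)) * ball_volume (dim V - 1)"
proof -
  let ?W = "perp_in V \<xi>" and ?\<gamma> = "p / (1 + p * (norm z)\<^sup>2)"
  have W: "subspace ?W" using V by (rule subspace_perp_in)
  have dW: "dim V = Suc (dim ?W)" using \<xi> V by (intro dim_perp_in) auto
  define z' where "z' = z - (\<xi> \<bullet> z) *\<^sub>R \<xi>"
  have z': "z' \<in> ?W"
    using V z \<xi> by (auto simp: z'_def orthogonal_def inner_diff_right norm_eq_1 subspace_diff subspace_scale)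
  have "z = z' + (\<xi> \<bullet> z) *\<^sub>R \<xi>" by (simp add: z'_def)
  then have "(norm z)\<^sup>2 = (norm z')\<^sup>2 + (\<xi> \<bullet> z)\<^sup>2"
    using norm_add_orthogonal_unit[of \<xi> z' "\<xi> \<bullet> z"] z' \<xi> by auto
  then have nz: "(norm z')\<^sup>2 = (norm z)\<^sup>2 - (\<xi> \<bullet> z)\<^sup>2" by simp
  have P: "1 + p * (norm z)\<^sup>2 > 0" "1 + p * (\<xi> \<bullet> z)\<^sup>2 > 0" using p by (auto intro: add_pos_nonneg)
  have g: "1 - ?\<gamma> * (norm z')\<^sup>2 = (1 + p * (\<xi> \<bullet> z)\<^sup>2) / (1 + p * (norm z)\<^sup>2)"
    using P unfolding nz by (simp add: field_simps)
  have "?\<gamma> * (norm z')\<^sup>2 < 1" using g P by (smt (verit) divide_pos_pos)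
  note E = emeasure_ellipsoid[OF W _ z' this]
  have "emeasure (subspace_lborel ?W) {x. (norm x)\<^sup>2 - ?\<gamma> * (x \<bullet> z)\<^sup>2 \<le> 1} =
      emeasure (subspace_lborel ?W) {x. (norm x)\<^sup>2 - ?\<gamma> * (x \<bullet> z')\<^sup>2 \<le> 1}"
  proof (rule emeasure_eq_AE)
    show "AE x in subspace_lborel ?W. x \<in> {x. (norm x)\<^sup>2 - ?\<gamma> * (x \<bullet> z)\<^sup>2 \<le> 1} \<longleftrightarrow>
        x \<in> {x. (norm x)\<^sup>2 - ?\<gamma> * (x \<bullet> z')\<^sup>2 \<le> 1}"
      using AE_subspace_lborel[OF W]
    proof eventually_elim
      case (elim x)
      then have "x \<bullet> z = x \<bullet> z'" by (simp add: z'_def inner_diff_right orthogonal_def inner_commute)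
      then show ?case by simp
    qed
  qed measurable
  then show ?thesis
    using E dW dim P unfolding g by (simp add: real_sqrt_divide)
qed

text \<open>\<open>L\<close> is found by inverting the spherical Radon transform: the two terms of \<open>dented_radial\<close> are
  multiples of the central section functions of the unit ball and of the ellipsoid above, and the
  volume of the sections of \<open>L\<close> is linear in the power \<open>\<rho>\<^sub>L\<^sup>d\<close>. The hypothesis on \<open>\<delta>\<close> says that the
  resulting power is positive.\<close>

lemma dented_is_intersection_body:
  fixes e z :: "'a::euclidean_space"
  assumes V: "subspace V" and d: "dim V = Suc d" "d \<ge> 1"
    and z: "z \<in> V" "\<And>x. x \<in> V \<Longrightarrow> x \<bullet> e = x \<bullet> z"
    and p: "p \<ge> 0" and \<delta>: "0 \<le> \<delta>" "\<delta> * sqrt (1 + p * (norm z)\<^sup>2) ^ (d - 1) < 1"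
  shows "\<exists>L. is_intersection_body_of_in V (star_set V (dented_radial \<delta> p e)) L"
proof -
  define \<tau> where "\<tau> = sqrt (1 + p * (norm z)\<^sup>2)"
  have P: "1 + p * (norm z)\<^sup>2 > 0" using p by (auto intro: add_pos_nonneg)
  have \<tau>: "\<tau> \<ge> 1" "\<tau>\<^sup>2 = 1 + p * (norm z)\<^sup>2" using p by (auto simp: \<tau>_def)
  have "1 \<le> \<tau> ^ (d - 1)" using \<tau>(1) by (rule one_le_power)
  then have "\<delta> \<le> \<delta> * \<tau> ^ (d - 1)" using \<delta>(1) by (simp add: mult_le_cancel_left1)
  then have \<delta>1: "\<delta> < 1" using \<delta>(2) unfolding \<tau>_def by simp
  interpret K: radial_function V "dented_radial \<delta> p e"
    by (rule radial_function_dented) (use V \<delta> \<delta>1 p in auto)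
  obtain b where b: "b \<in> V" "norm b = 1" using subspace_unit_vector V d by (metis zero_less_Suc)
  have "b \<noteq> 0" using b(2) by auto
  then have "d = dim (perp_in V b)" using dim_perp_in[OF V b(1)] d by simp
  then have "ball_volume d \<noteq> 0" "ball_volume d \<noteq> \<infinity>"
    using ball_volume_pos_finite[OF subspace_perp_in[OF V], of b] by simp_all
  then obtain \<kappa> where \<kappa>: "\<kappa> > 0" "ball_volume d = ennreal \<kappa>"
    by (cases "ball_volume d") (auto simp: less_le)
  define \<gamma> where "\<gamma> = p / (1 + p * (norm z)\<^sup>2)"
  define q where "q x = (norm x)\<^sup>2 - \<gamma> * (x \<bullet> z)\<^sup>2" for x
  have q: "(norm x)\<^sup>2 / \<tau>\<^sup>2 \<le> q x" for x
  proof -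
    have "(x \<bullet> z)\<^sup>2 \<le> (norm x)\<^sup>2 * (norm z)\<^sup>2"
      using Cauchy_Schwarz_ineq[of x z] by (simp add: power2_norm_eq_inner)
    then have "\<gamma> * (x \<bullet> z)\<^sup>2 \<le> \<gamma> * ((norm x)\<^sup>2 * (norm z)\<^sup>2)"
      using p P unfolding \<gamma>_def by (intro mult_left_mono) auto
    moreover have "(norm x)\<^sup>2 - \<gamma> * ((norm x)\<^sup>2 * (norm z)\<^sup>2) = (norm x)\<^sup>2 / \<tau>\<^sup>2"
      unfolding \<gamma>_def \<tau>(2) using P by (simp add: field_simps)
    ultimately show ?thesis unfolding q_def by linarith
  qed
  have qpos: "q x > 0" if "x \<noteq> 0" for x
    by (rule less_le_trans[OF _ q]) (use that \<tau>(1) in auto)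
  have qscale: "q (t *\<^sub>R x) = t\<^sup>2 * q x" for t x
    by (simp add: q_def power_mult_distrib algebra_simps)
  \<comment> \<open>\<open>f1\<close> and \<open>f2\<close> are the \<open>d\<close>-th powers of the radial functions of the ball and of the ellipsoid,
    and \<open>f\<close> is going to be that of \<open>L\<close>.\<close>
  define f1 where "f1 x = (1 / norm x) ^ d" for x :: 'a
  define f2 where "f2 x = (1 / sqrt (q x)) ^ d" for x
  define f where "f x = (f1 x - \<delta> / \<tau> * f2 x) / \<kappa>" for x
  have hom1: "f1 (t *\<^sub>R x) = f1 x / t ^ d" if "t > 0" for x t
    using that by (simp add: f1_def power_mult_distrib power_divide)
  have hom2: "f2 (t *\<^sub>R x) = f2 x / t ^ d" if "t > 0" for x t
    using that by (simp add: f2_def qscale real_sqrt_mult power_mult_distrib power_divide)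
  have hom: "f (t *\<^sub>R x) = f x / t ^ d" if "t > 0" for x t
    unfolding f_def hom1[OF that] hom2[OF that] using that \<kappa>(1) by (simp add: field_simps)
  have fpos: "f x > 0" if "x \<noteq> 0" for x
  proof -
    have "norm x / \<tau> \<le> sqrt (q x)"
      using q[of x] \<tau>(1) by (intro real_le_rsqrt) (simp add: power_divide)
    then have "1 / sqrt (q x) \<le> \<tau> / norm x"
      using that \<tau>(1) qpos[OF that] by (simp add: field_simps)
    then have "f2 x \<le> (\<tau> / norm x) ^ d"
      unfolding f2_def using qpos[OF that] by (intro power_mono) auto
    then have "\<delta> / \<tau> * f2 x \<le> \<delta> / \<tau> * (\<tau> / norm x) ^ d"
      using \<delta> \<tau> by (intro mult_left_mono) auto
    also have "\<dots> = \<delta> * \<tau> ^ (d - 1) * f1 x"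
    proof -
      have "\<tau> ^ d = \<tau> * \<tau> ^ (d - 1)" using d(2) by (metis power_eq_if not_one_le_zero)
      then show ?thesis using \<tau>(1) by (simp add: f1_def power_divide)
    qed
    also have "\<dots> < 1 * f1 x"
      using \<delta>(2) that unfolding \<tau>_def f1_def by (intro mult_strict_right_mono) auto
    finally show ?thesis unfolding f_def using \<kappa> by simp
  qed
  interpret L: radial_function V "\<lambda>x. root d (f x)"
  proof
    show "continuous_on (V - {0}) (\<lambda>x. root d (f x))"
    proof (intro continuous_intros)
      show "continuous_on (V - {0}) f"
        unfolding f_def f1_def f2_def
        using \<kappa> qpos by (intro continuous_intros) (auto simp: q_def less_le intro!: continuous_intros)
    qed
    show "root d (f x) > 0" if "x \<noteq> 0" for x using fpos[OF that] d by simp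
    show "root d (f (t *\<^sub>R x)) = root d (f x) / t" if "t > 0" for x t
      using that d unfolding hom[OF that] by (simp add: real_root_divide real_root_power_cancel)
  qed (rule V)
  have sym: "f (- x) = f x" for x by (simp add: f_def f1_def f2_def q_def)
  have [measurable]: "q \<in> borel_measurable borel" unfolding q_def by measurable
  have [measurable]: "f1 \<in> borel_measurable borel" "f2 \<in> borel_measurable borel" "f \<in> borel_measurable borel"
    unfolding f_def f1_def f2_def by measurable
  have "dented_radial \<delta> p e \<xi> = measure (subspace_lborel (perp_in V \<xi>)) (star_set V (\<lambda>x. root d (f x)) \<inter> {x. orthogonal \<xi> x})"
    if \<xi>: "\<xi> \<in> V" "norm \<xi> = 1" for \<xi>
  proof -
    let ?W = "perp_in V \<xi>"
    let ?M = "subspace_lborel ?W"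
    define r where "r = sqrt (1 + p * (\<xi> \<bullet> z)\<^sup>2)"
    have r: "r > 0" unfolding r_def using p by (auto intro: add_pos_nonneg)
    have W: "subspace ?W" using V by (rule subspace_perp_in)
    have "\<xi> \<noteq> 0" using \<xi>(2) by auto
    then have dW: "d = dim ?W" "d > 0" using dim_perp_in[OF V \<xi>(1)] d by simp_all
    have ne0: "AE x in ?M. x \<noteq> 0"
    proof -
      obtain c where "c \<in> ?W" "norm c = 1" using subspace_unit_vector[OF W] dW by metis
      then have "AE x in ?M. c \<bullet> x \<noteq> 0" by (intro AE_subspace_hyperplane[OF W]) auto
      then show ?thesis by eventually_elim auto
    qed
    define A where "A x = (indicator {1..<exp 1} (norm x) :: ennreal)" for x :: 'a
    have [measurable]: "A \<in> borel_measurable borel" unfolding A_def by measurable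
    let ?v = "emeasure ?M {x. x \<noteq> 0 \<and> f x \<ge> 1}"
    have I: "(\<integral>\<^sup>+ x. ennreal (f x) * A x \<partial>?M) = ennreal d * ?v"
      unfolding A_def
      by (rule nn_integral_homogeneous_shell[OF W dW]) (use hom fpos in \<open>auto intro: less_imp_le\<close>)
    have "(\<integral>\<^sup>+ x. ennreal (f1 x) * A x \<partial>?M) = ennreal d * emeasure ?M {x. x \<noteq> 0 \<and> f1 x \<ge> 1}"
      unfolding A_def
      by (rule nn_integral_homogeneous_shell[OF W dW]) (use hom1 in \<open>auto simp: f1_def\<close>)
    also have "emeasure ?M {x. x \<noteq> 0 \<and> f1 x \<ge> 1} = emeasure ?M (cball 0 1)"
    proof (rule emeasure_eq_AE)
      show "AE x in ?M. x \<in> {x. x \<noteq> 0 \<and> f1 x \<ge> 1} \<longleftrightarrow> x \<in> cball 0 1"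
        using ne0 by eventually_elim (use d in \<open>auto simp: f1_def power_divide power_le_one_iff\<close>)
    qed measurable
    also have "\<dots> = ennreal \<kappa>" unfolding emeasure_subspace_cball[OF W] dW(1)[symmetric] \<kappa> ..
    finally have I1: "(\<integral>\<^sup>+ x. ennreal (f1 x) * A x \<partial>?M) = ennreal d * ennreal \<kappa>" .
    have "(\<integral>\<^sup>+ x. ennreal (f2 x) * A x \<partial>?M) = ennreal d * emeasure ?M {x. x \<noteq> 0 \<and> f2 x \<ge> 1}"
      unfolding A_def
      by (rule nn_integral_homogeneous_shell[OF W dW]) (use hom2 qpos in \<open>auto simp: f2_def less_imp_le\<close>)
    also have "emeasure ?M {x. x \<noteq> 0 \<and> f2 x \<ge> 1} = emeasure ?M {x. q x \<le> 1}"
    proof (rule emeasure_eq_AE)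
      show "AE x in ?M. x \<in> {x. x \<noteq> 0 \<and> f2 x \<ge> 1} \<longleftrightarrow> x \<in> {x. q x \<le> 1}"
        using ne0
      proof eventually_elim
        case (elim x)
        have "f2 x \<ge> 1 \<longleftrightarrow> sqrt (q x) \<le> 1"
          using qpos[OF elim] d by (simp add: f2_def power_divide power_le_one_iff)
        then show ?case using elim by simp
      qed
    qed measurable
    also have "\<dots> = ennreal (\<tau> / r) * ennreal \<kappa>"
      unfolding q_def \<gamma>_def \<tau>_def r_def \<kappa>(2)[symmetric]
      using emeasure_section_ellipsoid[OF V \<xi> z(1) _ p] d by simp
    finally have I2: "(\<integral>\<^sup>+ x. ennreal (f2 x) * A x \<partial>?M) = ennreal d * (ennreal (\<tau> / r) * ennreal \<kappa>)" .
    have "ennreal \<kappa> * (\<integral>\<^sup>+ x. ennreal (f x) * A x \<partial>?M) + ennreal (\<delta> / \<tau>) * (\<integral>\<^sup>+ x. ennreal (f2 x) * A x \<partial>?M) =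
        (\<integral>\<^sup>+ x. ennreal \<kappa> * (ennreal (f x) * A x) + ennreal (\<delta> / \<tau>) * (ennreal (f2 x) * A x) \<partial>?M)"
      by (subst nn_integral_add) (auto simp: nn_integral_cmult)
    also have "\<dots> = (\<integral>\<^sup>+ x. ennreal (f1 x) * A x \<partial>?M)"
    proof (intro nn_integral_cong)
      fix x
      show "ennreal \<kappa> * (ennreal (f x) * A x) + ennreal (\<delta> / \<tau>) * (ennreal (f2 x) * A x) = ennreal (f1 x) * A x"
      proof (cases "x = 0")
        case False
        have "f1 x = \<kappa> * f x + \<delta> / \<tau> * f2 x" using \<kappa> by (simp add: f_def)
        moreover have "\<kappa> * f x \<ge> 0" "\<delta> / \<tau> * f2 x \<ge> 0" "f x \<ge> 0" "f2 x \<ge> 0"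
          using fpos[OF False] qpos[OF False] \<kappa> \<delta> \<tau> by (auto simp: f2_def)
        ultimately have "ennreal (f1 x) = ennreal \<kappa> * ennreal (f x) + ennreal (\<delta> / \<tau>) * ennreal (f2 x)"
          using \<kappa> \<delta> \<tau> by (simp add: ennreal_mult[symmetric])
        then show ?thesis by (simp add: algebra_simps)
      qed (simp add: A_def)
    qed
    finally have eq: "ennreal \<kappa> * (ennreal d * ?v) + ennreal (\<delta> / \<tau>) * (ennreal d * (ennreal (\<tau> / r) * ennreal \<kappa>)) =
        ennreal d * ennreal \<kappa>"
      unfolding I I1 I2 .
    then have "ennreal \<kappa> * (ennreal d * ?v) < \<infinity>"
      by (metis ennreal_add_eq_top ennreal_mult_eq_top_iff ennreal_neq_top infinity_ennreal_def top.not_eq_extremum)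
    then obtain v where v: "v \<ge> 0" "?v = ennreal v"
      using \<kappa>(1) dW(2) by (cases ?v) (auto simp: ennreal_mult_less_top simp del: dim_eq_0)
    have "\<kappa> * (d * v) + \<delta> / \<tau> * (d * (\<tau> / r * \<kappa>)) = d * \<kappa>"
      using eq \<kappa> \<delta> \<tau> r v by (simp add: ennreal_mult[symmetric] ennreal_plus[symmetric] del: ennreal_plus)
    then have "d * \<kappa> * (v + \<delta> / r) = d * \<kappa> * 1" using \<tau> by (simp add: field_simps)
    then have vr: "v = 1 - \<delta> / r" using \<kappa>(1) dW(2) by simp
    have "measure ?M (star_set V (\<lambda>x. root d (f x)) \<inter> {x. orthogonal \<xi> x}) = measure ?M {x. x \<noteq> 0 \<and> f x \<ge> 1}"
    proof (rule measure_eq_AE)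
      show "AE x in ?M. x \<in> star_set V (\<lambda>x. root d (f x)) \<inter> {x. orthogonal \<xi> x} \<longleftrightarrow> x \<in> {x. x \<noteq> 0 \<and> f x \<ge> 1}"
        using ne0 AE_subspace_lborel[OF W] by eventually_elim (use d in \<open>auto simp: star_set_def\<close>)
      have "closed {x. orthogonal \<xi> x}" using closed_hyperplane[of \<xi> 0] by (simp add: orthogonal_def)
      then show "star_set V (\<lambda>x. root d (f x)) \<inter> {x. orthogonal \<xi> x} \<in> sets ?M"
        using L.closed_star_set by (simp add: closed_Int)
    qed measurable
    also have "\<dots> = v" unfolding measure_def v by (simp add: v)
    also have "\<dots> = dented_radial \<delta> p e \<xi>"
      unfolding vr r_def dented_radial_def \<xi>(2) z(2)[OF \<xi>(1)] by simp
    finally show ?thesis ..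
  qed
  moreover have "inverse (minkowski_functional (star_set V (dented_radial \<delta> p e)) \<xi>) = dented_radial \<delta> p e \<xi>"
    if "\<xi> \<in> V" "norm \<xi> = 1" for \<xi>
    using inverse_minkowski_functional(1)[OF K.star_body_star_set, of \<xi>] K.radial_star_set[of \<xi>] that
    by (metis norm_zero zero_neq_one)
  ultimately have "is_intersection_body_of_in V (star_set V (dented_radial \<delta> p e)) (star_set V (\<lambda>x. root d (f x)))"
    unfolding is_intersection_body_of_in_def
    using K.star_body_star_set L.star_body_star_set K.origin_symmetric_star_set L.origin_symmetric_star_set
    by (auto simp: dented_radial_minus sym)
  then show ?thesis ..
qed

lemma intersection_body_inI:
  assumes "is_intersection_body_of_in V K L" "subspace V" "dim V > 0"
  shows "intersection_body_in V K"
proof -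
  obtain b where "b \<in> V" "norm b = 1" using subspace_unit_vector[OF assms(2,3)] .
  then have "sphere 0 1 \<inter> V \<noteq> {}" by auto
  then have "radial_dist V K K = 0" unfolding radial_dist_def by simp
  then show ?thesis
    using assms(1) unfolding intersection_body_in_def is_intersection_body_of_in_def
    by (metis assms(1))
qed

text \<open>If \<open>V\<close> is tilted against \<open>e\<close>, the projection \<open>z\<close> is shorter than \<open>e\<close> and the groove in \<open>V\<close> is wider,
  which only helps: the worst case is \<open>e \<in> V\<close>.\<close>

lemma dented_section_intersection_body:
  fixes e :: "'a::euclidean_space"
  assumes V: "subspace V" and d: "dim V = Suc d" "d \<ge> 1" and e: "norm e = 1"
    and p: "p \<ge> 0" and \<delta>: "0 \<le> \<delta>" "\<delta> * sqrt (1 + p) ^ (d - 1) < 1"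
  shows "intersection_body_in V (star_set UNIV (dented_radial \<delta> p e) \<inter> V)"
proof -
  obtain z y where zy: "z \<in> span V" "\<And>w. w \<in> span V \<Longrightarrow> orthogonal y w" "e = z + y"
    using orthogonal_subspace_decomp_exists by metis
  have sp: "span V = V" using V by (simp add: span_eq_iff)
  have z: "z \<in> V" "x \<bullet> e = x \<bullet> z" if "x \<in> V" for x
    using zy sp that by (auto simp: inner_add_right orthogonal_def inner_commute)
  have zV: "z \<in> V" using zy sp by simp
  have "(norm z)\<^sup>2 = z \<bullet> e" using z(2)[OF zV] by (simp add: power2_norm_eq_inner)
  also have "\<dots> \<le> norm z" using norm_cauchy_schwarz[of z e] e by simp
  finally have "norm z \<le> 1" by (cases "z = 0") (auto simp: power2_eq_square)
  then have "sqrt (1 + p * (norm z)\<^sup>2) \<le> sqrt (1 + p)"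
    using p by (auto intro!: mult_left_le simp: abs_square_le_1)
  then have "sqrt (1 + p * (norm z)\<^sup>2) ^ (d - 1) \<le> sqrt (1 + p) ^ (d - 1)"
    using p by (intro power_mono) auto
  then have "\<delta> * sqrt (1 + p * (norm z)\<^sup>2) ^ (d - 1) < 1"
    using \<delta> by (meson le_less_trans mult_left_mono)
  then obtain L where "is_intersection_body_of_in V (star_set V (dented_radial \<delta> p e)) L"
    using dented_is_intersection_body[OF V d zV z(2) p \<delta>(1)] by blast
  moreover have "star_set UNIV (dented_radial \<delta> p e) \<inter> V = star_set V (dented_radial \<delta> p e)"
    by (auto simp: star_set_def)
  ultimately show ?thesis using intersection_body_inI[of V _ L] V d by simp
qed

section \<open>Convexity of the dented ball\<close>

lemma convex_on_inverse:
  fixes F F' F'' :: "real \<Rightarrow> real"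
  assumes pos: "\<And>s. F s > 0"
    and d1: "\<And>s. (F has_real_derivative F' s) (at s)"
    and d2: "\<And>s. (F' has_real_derivative F'' s) (at s)"
    and ge: "\<And>s. F s * F'' s \<le> 2 * (F' s)\<^sup>2"
  shows "convex_on UNIV (\<lambda>s. 1 / F s)"
proof (rule f''_ge0_imp_convex)
  fix s :: real
  have F: "F s \<noteq> 0" "F s > 0" using pos[of s] by auto
  show "((\<lambda>s. 1 / F s) has_real_derivative - F' s / (F s)\<^sup>2) (at s)"
    by (rule derivative_eq_intros d1 refl F(1))+ (simp add: power2_eq_square)
  show "((\<lambda>s. - F' s / (F s)\<^sup>2) has_real_derivative (2 * (F' s)\<^sup>2 - F s * F'' s) / (F s) ^ 3) (at s)"
    using F by (auto intro!: derivative_eq_intros d1 d2 simp: field_simps power2_eq_square power3_eq_cube)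
  show "0 \<le> (2 * (F' s)\<^sup>2 - F s * F'' s) / (F s) ^ 3"
    using ge[of s] F(2) by (intro divide_nonneg_pos) auto
qed simp

lemma DERIV_inverse_sqrt_quadratic:
  fixes c0 c1 c2 s :: real
  defines "Q \<equiv> \<lambda>s. c0 + 2 * c1 * s + c2 * s\<^sup>2"
  assumes "Q s > 0"
  shows "((\<lambda>s. 1 / sqrt (Q s)) has_real_derivative - (c1 + c2 * s) * (1 / sqrt (Q s)) ^ 3) (at s)"
    and "((\<lambda>s. - (c1 + c2 * s) * (1 / sqrt (Q s)) ^ 3) has_real_derivative
      3 * (c1 + c2 * s)\<^sup>2 * (1 / sqrt (Q s)) ^ 5 - c2 * (1 / sqrt (Q s)) ^ 3) (at s)"
proof -
  define y where "y = sqrt (Q s)"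
  have y: "y > 0" "Q s = y\<^sup>2" using assms(2) by (auto simp: y_def)
  have Q: "(Q has_real_derivative 2 * (c1 + c2 * s)) (at s)"
    unfolding Q_def by (auto intro!: derivative_eq_intros simp: algebra_simps)
  have S: "((\<lambda>s. sqrt (Q s)) has_real_derivative (c1 + c2 * s) / y) (at s)"
    by (rule DERIV_cong[OF DERIV_chain2[OF DERIV_real_sqrt[OF assms(2)] Q]])
       (use y in \<open>simp add: y_def[symmetric] field_simps\<close>)
  have "((\<lambda>s. inverse (sqrt (Q s))) has_real_derivative
      - (inverse y * ((c1 + c2 * s) / y) * inverse y)) (at s)"
    by (rule DERIV_inverse'[OF S, folded y_def]) (use y(1) in simp)
  moreover have "- (inverse y * ((c1 + c2 * s) / y) * inverse y) = - (c1 + c2 * s) * (1 / sqrt (Q s)) ^ 3"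
    using y(1) by (simp add: y_def[symmetric] field_simps power3_eq_cube)
  ultimately show 1: "((\<lambda>s. 1 / sqrt (Q s)) has_real_derivative - (c1 + c2 * s) * (1 / sqrt (Q s)) ^ 3) (at s)"
    unfolding inverse_eq_divide by simp
  have alg: "- c2 * r ^ 3 + of_nat 3 * (- D * r ^ 3 * r ^ (3 - Suc 0)) * - D = 3 * D\<^sup>2 * r ^ 5 - c2 * r ^ 3"
    for r D :: real
    by (simp add: algebra_simps power2_eq_square eval_nat_numeral)
  have L: "((\<lambda>s. - (c1 + c2 * s)) has_real_derivative - c2) (at s)"
    by (auto intro!: derivative_eq_intros)
  show "((\<lambda>s. - (c1 + c2 * s) * (1 / sqrt (Q s)) ^ 3) has_real_derivative
      3 * (c1 + c2 * s)\<^sup>2 * (1 / sqrt (Q s)) ^ 5 - c2 * (1 / sqrt (Q s)) ^ 3) (at s)"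
    by (rule DERIV_cong[OF DERIV_mult[OF L DERIV_power[OF 1, of 3]] alg])
qed

text \<open>On the line \<open>x + s v\<close>, where \<open>x\<close> is orthogonal to the unit vector \<open>v\<close> and \<open>m2 = |x|\<^sup>2\<close>, let
  \<open>U = |x + s v|\<^sup>-\<^sup>1\<close>, let \<open>Y\<close> be the inverse of the norm in the second term of \<open>dented_radial\<close>, and
  \<open>F = U - \<delta> Y\<close>. Then the inequality says \<open>F F'' \<le> 2 F'\<^sup>2\<close>, which is the convexity of \<open>1 / F\<close>. The reason:
  the mixed terms are a square up to terms that carry the factor \<open>m2\<close>, as does the main term \<open>m2 U\<^sup>6\<close>.\<close>

lemma dented_second_order:
  fixes U Y :: real
  assumes U: "U\<^sup>2 * (m2 + s\<^sup>2) = 1" and Y: "Y\<^sup>2 * (c0 + 2 * c1 * s + c2 * s\<^sup>2) = 1"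
    and YU: "0 < Y" "Y \<le> U" and m2: "0 \<le> m2" and p: "0 \<le> p"
    and \<Delta>: "0 \<le> c0 * c2 - c1\<^sup>2" "c0 * c2 - c1\<^sup>2 \<le> m2 * (1 + p)"
    and \<delta>: "0 \<le> \<delta>" "\<delta> * (2 + p) \<le> 1"
  defines "D \<equiv> c1 + c2 * s"
  shows "(U - \<delta> * Y) * ((3 * s\<^sup>2 * U ^ 5 - U ^ 3) - \<delta> * (3 * D\<^sup>2 * Y ^ 5 - c2 * Y ^ 3)) \<le>
    2 * (- s * U ^ 3 + \<delta> * (D * Y ^ 3))\<^sup>2"
proof -
  define E where "E = c0 * c2 - c1\<^sup>2"
  have D: "c2 * (c0 + 2 * c1 * s + c2 * s\<^sup>2) = D\<^sup>2 + E"
    unfolding D_def E_def by (simp add: power2_eq_square algebra_simps)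
  have U3: "U ^ 3 = U ^ 5 * (m2 + s\<^sup>2)" and U4: "U ^ 4 = U ^ 6 * (m2 + s\<^sup>2)"
    using U by (simp_all add: eval_nat_numeral)
  have Y3: "c2 * Y ^ 3 = Y ^ 5 * (D\<^sup>2 + E)" and Y4: "c2 * Y ^ 4 = Y ^ 6 * (D\<^sup>2 + E)"
  proof -
    have "Y ^ 5 * (D\<^sup>2 + E) = c2 * Y ^ 3 * (Y\<^sup>2 * (c0 + 2 * c1 * s + c2 * s\<^sup>2))"
      unfolding D[symmetric] by (simp add: eval_nat_numeral)
    then show "c2 * Y ^ 3 = Y ^ 5 * (D\<^sup>2 + E)" unfolding Y by simp
    then show "c2 * Y ^ 4 = Y ^ 6 * (D\<^sup>2 + E)" by (simp add: eval_nat_numeral)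
  qed
  have "2 * (- s * U ^ 3 + \<delta> * (D * Y ^ 3))\<^sup>2 -
      (U - \<delta> * Y) * ((3 * s\<^sup>2 * U ^ 5 - U ^ 3) - \<delta> * (3 * D\<^sup>2 * Y ^ 5 - c2 * Y ^ 3)) =
    (U ^ 4 - s\<^sup>2 * U ^ 6) + \<delta>\<^sup>2 * (c2 * Y ^ 4 - D\<^sup>2 * Y ^ 6) +
      \<delta> * (- 4 * s * D * U ^ 3 * Y ^ 3 + U * (3 * D\<^sup>2 * Y ^ 5 - c2 * Y ^ 3) + Y * (3 * s\<^sup>2 * U ^ 5 - U ^ 3))"
    by (simp add: eval_nat_numeral algebra_simps)
  also have "U ^ 4 - s\<^sup>2 * U ^ 6 = m2 * U ^ 6" unfolding U4 by (simp add: algebra_simps)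
  also have "c2 * Y ^ 4 - D\<^sup>2 * Y ^ 6 = E * Y ^ 6" unfolding Y4 by (simp add: algebra_simps)
  also have "- 4 * s * D * U ^ 3 * Y ^ 3 + U * (3 * D\<^sup>2 * Y ^ 5 - c2 * Y ^ 3) + Y * (3 * s\<^sup>2 * U ^ 5 - U ^ 3) =
      2 * U * Y * (s * U\<^sup>2 - D * Y\<^sup>2)\<^sup>2 - m2 * U ^ 5 * Y - E * U * Y ^ 5"
  proof -
    have "Y * (3 * s\<^sup>2 * U ^ 5 - U ^ 3) = Y * U ^ 5 * (2 * s\<^sup>2 - m2)" unfolding U3 by (simp add: algebra_simps)
    then show ?thesis unfolding Y3 by (simp add: eval_nat_numeral algebra_simps)
  qed
  finally have eq: "2 * (- s * U ^ 3 + \<delta> * (D * Y ^ 3))\<^sup>2 -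
      (U - \<delta> * Y) * ((3 * s\<^sup>2 * U ^ 5 - U ^ 3) - \<delta> * (3 * D\<^sup>2 * Y ^ 5 - c2 * Y ^ 3)) =
    m2 * U ^ 6 + \<delta>\<^sup>2 * (E * Y ^ 6) + \<delta> * (2 * U * Y * (s * U\<^sup>2 - D * Y\<^sup>2)\<^sup>2 - m2 * U ^ 5 * Y - E * U * Y ^ 5)" .
  have U0: "U > 0" using YU by simp
  have "m2 * U ^ 5 * Y \<le> m2 * U ^ 5 * U" using YU U0 m2 by (intro mult_left_mono) auto
  then have 1: "m2 * U ^ 5 * Y \<le> m2 * U ^ 6" by (simp add: eval_nat_numeral mult_ac)
  have "E * U * Y ^ 5 \<le> (m2 * (1 + p)) * U * U ^ 5"
    using YU U0 \<Delta> m2 p unfolding E_def[symmetric]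
    by (intro mult_mono power_mono) auto
  then have 2: "E * U * Y ^ 5 \<le> m2 * U ^ 6 * (1 + p)" by (simp add: eval_nat_numeral mult_ac)
  have "0 \<le> 2 * U * Y * (s * U\<^sup>2 - D * Y\<^sup>2)\<^sup>2" using YU U0 by simp
  then have "- (m2 * U ^ 6 * (2 + p)) \<le> 2 * U * Y * (s * U\<^sup>2 - D * Y\<^sup>2)\<^sup>2 - m2 * U ^ 5 * Y - E * U * Y ^ 5"
    using 1 2 by (simp add: algebra_simps)
  from mult_left_mono[OF this \<delta>(1)]
  have "- (m2 * U ^ 6 * (\<delta> * (2 + p))) \<le> \<delta> * (2 * U * Y * (s * U\<^sup>2 - D * Y\<^sup>2)\<^sup>2 - m2 * U ^ 5 * Y - E * U * Y ^ 5)"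
    by (simp add: mult_ac)
  moreover have "m2 * U ^ 6 * (\<delta> * (2 + p)) \<le> m2 * U ^ 6" using \<delta> m2 U0 by (intro mult_left_le) auto
  moreover have "0 \<le> \<delta>\<^sup>2 * (E * Y ^ 6)" using \<Delta>(1) YU unfolding E_def by simp
  ultimately show ?thesis using eq by linarith
qed

text \<open>Bessel's inequality for the orthogonal pair \<open>x\<close>, \<open>v\<close>, multiplied by \<open>|x|\<^sup>2\<close>.\<close>

lemma bessel_two:
  fixes x v e :: "'a::real_inner"
  assumes "orthogonal v x" "norm v = 1" "norm e = 1"
  shows "(x \<bullet> e)\<^sup>2 + (v \<bullet> e)\<^sup>2 * (norm x)\<^sup>2 \<le> (norm x)\<^sup>2"
proof -
  let ?m = "(norm x)\<^sup>2"
  define S where "S = (x \<bullet> e)\<^sup>2 + (v \<bullet> e)\<^sup>2 * ?m"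
  let ?h = "(x \<bullet> e) *\<^sub>R x + ((v \<bullet> e) * ?m) *\<^sub>R v"
  have "?h \<bullet> e = S" by (simp add: S_def inner_add_left power2_eq_square)
  moreover have "(norm ?h)\<^sup>2 = ?m * S"
    using assms by (simp add: S_def orthogonal_def power2_norm_eq_inner inner_add_left inner_add_right
        inner_commute norm_eq_1 algebra_simps) (simp add: power2_eq_square algebra_simps)
  moreover have "(?h \<bullet> e)\<^sup>2 \<le> (norm ?h)\<^sup>2"
    using Cauchy_Schwarz_ineq[of ?h e] assms(3) by (simp add: power2_norm_eq_inner norm_eq_1)
  ultimately have "S * S \<le> ?m * S" by (simp add: power2_eq_square)
  moreover have "S \<ge> 0" by (simp add: S_def)
  ultimately have "S \<le> ?m" by (cases "S = 0") auto
  then show ?thesis unfolding S_def .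
qed

text \<open>On a line that misses the origin the gauge \<open>1 / \<rho>\<close> is smooth; \<open>x\<close> is the point of the line closest
  to the origin.\<close>

lemma convex_on_dented_line:
  fixes e v x :: "'a::euclidean_space"
  assumes e: "norm e = 1" and v: "orthogonal v x" "norm v = 1" and x: "x \<noteq> 0"
    and p: "0 \<le> p" and \<delta>: "0 \<le> \<delta>" "\<delta> * (2 + p) \<le> 1"
  shows "convex_on UNIV (\<lambda>s. 1 / dented_radial \<delta> p e (x + s *\<^sub>R v))"
proof -
  define m2 where "m2 = (norm x)\<^sup>2"
  define \<alpha> \<beta> where "\<alpha> = x \<bullet> e" "\<beta> = v \<bullet> e"
  define c0 c1 c2 where "c0 = m2 + p * \<alpha>\<^sup>2" "c1 = p * \<alpha> * \<beta>" "c2 = 1 + p * \<beta>\<^sup>2"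
  define X Q where "X s = m2 + 2 * 0 * s + 1 * s\<^sup>2" "Q s = c0 + 2 * c1 * s + c2 * s\<^sup>2" for s
  define U Y where "U s = 1 / sqrt (X s)" "Y s = 1 / sqrt (Q s)" for s
  have n: "(norm (x + s *\<^sub>R v))\<^sup>2 = X s" for s
    using norm_add_orthogonal_unit[OF v] by (simp add: X_Q_def m2_def)
  have ie: "(x + s *\<^sub>R v) \<bullet> e = \<alpha> + s * \<beta>" for s by (simp add: inner_add_left \<alpha>_\<beta>_def)
  have Q: "Q s = X s + p * (\<alpha> + s * \<beta>)\<^sup>2" for s
    by (simp add: X_Q_def c0_c1_c2_def power2_eq_square algebra_simps)
  have m2: "m2 > 0" using x by (simp add: m2_def)
  have X: "X s > 0" for s using m2 by (simp add: X_Q_def add_pos_nonneg)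
  have XQ: "X s \<le> Q s" for s using p by (simp add: Q)
  have Qpos: "Q s > 0" for s using X XQ by (rule less_le_trans)
  have YU: "0 < Y s" "Y s \<le> U s" for s
    using X[of s] Qpos[of s] XQ[of s] by (auto simp: U_Y_def intro!: divide_left_mono)
  have F: "dented_radial \<delta> p e (x + s *\<^sub>R v) = U s - \<delta> * Y s" for s
    unfolding dented_radial_def n ie Q[symmetric] U_Y_def
    by (simp flip: n)
  have \<delta>1: "\<delta> < 1"
  proof (cases "\<delta> = 0")
    case False
    then have "\<delta> * 1 < \<delta> * (2 + p)" using \<delta> p by (intro mult_strict_left_mono) auto
    then show ?thesis using \<delta> by simp
  qed simp
  have bes: "\<alpha>\<^sup>2 + \<beta>\<^sup>2 * m2 \<le> m2" using bessel_two[OF v e] by (simp add: \<alpha>_\<beta>_def m2_def)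
  have "c0 * c2 - c1\<^sup>2 = m2 + p * (\<alpha>\<^sup>2 + \<beta>\<^sup>2 * m2)"
    by (simp add: c0_c1_c2_def power2_eq_square algebra_simps)
  moreover have "p * (\<alpha>\<^sup>2 + \<beta>\<^sup>2 * m2) \<le> p * m2" using bes p by (rule mult_left_mono)
  moreover have "0 \<le> p * (\<alpha>\<^sup>2 + \<beta>\<^sup>2 * m2)" using p m2 by simp
  ultimately have \<Delta>: "0 \<le> c0 * c2 - c1\<^sup>2" "c0 * c2 - c1\<^sup>2 \<le> m2 * (1 + p)"
    using m2 by (simp_all add: algebra_simps)
  have "convex_on UNIV (\<lambda>s. 1 / (U s - \<delta> * Y s))"
  proof (rule convex_on_inverse[where
        F' = "\<lambda>s. - (0 + 1 * s) * (U s) ^ 3 - \<delta> * (- (c1 + c2 * s) * (Y s) ^ 3)" and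
        F'' = "\<lambda>s. (3 * (0 + 1 * s)\<^sup>2 * (U s) ^ 5 - 1 * (U s) ^ 3) -
          \<delta> * (3 * (c1 + c2 * s)\<^sup>2 * (Y s) ^ 5 - c2 * (Y s) ^ 3)"])
    fix s
    have "\<delta> * Y s \<le> \<delta> * U s" using YU \<delta> by (intro mult_left_mono) auto
    also have "\<dots> < 1 * U s" using \<delta>1 YU[of s] by (intro mult_strict_right_mono) auto
    finally show "U s - \<delta> * Y s > 0" by simp
    note dU = DERIV_inverse_sqrt_quadratic[of m2 0 s 1, folded X_Q_def, OF X, folded U_Y_def]
    note dY = DERIV_inverse_sqrt_quadratic[of c0 c1 s c2, folded X_Q_def, OF Qpos, folded U_Y_def]
    show "((\<lambda>s. U s - \<delta> * Y s) has_real_derivative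
        - (0 + 1 * s) * (U s) ^ 3 - \<delta> * (- (c1 + c2 * s) * (Y s) ^ 3)) (at s)"
      by (intro DERIV_diff DERIV_cmult dU dY)
    show "((\<lambda>s. - (0 + 1 * s) * (U s) ^ 3 - \<delta> * (- (c1 + c2 * s) * (Y s) ^ 3)) has_real_derivative
        (3 * (0 + 1 * s)\<^sup>2 * (U s) ^ 5 - 1 * (U s) ^ 3) -
          \<delta> * (3 * (c1 + c2 * s)\<^sup>2 * (Y s) ^ 5 - c2 * (Y s) ^ 3)) (at s)"
      by (intro DERIV_diff DERIV_cmult dU dY)
    have U1: "(U s)\<^sup>2 * (m2 + s\<^sup>2) = 1" and Y1: "(Y s)\<^sup>2 * (c0 + 2 * c1 * s + c2 * s\<^sup>2) = 1"
      using X[of s] Qpos[of s] by (simp_all add: U_Y_def X_Q_def power_divide)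
    have F': "- (0 + 1 * s) * (U s) ^ 3 - \<delta> * (- (c1 + c2 * s) * (Y s) ^ 3) =
        - s * (U s) ^ 3 + \<delta> * ((c1 + c2 * s) * (Y s) ^ 3)" by (simp add: algebra_simps)
    show "(U s - \<delta> * Y s) * ((3 * (0 + 1 * s)\<^sup>2 * (U s) ^ 5 - 1 * (U s) ^ 3) -
          \<delta> * (3 * (c1 + c2 * s)\<^sup>2 * (Y s) ^ 5 - c2 * (Y s) ^ 3)) \<le>
        2 * (- (0 + 1 * s) * (U s) ^ 3 - \<delta> * (- (c1 + c2 * s) * (Y s) ^ 3))\<^sup>2"
      unfolding F' using dented_second_order[OF U1 Y1 YU _ p \<Delta> \<delta>] m2 by simp
  qed
  then show ?thesis unfolding F .
qed

text \<open>It suffices to see that every line meets the set in a convex set. A line through the origin meets it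
  in a segment, on the other lines the gauge is convex.\<close>

lemma convex_dented:
  fixes e :: "'a::euclidean_space"
  assumes e: "norm e = 1" and p: "0 \<le> p" and \<delta>: "0 \<le> \<delta>" "\<delta> < 1" "\<delta> * (2 + p) \<le> 1"
  shows "convex (star_set UNIV (dented_radial \<delta> p e))"
proof -
  let ?K = "star_set UNIV (dented_radial \<delta> p e)"
  interpret radial_function UNIV "dented_radial \<delta> p e"
    by (rule radial_function_dented) (use \<delta> p in auto)
  have line: "convex {s. x + s *\<^sub>R v \<in> ?K}" if v: "orthogonal v x" "norm v = 1" for x v
  proof (cases "x = 0")
    case True
    have "s *\<^sub>R v \<in> ?K \<longleftrightarrow> \<bar>s\<bar> \<le> dented_radial \<delta> p e v" for s
    proof (cases s "0::real" rule: linorder_cases)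
      case less
      then have "s *\<^sub>R v \<in> ?K \<longleftrightarrow> (- s) *\<^sub>R v \<in> ?K"
        using dented_radial_minus[of \<delta> p e "s *\<^sub>R v"] by (simp add: star_set_def)
      also have "\<dots> \<longleftrightarrow> - s \<le> dented_radial \<delta> p e v"
        using v less by (intro scale_mem_iff) auto
      finally show ?thesis using less by simp
    next
      case equal
      have "v \<noteq> 0" using v by auto
      then have "dented_radial \<delta> p e v > 0" using pos[of v] by simp
      then show ?thesis using equal by (simp add: star_set_def)
    next
      case greater
      then have "s *\<^sub>R v \<in> ?K \<longleftrightarrow> s \<le> dented_radial \<delta> p e v"
        using v by (intro scale_mem_iff) auto
      then show ?thesis using greater by simp
    qed
    then have "{s. x + s *\<^sub>R v \<in> ?K} = {- dented_radial \<delta> p e v..dented_radial \<delta> p e v}"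
      using True by (simp add: set_eq_iff abs_le_iff minus_le_iff) auto
    then show ?thesis by simp
  next
    case False
    let ?g = "\<lambda>s. 1 / dented_radial \<delta> p e (x + s *\<^sub>R v)"
    have ne: "x + s *\<^sub>R v \<noteq> 0" for s
    proof
      assume "x + s *\<^sub>R v = 0"
      then have "(norm x)\<^sup>2 + s\<^sup>2 = 0" using norm_add_orthogonal_unit[OF v, of s] by simp
      then show False using False by (simp add: sum_power2_eq_zero_iff)
    qed
    have "x + s *\<^sub>R v \<in> ?K \<longleftrightarrow> ?g s \<le> 1" for s
      using ne[of s] pos[of "x + s *\<^sub>R v"] by (simp add: star_set_def)
    then have S: "{s. x + s *\<^sub>R v \<in> ?K} = {s \<in> UNIV. ?g s \<le> 1}" by simp
    have cv: "convex_on UNIV ?g" by (rule convex_on_dented_line[OF e v False p \<delta>(1,3)])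
    show ?thesis
      unfolding S
    proof (rule convexI)
      fix a b u w :: real
      assume ab: "a \<in> {s \<in> UNIV. ?g s \<le> 1}" "b \<in> {s \<in> UNIV. ?g s \<le> 1}" and uw: "0 \<le> u" "0 \<le> w" "u + w = 1"
      have "?g (u *\<^sub>R a + w *\<^sub>R b) \<le> u * ?g a + w * ?g b"
        using cv uw unfolding convex_on_def by blast
      also have "\<dots> \<le> 1" using ab uw by (intro convex_bound_le) auto
      finally show "u *\<^sub>R a + w *\<^sub>R b \<in> {s \<in> UNIV. ?g s \<le> 1}" by simp
    qed
  qed
  show ?thesis
  proof (rule convexI)
    fix x y and u w :: real
    assume xy: "x \<in> ?K" "y \<in> ?K" and uw: "0 \<le> u" "0 \<le> w" "u + w = 1"
    show "u *\<^sub>R x + w *\<^sub>R y \<in> ?K"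
    proof (cases "x = y")
      case True
      then show ?thesis using xy uw by (simp flip: scaleR_left_distrib)
    next
      case False
      define v where "v = (y - x) /\<^sub>R norm (y - x)"
      have v: "norm v = 1" using False by (simp add: v_def)
      define t where "t = norm (y - x)"
      have yx: "y = x + t *\<^sub>R v" using False by (simp add: v_def t_def)
      define r where "r = v \<bullet> x"
      define x0 where "x0 = x - r *\<^sub>R v"
      have "orthogonal v x0" using v by (simp add: x0_def r_def orthogonal_def inner_diff_right norm_eq_1)
      from line[OF this v] have c: "convex {s. x0 + s *\<^sub>R v \<in> ?K}" .
      have x: "x = x0 + r *\<^sub>R v" by (simp add: x0_def)
      then have y: "y = x0 + (r + t) *\<^sub>R v" by (simp add: yx scaleR_left_distrib)
      have "u *\<^sub>R r + w *\<^sub>R (r + t) \<in> {s. x0 + s *\<^sub>R v \<in> ?K}"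
        by (rule convexD[OF c]) (use xy uw in \<open>simp_all add: x[symmetric] y[symmetric]\<close>)
      moreover have "u *\<^sub>R x + w *\<^sub>R y = x0 + (u *\<^sub>R r + w *\<^sub>R (r + t)) *\<^sub>R v"
      proof -
        have "u *\<^sub>R x0 + w *\<^sub>R x0 = x0" using uw(3) by (metis scaleR_left_distrib scaleR_one)
        then show ?thesis unfolding x y by (simp add: algebra_simps)
      qed
      ultimately show ?thesis by simp
    qed
  qed
qed

lemma convex_body_dented:
  fixes e :: "'a::euclidean_space"
  assumes e: "norm e = 1" and p: "0 \<le> p" and \<delta>: "0 \<le> \<delta>" "\<delta> < 1" "\<delta> * (2 + p) \<le> 1"
  shows "convex_body (star_set UNIV (dented_radial \<delta> p e))"
  unfolding convex_body_def
proof (intro conjI)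
  interpret radial_function UNIV "dented_radial \<delta> p e"
    by (rule radial_function_dented) (use \<delta> p in auto)
  let ?K = "star_set UNIV (dented_radial \<delta> p e)"
  show "compact ?K" using star_body_star_set by (simp add: star_body_in_def)
  show "convex ?K" by (rule convex_dented[OF assms])
  have "ball 0 (1 - \<delta>) \<subseteq> ?K"
  proof
    fix x :: 'a assume x: "x \<in> ball 0 (1 - \<delta>)"
    show "x \<in> ?K"
    proof (cases "x = 0")
      case False
      then have "1 \<le> (1 - \<delta>) / norm x" using x by simp
      then show ?thesis
        using dented_radial_lower[OF \<delta>(1) p False, of e] by (simp add: star_set_def)
    qed (simp add: star_set_def)
  qed
  then show "0 \<in> interior ?K" using \<delta>(2) unfolding mem_interior by (intro exI[of _ "1 - \<delta>"]) simp
qed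

section \<open>Duality for central hyperplane sections\<close>

text \<open>The measure \<open>ds / |s|\<close> is invariant under \<open>s \<mapsto> c / s\<close>. It suffices to treat \<open>c = -1\<close>, where the
  substitution is increasing on each half-line and exchanges the two; dilations do the rest.\<close>

lemma nn_integral_inversion:
  fixes h :: "real \<Rightarrow> ennreal"
  assumes [measurable]: "h \<in> borel_measurable borel" and c: "c \<noteq> 0"
  shows "(\<integral>\<^sup>+ s. h s * ennreal (1 / \<bar>s\<bar>) \<partial>lborel) = (\<integral>\<^sup>+ s. h (c / s) * ennreal (1 / \<bar>s\<bar>) \<partial>lborel)"
proof -
  have half: "(\<integral>\<^sup>+ s. h s * ennreal (1 / \<bar>s\<bar>) * indicator {..<0} s \<partial>lborel) =
      (\<integral>\<^sup>+ s. h (- 1 / s) * ennreal (1 / \<bar>s\<bar>) * indicator {0<..} s \<partial>lborel)"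
    if [measurable]: "h \<in> borel_measurable borel" for h :: "real \<Rightarrow> ennreal"
  proof -
    define b where "b n = real n + 2" for n :: nat
    have b: "b n > 0" "1 / b n < b n" for n
    proof -
      show 1: "b n > 0" by (simp add: b_def)
      have "b n * b n > 1" by (simp add: b_def algebra_simps add_pos_nonneg)
      then show "1 / b n < b n" using 1 by (simp add: divide_less_eq)
    qed
    let ?f = "\<lambda>s. h s * ennreal (1 / \<bar>s\<bar>)" and ?g = "\<lambda>s. h (- 1 / s) * ennreal (1 / \<bar>s\<bar>)"
    let ?A = "\<lambda>n. {- b n..- 1 / b n}" and ?B = "\<lambda>n. {1 / b n..b n}"
    have ex: "\<exists>n. 1 / b n \<le> x \<and> x \<le> b n" if x: "x > 0" for x
    proof -
      obtain n where n: "x + 1 / x < real n" using reals_Archimedean2 by blast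
      have "1 / x \<le> b n" "x \<le> b n" using n x by (auto simp: b_def add_increasing intro: less_imp_le)
         (smt (verit) divide_nonneg_nonneg)+
      then show ?thesis using x b(1)[of n] by (intro exI[of _ n]) (auto simp: field_simps)
    qed
    have mono: "m \<le> n \<Longrightarrow> b m \<le> b n \<and> 1 / b n \<le> 1 / b m" for m n
      using b(1)[of m] by (auto simp: b_def intro!: divide_left_mono)
    have incA: "incseq ?A" and incB: "incseq ?B"
      using mono by (force simp: incseq_def)+
    have "(\<Union>n. ?B n) = {0<..}"
      using ex b by (auto intro: less_le_trans[of 0 "1 / b _"])
    then have UB: "(\<integral>\<^sup>+ s. ?g s * indicator {0<..} s \<partial>lborel) = (SUP n. \<integral>\<^sup>+ s. ?g s * indicator (?B n) s \<partial>lborel)"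
      using SUP_emeasure_incseq[of ?B "density lborel ?g", OF _ incB]
      by (simp add: emeasure_density image_subset_iff)
    have "(\<Union>n. ?A n) = {..<0}"
    proof (intro set_eqI iffI)
      fix x assume "x \<in> (\<Union>n. ?A n)"
      then obtain n where "x \<le> - 1 / b n" by auto
      moreover have "- 1 / b n < 0" using b(1)[of n] by simp
      ultimately have "x < 0" by linarith
      then show "x \<in> {..<0}" by simp
    next
      fix x :: real assume "x \<in> {..<0}"
      then obtain n where "1 / b n \<le> - x" "- x \<le> b n" using ex[of "- x"] by auto
      then have "x \<in> ?A n" by auto
      then show "x \<in> (\<Union>n. ?A n)" by blast
    qed
    then have UA: "(\<integral>\<^sup>+ s. ?f s * indicator {..<0} s \<partial>lborel) = (SUP n. \<integral>\<^sup>+ s. ?f s * indicator (?A n) s \<partial>lborel)"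
      using SUP_emeasure_incseq[of ?A "density lborel ?f", OF _ incA]
      by (simp add: emeasure_density image_subset_iff)
    have "(\<integral>\<^sup>+ s. ?f s * indicator (?A n) s \<partial>lborel) = (\<integral>\<^sup>+ s. ?g s * indicator (?B n) s \<partial>lborel)" for n
    proof -
      have pos: "x > 0" if "x \<in> ?B n" for x using that b(1)[of n] by (auto intro: less_le_trans[of 0 "1 / b n"])
      have "(\<integral>\<^sup>+ s. ?f s * indicator {- 1 / (1 / b n)..- 1 / b n} s \<partial>lborel) =
          (\<integral>\<^sup>+ s. ?f (- 1 / s) * ennreal (1 / s\<^sup>2) * indicator (?B n) s \<partial>lborel)"
      proof (rule nn_integral_substitution_aux)
        show "((\<lambda>x. - 1 / x) has_real_derivative 1 / x\<^sup>2) (at x)" if "x \<in> ?B n" for x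
          using pos[OF that] by (auto intro!: derivative_eq_intros simp: power2_eq_square)
        show "continuous_on (?B n) (\<lambda>x. 1 / x\<^sup>2)"
          using pos by (intro continuous_intros) fastforce
      qed (use b in auto)
      also have "\<dots> = (\<integral>\<^sup>+ s. ?g s * indicator (?B n) s \<partial>lborel)"
      proof (intro nn_integral_cong)
        fix s
        show "?f (- 1 / s) * ennreal (1 / s\<^sup>2) * indicator (?B n) s = ?g s * indicator (?B n) s"
        proof (cases "s \<in> ?B n")
          case True
          then have "1 / \<bar>- 1 / s\<bar> * (1 / s\<^sup>2) = 1 / \<bar>s\<bar>" using pos[OF True] by (simp add: power2_eq_square)
          then have "ennreal (1 / \<bar>- 1 / s\<bar>) * ennreal (1 / s\<^sup>2) = ennreal (1 / \<bar>s\<bar>)"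
            by (simp add: ennreal_mult[symmetric])
          then show ?thesis using True by (simp add: mult.assoc)
        qed simp
      qed
      finally show ?thesis by simp
    qed
    then show ?thesis unfolding UA UB by simp
  qed
  have m1: "(\<integral>\<^sup>+ s. h s * ennreal (1 / \<bar>s\<bar>) \<partial>lborel) = (\<integral>\<^sup>+ s. h (- 1 / s) * ennreal (1 / \<bar>s\<bar>) \<partial>lborel)"
    if [measurable]: "h \<in> borel_measurable borel" for h :: "real \<Rightarrow> ennreal"
  proof -
    have split: "(\<integral>\<^sup>+ s. g s * ennreal (1 / \<bar>s\<bar>) \<partial>lborel) =
        (\<integral>\<^sup>+ s. g s * ennreal (1 / \<bar>s\<bar>) * indicator {..<0} s \<partial>lborel) +
        (\<integral>\<^sup>+ s. g s * ennreal (1 / \<bar>s\<bar>) * indicator {0<..} s \<partial>lborel)"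
      if [measurable]: "g \<in> borel_measurable borel" for g :: "real \<Rightarrow> ennreal"
      by (subst nn_integral_add[symmetric]) (auto intro!: nn_integral_cong simp: indicator_def)
    have "(\<lambda>s. h (- 1 / s)) \<in> borel_measurable borel" by measurable
    from half[OF this] have "(\<integral>\<^sup>+ s. h (- 1 / s) * ennreal (1 / \<bar>s\<bar>) * indicator {..<0} s \<partial>lborel) =
      (\<integral>\<^sup>+ s. h s * ennreal (1 / \<bar>s\<bar>) * indicator {0<..} s \<partial>lborel)" by simp
    then show ?thesis using half[OF that] by (subst (1 2) split) (simp_all add: add.commute)
  qed
  have scale: "(\<integral>\<^sup>+ s. h s * ennreal (1 / \<bar>s\<bar>) \<partial>lborel) = (\<integral>\<^sup>+ s. h (k * s) * ennreal (1 / \<bar>s\<bar>) \<partial>lborel)"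
    if [measurable]: "h \<in> borel_measurable borel" and k: "k \<noteq> 0" for h :: "real \<Rightarrow> ennreal" and k
  proof -
    have "(\<integral>\<^sup>+ s. h s * ennreal (1 / \<bar>s\<bar>) \<partial>lborel) = \<bar>k\<bar> * (\<integral>\<^sup>+ s. h (k * s) * ennreal (1 / \<bar>k * s\<bar>) \<partial>lborel)"
      by (subst nn_integral_real_affine[where c = k and t = 0]) (use k in auto)
    also have "\<dots> = (\<integral>\<^sup>+ s. \<bar>k\<bar> * (h (k * s) * ennreal (1 / \<bar>k * s\<bar>)) \<partial>lborel)"
      by (subst nn_integral_cmult) auto
    also have "\<dots> = (\<integral>\<^sup>+ s. h (k * s) * ennreal (1 / \<bar>s\<bar>) \<partial>lborel)"
    proof (intro nn_integral_cong)
      fix s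
      have "ennreal \<bar>k\<bar> * ennreal (1 / \<bar>k * s\<bar>) = ennreal (1 / \<bar>s\<bar>)"
        using k by (simp add: ennreal_mult[symmetric] abs_mult)
      then show "ennreal \<bar>k\<bar> * (h (k * s) * ennreal (1 / \<bar>k * s\<bar>)) = h (k * s) * ennreal (1 / \<bar>s\<bar>)"
        by (metis mult.commute mult.left_commute)
    qed
    finally show ?thesis .
  qed
  have "(\<integral>\<^sup>+ s. h s * ennreal (1 / \<bar>s\<bar>) \<partial>lborel) = (\<integral>\<^sup>+ s. h (- c * s) * ennreal (1 / \<bar>s\<bar>) \<partial>lborel)"
    by (rule scale) (use c in auto)
  also have "\<dots> = (\<integral>\<^sup>+ s. h (- c * (- 1 / s)) * ennreal (1 / \<bar>s\<bar>) \<partial>lborel)"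
    by (rule m1) measurable
  finally show ?thesis by simp
qed

text \<open>The integral of \<open>F\<close> over \<open>\<xi>\<^sup>\<bottom>\<close>, divided by \<open>|\<xi>|\<close> and computed by parametrising \<open>\<xi>\<^sup>\<bottom>\<close> as a graph
  over \<open>e\<^sup>\<bottom>\<close>; see \<open>section_transform_eq\<close>. In this form it is visibly measurable in \<open>\<xi>\<close>.\<close>

definition section_transform :: "'a::euclidean_space \<Rightarrow> ('a \<Rightarrow> ennreal) \<Rightarrow> 'a \<Rightarrow> ennreal" where
  "section_transform e F \<xi> = ennreal (1 / \<bar>\<xi> \<bullet> e\<bar>) *
     (\<integral>\<^sup>+ y. F (y - ((y \<bullet> \<xi>) / (\<xi> \<bullet> e)) *\<^sub>R e) \<partial>subspace_lborel (perp_in UNIV e))"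

lemma measurable_section_transform [measurable]:
  fixes e :: "'a::euclidean_space"
  assumes [measurable]: "F \<in> borel_measurable borel"
  shows "section_transform e F \<in> borel_measurable borel"
proof -
  interpret sigma_finite_measure "subspace_lborel (perp_in UNIV e)"
    by (intro sigma_finite_subspace_lborel subspace_perp_in subspace_UNIV)
  show ?thesis unfolding section_transform_def by measurable
qed

text \<open>The graph map \<open>e\<^sup>\<bottom> \<rightarrow> \<xi>\<^sup>\<bottom>\<close> along \<open>e\<close> fixes the common subspace \<open>{e, \<xi>}\<^sup>\<bottom>\<close> and stretches the remaining
  direction \<open>u\<close> by the factor \<open>|\<xi>| / |\<langle>\<xi>, e\<rangle>|\<close>.\<close>

lemma section_transform_eq:
  fixes e :: "'a::euclidean_space"
  assumes dim: "DIM('a) \<ge> 2" and e: "norm e = 1" and \<xi>: "\<xi> \<bullet> e \<noteq> 0"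
    and [measurable]: "F \<in> borel_measurable borel"
  shows "section_transform e F \<xi> = ennreal (1 / norm \<xi>) * nn_integral (subspace_lborel (perp_in UNIV \<xi>)) F"
proof -
  let ?H = "perp_in UNIV e" and ?P = "perp_in UNIV \<xi>"
  have H: "subspace ?H" and P: "subspace ?P" by (rule subspace_perp_in[OF subspace_UNIV])+
  have e0: "e \<noteq> 0" using e by auto
  have dH: "dim ?H > 0" using dim_perp_in[OF subspace_UNIV, of e] e0 dim by simp
  define s where "s = \<xi> \<bullet> e"
  have s: "s \<noteq> 0" using \<xi> by (simp add: s_def)
  have "\<xi> - s *\<^sub>R e \<in> ?H" using e by (simp add: s_def orthogonal_def inner_diff_right norm_eq_1 inner_commute)
  from subspace_direction[OF H dH this] obtain u where
    u: "u \<in> ?H" "norm u = 1" "\<xi> - s *\<^sub>R e = norm (\<xi> - s *\<^sub>R e) *\<^sub>R u" .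
  define \<alpha> where "\<alpha> = norm (\<xi> - s *\<^sub>R e)"
  have \<xi>eq: "\<xi> = s *\<^sub>R e + \<alpha> *\<^sub>R u" using u(3) unfolding \<alpha>_def by (metis add.commute diff_add_cancel)
  have ip: "e \<bullet> u = 0" "u \<bullet> e = 0" "e \<bullet> e = 1" "u \<bullet> u = 1"
    using u e by (auto simp: orthogonal_def inner_commute norm_eq_1)
  define N where "N = norm \<xi>"
  have "N\<^sup>2 = s\<^sup>2 + \<alpha>\<^sup>2"
    unfolding N_def power2_norm_eq_inner \<xi>eq by (simp add: inner_add_left inner_add_right ip power2_eq_square)
  moreover have "\<xi> \<noteq> 0" using \<xi> by auto
  ultimately have N: "N > 0" "N\<^sup>2 = s\<^sup>2 + \<alpha>\<^sup>2" unfolding N_def by auto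
  \<comment> \<open>\<open>w\<close> is the normalised image of \<open>u\<close> under the graph map.\<close>
  define w where "w = (1 / N) *\<^sub>R (s *\<^sub>R u - \<alpha> *\<^sub>R e)"
  have wP: "w \<in> ?P"
    unfolding w_def \<xi>eq by (simp add: orthogonal_def inner_add_left inner_diff_right ip)
  have "(norm w)\<^sup>2 = (1 / N)\<^sup>2 * (s\<^sup>2 + \<alpha>\<^sup>2)"
    unfolding power2_norm_eq_inner w_def
    by (simp add: inner_diff_left inner_diff_right ip power2_eq_square algebra_simps)
  then have "(norm w)\<^sup>2 = (1 / N)\<^sup>2 * N\<^sup>2" by (simp only: N(2))
  then have "(norm w)\<^sup>2 = 1" using N(1) by (simp add: power_divide)
  then have w1: "norm w = 1" using norm_ge_zero[of w] by (auto simp: power2_eq_1_iff)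
  have PH: "perp_in ?P w = perp_in ?H u"
  proof (intro set_eqI iffI)
    fix y assume "y \<in> perp_in ?P w"
    then have 1: "s * (e \<bullet> y) + \<alpha> * (u \<bullet> y) = 0" and 2: "s * (u \<bullet> y) - \<alpha> * (e \<bullet> y) = 0"
      using N(1) unfolding w_def \<xi>eq by (auto simp: orthogonal_def inner_add_left inner_diff_left)
    have "N\<^sup>2 * (e \<bullet> y) = s * (s * (e \<bullet> y) + \<alpha> * (u \<bullet> y)) - \<alpha> * (s * (u \<bullet> y) - \<alpha> * (e \<bullet> y))"
      unfolding N by (simp add: algebra_simps power2_eq_square)
    moreover have "N\<^sup>2 * (u \<bullet> y) = \<alpha> * (s * (e \<bullet> y) + \<alpha> * (u \<bullet> y)) + s * (s * (u \<bullet> y) - \<alpha> * (e \<bullet> y))"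
      unfolding N by (simp add: algebra_simps power2_eq_square)
    ultimately show "y \<in> perp_in ?H u" unfolding 1 2 using N(1) by (auto simp: orthogonal_def)
  next
    fix y assume "y \<in> perp_in ?H u"
    then show "y \<in> perp_in ?P w"
      unfolding w_def \<xi>eq by (auto simp: orthogonal_def inner_add_left inner_diff_left)
  qed
  have "nn_integral (subspace_lborel ?P) F =
      (\<integral>\<^sup>+ y. (\<integral>\<^sup>+ r. F (y + r *\<^sub>R w) \<partial>lborel) \<partial>subspace_lborel (perp_in ?H u))"
    unfolding PH[symmetric] by (rule nn_integral_subspace_split[OF P wP w1]) measurable
  also have "\<dots> = (\<integral>\<^sup>+ y. ennreal \<bar>N / s\<bar> * (\<integral>\<^sup>+ r. F (y + (r * (N / s)) *\<^sub>R w) \<partial>lborel) \<partial>subspace_lborel (perp_in ?H u))"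
    by (subst nn_integral_real_affine[where c = "N / s" and t = 0]) (use N s in \<open>auto simp: mult.commute\<close>)
  also have "\<dots> = ennreal \<bar>N / s\<bar> * (\<integral>\<^sup>+ y. (\<integral>\<^sup>+ r. F (y + (r * (N / s)) *\<^sub>R w) \<partial>lborel) \<partial>subspace_lborel (perp_in ?H u))"
    by (rule nn_integral_cmult) measurable
  also have "(\<integral>\<^sup>+ y. (\<integral>\<^sup>+ r. F (y + (r * (N / s)) *\<^sub>R w) \<partial>lborel) \<partial>subspace_lborel (perp_in ?H u)) =
     (\<integral>\<^sup>+ y. (\<integral>\<^sup>+ r. F ((y + r *\<^sub>R u) - (((y + r *\<^sub>R u) \<bullet> \<xi>) / s) *\<^sub>R e) \<partial>lborel) \<partial>subspace_lborel (perp_in ?H u))"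
  proof (rule nn_integral_subspace_cong[OF subspace_perp_in[OF H]], rule nn_integral_cong)
    fix y r assume y: "y \<in> perp_in ?H u"
    have "y \<bullet> \<xi> = 0" using y unfolding \<xi>eq by (simp add: orthogonal_def inner_add_right inner_commute)
    moreover have "u \<bullet> \<xi> = \<alpha>" unfolding \<xi>eq by (simp add: inner_add_right ip)
    ultimately have "(y + r *\<^sub>R u) \<bullet> \<xi> = r * \<alpha>" by (simp add: inner_add_left)
    moreover have "(r * (N / s)) *\<^sub>R w = r *\<^sub>R u - ((r * \<alpha>) / s) *\<^sub>R e"
      unfolding w_def using N(1) s by (simp add: scaleR_diff_right)
    ultimately show "F (y + (r * (N / s)) *\<^sub>R w) = F ((y + r *\<^sub>R u) - (((y + r *\<^sub>R u) \<bullet> \<xi>) / s) *\<^sub>R e)"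
      by (simp add: add_diff_eq)
  qed
  also have "\<dots> = (\<integral>\<^sup>+ y. F (y - ((y \<bullet> \<xi>) / s) *\<^sub>R e) \<partial>subspace_lborel ?H)"
    by (rule nn_integral_subspace_split[OF H u(1,2), symmetric]) measurable
  finally have "ennreal (1 / N) * nn_integral (subspace_lborel ?P) F =
      ennreal (1 / N) * ennreal \<bar>N / s\<bar> * (\<integral>\<^sup>+ y. F (y - ((y \<bullet> \<xi>) / s) *\<^sub>R e) \<partial>subspace_lborel ?H)"
    by (simp add: mult.assoc)
  also have "ennreal (1 / N) * ennreal \<bar>N / s\<bar> = ennreal (1 / \<bar>s\<bar>)"
    using N by (simp add: ennreal_mult[symmetric])
  finally show ?thesis unfolding section_transform_def s_def N_def by simp
qed

text \<open>The transform is symmetric: both sides integrate \<open>F x G \<xi>\<close> over the pairs with \<open>x \<bottom> \<xi>\<close>. In the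
  coordinates \<open>x = y + t e\<close>, \<open>\<xi> = \<eta> + s e\<close> the condition is \<open>s t = - y \<bullet> \<eta>\<close>, and \<open>ds/|s| = dt/|t|\<close>.\<close>

lemma section_transform_symmetric:
  fixes e :: "'a::euclidean_space"
  assumes dim: "DIM('a) \<ge> 2" and e: "norm e = 1"
    and [measurable]: "F \<in> borel_measurable borel" "G \<in> borel_measurable borel"
  shows "(\<integral>\<^sup>+ \<xi>. G \<xi> * section_transform e F \<xi> \<partial>lborel) = (\<integral>\<^sup>+ x. F x * section_transform e G x \<partial>lborel)"
proof -
  let ?H = "perp_in UNIV e" let ?M = "subspace_lborel ?H"
  have H: "subspace ?H" by (rule subspace_perp_in[OF subspace_UNIV])
  have e0: "e \<noteq> 0" using e by auto
  have dH: "dim ?H > 0" using dim_perp_in[OF subspace_UNIV, of e] e0 dim by simp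
  interpret M: sigma_finite_measure ?M by (rule sigma_finite_subspace_lborel[OF H])
  interpret QL: pair_sigma_finite ?M "lborel :: real measure" ..
  interpret QQ: pair_sigma_finite ?M ?M ..
  define \<Phi> where "\<Phi> F G \<eta> y s = G (\<eta> + s *\<^sub>R e) * F (y - ((y \<bullet> \<eta>) / s) *\<^sub>R e) * ennreal (1 / \<bar>s\<bar>)"
    for F G :: "'a \<Rightarrow> ennreal" and \<eta> y s
  have expand: "(\<integral>\<^sup>+ \<xi>. G \<xi> * section_transform e F \<xi> \<partial>lborel) =
      (\<integral>\<^sup>+ \<eta>. (\<integral>\<^sup>+ y. (\<integral>\<^sup>+ s. \<Phi> F G \<eta> y s \<partial>lborel) \<partial>?M) \<partial>?M)"
    if [measurable]: "F \<in> borel_measurable borel" "G \<in> borel_measurable borel" for F G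
  proof -
    have "(\<integral>\<^sup>+ \<xi>. G \<xi> * section_transform e F \<xi> \<partial>lborel) =
        (\<integral>\<^sup>+ \<eta>. (\<integral>\<^sup>+ s. G (\<eta> + s *\<^sub>R e) * section_transform e F (\<eta> + s *\<^sub>R e) \<partial>lborel) \<partial>?M)"
      unfolding subspace_lborel_UNIV[where 'a = 'a, symmetric]
      by (rule nn_integral_subspace_split[OF subspace_UNIV UNIV_I e]) measurable
    also have "\<dots> = (\<integral>\<^sup>+ \<eta>. (\<integral>\<^sup>+ s. (\<integral>\<^sup>+ y. \<Phi> F G \<eta> y s \<partial>?M) \<partial>lborel) \<partial>?M)"
    proof (rule nn_integral_subspace_cong[OF H], rule nn_integral_cong)
      fix \<eta> s assume \<eta>: "\<eta> \<in> ?H"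
      have se: "(\<eta> + s *\<^sub>R e) \<bullet> e = s"
        using \<eta> e by (simp add: orthogonal_def inner_add_left inner_commute[of \<eta>] norm_eq_1)
      have "(\<integral>\<^sup>+ y. F (y - ((y \<bullet> (\<eta> + s *\<^sub>R e)) / s) *\<^sub>R e) \<partial>?M) = (\<integral>\<^sup>+ y. F (y - ((y \<bullet> \<eta>) / s) *\<^sub>R e) \<partial>?M)"
        by (rule nn_integral_subspace_cong[OF H])
           (simp add: orthogonal_def inner_add_right inner_commute)
      then have "G (\<eta> + s *\<^sub>R e) * section_transform e F (\<eta> + s *\<^sub>R e) =
          (G (\<eta> + s *\<^sub>R e) * ennreal (1 / \<bar>s\<bar>)) * (\<integral>\<^sup>+ y. F (y - ((y \<bullet> \<eta>) / s) *\<^sub>R e) \<partial>?M)"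
        unfolding section_transform_def se by (simp add: mult.assoc)
      also have "\<dots> = (\<integral>\<^sup>+ y. \<Phi> F G \<eta> y s \<partial>?M)"
        unfolding \<Phi>_def by (subst nn_integral_cmult[symmetric]) (auto simp: mult_ac)
      finally show "G (\<eta> + s *\<^sub>R e) * section_transform e F (\<eta> + s *\<^sub>R e) = (\<integral>\<^sup>+ y. \<Phi> F G \<eta> y s \<partial>?M)" .
    qed
    also have "\<dots> = (\<integral>\<^sup>+ \<eta>. (\<integral>\<^sup>+ y. (\<integral>\<^sup>+ s. \<Phi> F G \<eta> y s \<partial>lborel) \<partial>?M) \<partial>?M)"
    proof (rule nn_integral_cong)
      fix \<eta>
      show "(\<integral>\<^sup>+ s. (\<integral>\<^sup>+ y. \<Phi> F G \<eta> y s \<partial>?M) \<partial>lborel) = (\<integral>\<^sup>+ y. (\<integral>\<^sup>+ s. \<Phi> F G \<eta> y s \<partial>lborel) \<partial>?M)"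
        by (rule QL.Fubini') (unfold \<Phi>_def, measurable)
    qed
    finally show ?thesis .
  qed
  have "(\<integral>\<^sup>+ \<xi>. G \<xi> * section_transform e F \<xi> \<partial>lborel) =
      (\<integral>\<^sup>+ \<eta>. (\<integral>\<^sup>+ y. (\<integral>\<^sup>+ s. \<Phi> F G \<eta> y s \<partial>lborel) \<partial>?M) \<partial>?M)"
    by (rule expand) measurable
  also have "\<dots> = (\<integral>\<^sup>+ \<eta>. (\<integral>\<^sup>+ y. (\<integral>\<^sup>+ s. \<Phi> G F y \<eta> s \<partial>lborel) \<partial>?M) \<partial>?M)"
  proof (rule nn_integral_cong_AE)
    obtain c where c: "c \<in> ?H" "norm c = 1" using subspace_unit_vector[OF H dH] .
    have "c \<noteq> 0" using c by auto
    then have "AE \<eta> in ?M. c \<bullet> \<eta> \<noteq> 0" by (intro AE_subspace_hyperplane[OF H c(1)])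
    then show "AE \<eta> in ?M. (\<integral>\<^sup>+ y. (\<integral>\<^sup>+ s. \<Phi> F G \<eta> y s \<partial>lborel) \<partial>?M) = (\<integral>\<^sup>+ y. (\<integral>\<^sup>+ s. \<Phi> G F y \<eta> s \<partial>lborel) \<partial>?M)"
      using AE_subspace_lborel[OF H]
    proof eventually_elim
      case (elim \<eta>)
      then have \<eta>: "\<eta> \<in> ?H" "\<eta> \<noteq> 0" by auto
      show ?case
      proof (rule nn_integral_cong_AE)
        show "AE y in ?M. (\<integral>\<^sup>+ s. \<Phi> F G \<eta> y s \<partial>lborel) = (\<integral>\<^sup>+ s. \<Phi> G F y \<eta> s \<partial>lborel)"
          using AE_subspace_hyperplane[OF H \<eta>]
        proof eventually_elim
          case (elim y)
          define k where "k = - (y \<bullet> \<eta>)"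
          have k: "k \<noteq> 0" using elim by (simp add: k_def inner_commute)
          let ?h = "\<lambda>s. G (\<eta> + s *\<^sub>R e) * F (y + (k / s) *\<^sub>R e)"
          have "(\<integral>\<^sup>+ s. \<Phi> F G \<eta> y s \<partial>lborel) = (\<integral>\<^sup>+ s. ?h s * ennreal (1 / \<bar>s\<bar>) \<partial>lborel)"
            by (simp add: \<Phi>_def k_def)
          also have "\<dots> = (\<integral>\<^sup>+ s. ?h (k / s) * ennreal (1 / \<bar>s\<bar>) \<partial>lborel)"
            by (rule nn_integral_inversion[OF _ k]) measurable
          also have "\<dots> = (\<integral>\<^sup>+ s. \<Phi> G F y \<eta> s \<partial>lborel)"
          proof (rule nn_integral_cong)
            fix s
            show "?h (k / s) * ennreal (1 / \<bar>s\<bar>) = \<Phi> G F y \<eta> s"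
              using k by (cases "s = 0") (simp_all add: \<Phi>_def k_def inner_commute mult_ac)
          qed
          finally show ?case .
        qed
      qed
    qed
  qed
  also have "\<dots> = (\<integral>\<^sup>+ y. (\<integral>\<^sup>+ \<eta>. (\<integral>\<^sup>+ s. \<Phi> G F y \<eta> s \<partial>lborel) \<partial>?M) \<partial>?M)"
    by (rule QQ.Fubini') (unfold \<Phi>_def, measurable)
  also have "\<dots> = (\<integral>\<^sup>+ x. F x * section_transform e G x \<partial>lborel)"
    by (rule expand[symmetric]) measurable
  finally show ?thesis .
qed

section \<open>Axial moments of intersection bodies\<close>

text \<open>The squared cosine of the angle between \<open>x\<close> and the axis spanned by the unit vector \<open>e\<close>.\<close>

definition sq_cos :: "'a::euclidean_space \<Rightarrow> 'a \<Rightarrow> real" where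
  "sq_cos e x = (x \<bullet> e)\<^sup>2 / (norm x)\<^sup>2"

text \<open>In polar coordinates this is, up to the factor \<open>1 / (n - 1)\<close>, the integral of \<open>\<rho>\<^sub>F\<^sup>n\<^sup>-\<^sup>1\<close> times \<open>f\<close> of the
  squared cosine over the unit sphere. The section function of \<open>F\<close> is the spherical Radon transform of
  \<open>\<rho>\<^sub>F\<^sup>n\<^sup>-\<^sup>1\<close>, up to the same factor.\<close>

definition axial_moment :: "'a::euclidean_space \<Rightarrow> 'a set \<Rightarrow> (real \<Rightarrow> real) \<Rightarrow> real" where
  "axial_moment e F f = (LINT x|lborel. indicator F x * (f (sq_cos e x) / norm x))"

lemma measurable_sq_cos [measurable]: "sq_cos e \<in> borel_measurable borel"
  unfolding sq_cos_def by measurable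

lemma sq_cos_bounds:
  assumes "norm e = 1"
  shows "0 \<le> sq_cos e x" "sq_cos e x \<le> 1"
proof -
  show "0 \<le> sq_cos e x" by (simp add: sq_cos_def)
  have "(x \<bullet> e)\<^sup>2 \<le> (norm x)\<^sup>2"
    using Cauchy_Schwarz_ineq[of x e] assms by (simp add: power2_norm_eq_inner norm_eq_1)
  then show "sq_cos e x \<le> 1" by (cases "x = 0") (simp_all add: sq_cos_def)
qed

lemma section_transform_indicator:
  fixes e :: "'a::euclidean_space"
  assumes dim: "DIM('a) \<ge> 2" and e: "norm e = 1" and \<xi>: "\<xi> \<bullet> e \<noteq> 0"
    and F: "F \<in> sets borel" "bounded F"
  shows "section_transform e (indicator F) \<xi> =
    ennreal (measure (subspace_lborel (perp_in UNIV \<xi>)) (F \<inter> {x. orthogonal \<xi> x}) / norm \<xi>)"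
proof -
  let ?M = "subspace_lborel (perp_in UNIV \<xi>)"
  have P: "subspace (perp_in UNIV \<xi>)" by (rule subspace_perp_in[OF subspace_UNIV])
  have "closed {x. orthogonal \<xi> x}" using closed_hyperplane[of \<xi> 0] by (simp add: orthogonal_def)
  then have FP: "F \<inter> {x. orthogonal \<xi> x} \<in> sets borel" using F(1) by (intro sets.Int) auto
  have "nn_integral ?M (indicator F) = emeasure ?M F" using F by simp
  also have "\<dots> = emeasure ?M (F \<inter> {x. orthogonal \<xi> x})"
  proof (rule emeasure_eq_AE)
    show "AE x in ?M. x \<in> F \<longleftrightarrow> x \<in> F \<inter> {x. orthogonal \<xi> x}"
      using AE_subspace_lborel[OF P] by eventually_elim auto
  qed (use F FP in auto)
  also have "\<dots> = ennreal (measure ?M (F \<inter> {x. orthogonal \<xi> x}))"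
    using emeasure_subspace_bounded[OF P, of "F \<inter> {x. orthogonal \<xi> x}"] F(2)
    by (intro emeasure_eq_ennreal_measure) (auto simp: bounded_Int)
  finally have I: "nn_integral ?M (indicator F) = ennreal (measure ?M (F \<inter> {x. orthogonal \<xi> x}))" .
  have "section_transform e (indicator F) \<xi> = ennreal (1 / norm \<xi>) * nn_integral ?M (indicator F)"
    by (rule section_transform_eq[OF dim e \<xi>]) (use F in simp)
  also have "\<dots> = ennreal (1 / norm \<xi> * measure ?M (F \<inter> {x. orthogonal \<xi> x}))"
    unfolding I by (subst ennreal_mult) auto
  finally show ?thesis by simp
qed

lemma AE_inner_nonzero:
  fixes e :: "'a::euclidean_space"
  assumes "norm e = 1"
  shows "AE x in lborel. x \<bullet> e \<noteq> 0"
proof -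
  have "e \<noteq> 0" using assms by auto
  then show ?thesis
    using AE_subspace_hyperplane[OF subspace_UNIV UNIV_I, of e]
    unfolding subspace_lborel_UNIV[where 'a = 'a] by (simp add: inner_commute)
qed

text \<open>The weights on the left are chosen such that integrating them over \<open>x\<^sup>\<bottom>\<close> gives, up to a
  constant, the power \<open>(1 - cos\<^sup>2)\<^sup>j / |x|\<close>: the projection of \<open>e\<close> to \<open>x\<^sup>\<bottom>\<close> has squared length
  \<open>1 - cos\<^sup>2\<close>. The factor \<open>|\<xi>|\<close> in \<open>moment_weight\<close> cancels the singularity of the section function.\<close>

lemma nn_integral_section_moment:
  fixes e :: "'a::euclidean_space"
  assumes dim: "DIM('a) \<ge> 2" and e: "norm e = 1"
    and [measurable]: "F \<in> borel_measurable borel"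
  shows "(\<integral>\<^sup>+ \<xi>. ennreal ((\<xi> \<bullet> e) ^ (2 * j)) * moment_weight ((norm \<xi>)\<^sup>2) * section_transform e F \<xi> \<partial>lborel) =
    moment_const (DIM('a) - 1) j * (\<integral>\<^sup>+ x. F x * ennreal ((1 - sq_cos e x) ^ j / norm x) \<partial>lborel)"
proof -
  let ?G = "\<lambda>\<xi>. ennreal ((\<xi> \<bullet> e) ^ (2 * j)) * moment_weight ((norm \<xi>)\<^sup>2)"
  have "(\<integral>\<^sup>+ \<xi>. ?G \<xi> * section_transform e F \<xi> \<partial>lborel) = (\<integral>\<^sup>+ x. F x * section_transform e ?G x \<partial>lborel)"
    by (rule section_transform_symmetric[OF dim e]) measurable
  also have "\<dots> = (\<integral>\<^sup>+ x. moment_const (DIM('a) - 1) j * (F x * ennreal ((1 - sq_cos e x) ^ j / norm x)) \<partial>lborel)"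
  proof (rule nn_integral_cong_AE)
    show "AE x in lborel. F x * section_transform e ?G x =
        moment_const (DIM('a) - 1) j * (F x * ennreal ((1 - sq_cos e x) ^ j / norm x))"
      using AE_inner_nonzero[OF e]
    proof eventually_elim
      case (elim x)
      let ?P = "perp_in UNIV x"
      have P: "subspace ?P" by (rule subspace_perp_in[OF subspace_UNIV])
      have x: "x \<noteq> 0" using elim by auto
      have dP: "dim ?P = DIM('a) - 1" using dim_perp_in[OF subspace_UNIV UNIV_I x] by simp
      define z where "z = e - ((x \<bullet> e) / (norm x)\<^sup>2) *\<^sub>R x"
      have z: "z \<in> ?P" using x by (simp add: z_def orthogonal_def inner_diff_right power2_norm_eq_inner)
      define c where "c = (x \<bullet> e) / (norm x)\<^sup>2"
      have zc: "z = e - c *\<^sub>R x" by (simp add: z_def c_def)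
      have "z \<bullet> z = e \<bullet> e - 2 * c * (x \<bullet> e) + c\<^sup>2 * (x \<bullet> x)"
        unfolding zc by (simp add: inner_diff_left inner_diff_right inner_commute[of e x]
            power2_eq_square algebra_simps)
      also have "e \<bullet> e = 1" using e by (simp add: norm_eq_1)
      also have "x \<bullet> x = (norm x)\<^sup>2" by (simp add: power2_norm_eq_inner)
      also have "1 - 2 * c * (x \<bullet> e) + c\<^sup>2 * (norm x)\<^sup>2 = 1 - sq_cos e x"
        using x by (simp add: c_def sq_cos_def power2_eq_square field_simps)
      finally have "z \<bullet> z = 1 - sq_cos e x" .
      then have nz: "norm z ^ (2 * j) = (1 - sq_cos e x) ^ j"
        by (simp add: power_mult power2_norm_eq_inner)
      have "nn_integral (subspace_lborel ?P) ?G =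
          (\<integral>\<^sup>+ y. ennreal ((y \<bullet> z) ^ (2 * j)) * moment_weight ((norm y)\<^sup>2) \<partial>subspace_lborel ?P)"
        by (rule nn_integral_subspace_cong[OF P])
           (simp add: z_def inner_diff_right orthogonal_def inner_commute)
      also have "\<dots> = ennreal ((1 - sq_cos e x) ^ j) * moment_const (DIM('a) - 1) j"
        using nn_integral_moment[OF P _ z, of j] dP dim unfolding nz by simp
      finally have I: "nn_integral (subspace_lborel ?P) ?G = ennreal ((1 - sq_cos e x) ^ j) * moment_const (DIM('a) - 1) j" .
      have "section_transform e ?G x = ennreal (1 / norm x) * nn_integral (subspace_lborel ?P) ?G"
        by (rule section_transform_eq[OF dim e elim]) measurable
      also have "\<dots> = moment_const (DIM('a) - 1) j * (ennreal (1 / norm x) * ennreal ((1 - sq_cos e x) ^ j))"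
        unfolding I by (simp add: mult_ac)
      also have "ennreal (1 / norm x) * ennreal ((1 - sq_cos e x) ^ j) = ennreal ((1 - sq_cos e x) ^ j / norm x)"
        using sq_cos_bounds[OF e, of x] by (subst ennreal_mult[symmetric]) auto
      finally show ?case by (simp add: mult_ac)
    qed
  qed
  also have "\<dots> = moment_const (DIM('a) - 1) j * (\<integral>\<^sup>+ x. F x * ennreal ((1 - sq_cos e x) ^ j / norm x) \<partial>lborel)"
    by (rule nn_integral_cmult) measurable
  finally show ?thesis .
qed

lemma moment_const_UNIV:
  assumes "DIM('a::euclidean_space) \<ge> 2"
  shows "moment_const (DIM('a) - 1) j \<noteq> 0" "moment_const (DIM('a) - 1) j \<noteq> \<infinity>"
proof -
  obtain e :: 'a where e: "e \<in> Basis" using nonempty_Basis by blast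
  have d: "dim (perp_in UNIV e) = DIM('a) - 1"
    using dim_perp_in[OF subspace_UNIV UNIV_I, of e] nonzero_Basis[OF e] by simp
  show "moment_const (DIM('a) - 1) j \<noteq> 0" "moment_const (DIM('a) - 1) j \<noteq> \<infinity>"
    using moment_const_pos_finite[OF subspace_perp_in[OF subspace_UNIV, of e], of j] assms unfolding d by auto
qed

text \<open>Integrability of \<open>1 / |x|\<close> near the origin. For the unit ball it follows from the moment identity with
  \<open>j = 0\<close>, whose left-hand side has a bounded integrand with bounded support.\<close>

lemma nn_integral_inverse_norm_finite:
  fixes F :: "'a::euclidean_space set"
  assumes dim: "DIM('a) \<ge> 2" and F: "F \<in> sets borel" "bounded F"
  shows "(\<integral>\<^sup>+ x. indicator F x * ennreal (1 / norm x) \<partial>lborel) < \<infinity>"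
proof -
  obtain e :: 'a where "e \<in> Basis" using nonempty_Basis by blast
  then have e: "norm e = 1" by simp
  let ?B = "cball (0::'a) 1"
  let ?I = "\<integral>\<^sup>+ x. indicator ?B x * ennreal (1 / norm x) \<partial>lborel"
  let ?v = "ball_volume (DIM('a) - 1)"
  have "moment_const (DIM('a) - 1) 0 * ?I =
      (\<integral>\<^sup>+ \<xi>. moment_weight ((norm \<xi>)\<^sup>2) * section_transform e (indicator ?B) \<xi> \<partial>lborel)"
    using nn_integral_section_moment[OF dim e borel_measurable_indicator, of ?B 0] by simp
  also have "\<dots> \<le> (\<integral>\<^sup>+ \<xi>. ?v * indicator ?B \<xi> \<partial>lborel)"
  proof (rule nn_integral_mono_AE)
    show "AE \<xi> in lborel. moment_weight ((norm \<xi>)\<^sup>2) * section_transform e (indicator ?B) \<xi> \<le> ?v * indicator ?B \<xi>"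
      using AE_inner_nonzero[OF e]
    proof eventually_elim
      case (elim \<xi>)
      let ?P = "perp_in UNIV \<xi>"
      have P: "subspace ?P" by (rule subspace_perp_in[OF subspace_UNIV])
      have \<xi>: "\<xi> \<noteq> 0" using elim by auto
      have dP: "dim ?P = DIM('a) - 1" using dim_perp_in[OF subspace_UNIV UNIV_I \<xi>] by simp
      have "section_transform e (indicator ?B) \<xi> = ennreal (1 / norm \<xi>) * nn_integral (subspace_lborel ?P) (indicator ?B)"
        by (rule section_transform_eq[OF dim e elim borel_measurable_indicator]) simp
      also have "nn_integral (subspace_lborel ?P) (indicator ?B) = ?v"
        using emeasure_subspace_cball[OF P] dP by simp
      finally have S: "section_transform e (indicator ?B) \<xi> = ennreal (1 / norm \<xi>) * ?v" .
      show ?case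
      proof (cases "norm \<xi> \<le> 1")
        case True
        then have "moment_weight ((norm \<xi>)\<^sup>2) = ennreal (norm \<xi>)"
          by (simp add: moment_weight_def abs_square_le_1)
        moreover have "ennreal (norm \<xi>) * ennreal (1 / norm \<xi>) = 1"
          using \<xi> by (simp add: ennreal_mult[symmetric])
        ultimately show ?thesis using True unfolding S by (simp add: mult.assoc[symmetric])
      next
        case False
        then have "\<not> (norm \<xi>)\<^sup>2 \<le> 1" by (simp add: abs_square_le_1)
        then show ?thesis by (simp add: moment_weight_def)
      qed
    qed
  qed
  also have "\<dots> = ?v * emeasure lborel ?B" by (rule nn_integral_cmult_indicator) simp
  also have "\<dots> < \<infinity>"
  proof -
    have d: "dim (perp_in UNIV e) = DIM('a) - 1"
      using dim_perp_in[OF subspace_UNIV UNIV_I, of e] e by fastforce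
    have "?v \<noteq> \<infinity>" using ball_volume_pos_finite(2)[OF subspace_perp_in[OF subspace_UNIV, of e]] unfolding d .
    moreover have "emeasure lborel ?B < \<infinity>"
      by (intro emeasure_bounded_finite) simp
    ultimately show ?thesis by (simp add: ennreal_mult_less_top top.not_eq_extremum)
  qed
  finally have I: "?I < \<infinity>"
    using moment_const_UNIV[OF dim, of 0] by (auto simp: ennreal_mult_less_top)
  obtain R where R: "R > 0" "F \<subseteq> cball 0 R"
    using F(2) by (metis bounded_pos mem_cball_0 subsetI)
  have [measurable]: "cball (0::'a) R \<in> sets borel" "?B \<in> sets borel" by simp_all
  have m: "(\<lambda>x::'a. indicator (cball 0 R) x * ennreal (1 / norm x)) \<in> borel_measurable borel" by measurable
  have "(\<integral>\<^sup>+ x. indicator F x * ennreal (1 / norm x) \<partial>lborel) \<le>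
      (\<integral>\<^sup>+ x. indicator (cball (0::'a) R) x * ennreal (1 / norm x) \<partial>lborel)"
    using R(2) by (intro nn_integral_mono) (auto simp: indicator_def)
  also have "\<dots> = ennreal (R ^ DIM('a)) * (\<integral>\<^sup>+ x. indicator (cball (0::'a) R) (R *\<^sub>R x) * ennreal (1 / norm (R *\<^sub>R x)) \<partial>lborel)"
    using nn_integral_subspace_scale[OF subspace_UNIV m R(1)] unfolding subspace_lborel_UNIV[where 'a = 'a] by simp
  also have "(\<integral>\<^sup>+ x. indicator (cball (0::'a) R) (R *\<^sub>R x) * ennreal (1 / norm (R *\<^sub>R x)) \<partial>lborel) =
      (\<integral>\<^sup>+ x. ennreal (1 / R) * (indicator ?B x * ennreal (1 / norm x)) \<partial>lborel)"
  proof (rule nn_integral_cong)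
    fix x :: 'a
    have "ennreal (1 / norm (R *\<^sub>R x)) = ennreal (1 / R) * ennreal (1 / norm x)"
      using R(1) by (simp add: ennreal_mult[symmetric])
    moreover have "indicator (cball (0::'a) R) (R *\<^sub>R x) = (indicator ?B x :: ennreal)"
      using R(1) by (auto simp: indicator_def)
    ultimately show "indicator (cball (0::'a) R) (R *\<^sub>R x) * ennreal (1 / norm (R *\<^sub>R x)) =
        ennreal (1 / R) * (indicator ?B x * ennreal (1 / norm x))" by (simp add: mult_ac)
  qed
  also have "\<dots> = ennreal (1 / R) * ?I" by (rule nn_integral_cmult) measurable
  also have "ennreal (R ^ DIM('a)) * (ennreal (1 / R) * ?I) < \<infinity>"
    using I by (simp add: ennreal_mult_less_top)
  finally show ?thesis .
qed

lemma integrable_axial: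
  fixes e :: "'a::euclidean_space"
  assumes dim: "DIM('a) \<ge> 2" and e: "norm e = 1" and F: "F \<in> sets borel" "bounded F"
    and [measurable]: "f \<in> borel_measurable borel"
    and f: "\<And>t. 0 \<le> t \<Longrightarrow> t \<le> 1 \<Longrightarrow> \<bar>f t\<bar> \<le> 1"
  shows "integrable lborel (\<lambda>x. indicator F x * (f (sq_cos e x) / norm x))"
proof (rule Bochner_Integration.integrable_bound)
  have [measurable]: "F \<in> sets borel" by (rule F)
  show "integrable lborel (\<lambda>x. indicator F x * (1 / norm x) :: real)"
  proof (rule integrableI_nonneg)
    have "(\<integral>\<^sup>+ x. ennreal (indicator F x * (1 / norm x)) \<partial>lborel) = (\<integral>\<^sup>+ x. indicator F x * ennreal (1 / norm x) \<partial>lborel)"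
      by (intro nn_integral_cong) (auto simp: indicator_def)
    then show "(\<integral>\<^sup>+ x. ennreal (indicator F x * (1 / norm x)) \<partial>lborel) < \<infinity>"
      using nn_integral_inverse_norm_finite[OF dim F] by simp
  qed auto
  show "AE x in lborel. norm (indicator F x * (f (sq_cos e x) / norm x)) \<le> norm (indicator F x * (1 / norm x) :: real)"
    using f[OF sq_cos_bounds[OF e]]
    by (intro AE_I2) (auto simp: abs_mult indicator_def divide_right_mono)
qed (use F in measurable)

lemma nn_integral_axial_moment:
  fixes e :: "'a::euclidean_space"
  assumes dim: "DIM('a) \<ge> 2" and e: "norm e = 1" and F: "F \<in> sets borel" "bounded F"
    and f: "f \<in> borel_measurable borel" "\<And>t. 0 \<le> t \<Longrightarrow> t \<le> 1 \<Longrightarrow> 0 \<le> f t \<and> f t \<le> 1"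
  shows "(\<integral>\<^sup>+ x. indicator F x * ennreal (f (sq_cos e x) / norm x) \<partial>lborel) = ennreal (axial_moment e F f)"
    "0 \<le> axial_moment e F f"
proof -
  have pos: "0 \<le> indicator F x * (f (sq_cos e x) / norm x)" for x
    using f(2)[OF sq_cos_bounds[OF e]] by simp
  have "(\<integral>\<^sup>+ x. indicator F x * ennreal (f (sq_cos e x) / norm x) \<partial>lborel) =
      (\<integral>\<^sup>+ x. ennreal (indicator F x * (f (sq_cos e x) / norm x)) \<partial>lborel)"
    by (intro nn_integral_cong) (auto simp: indicator_def)
  also have "\<dots> = ennreal (axial_moment e F f)"
    unfolding axial_moment_def
    using integrable_axial[OF dim e F f(1)] f(2) pos by (intro nn_integral_eq_integral) auto
  finally show "(\<integral>\<^sup>+ x. indicator F x * ennreal (f (sq_cos e x) / norm x) \<partial>lborel) = ennreal (axial_moment e F f)" .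
  show "0 \<le> axial_moment e F f" unfolding axial_moment_def using pos by (intro Bochner_Integration.integral_nonneg)
qed

lemma one_minus_power_bounds: "0 \<le> t \<Longrightarrow> t \<le> 1 \<Longrightarrow> 0 \<le> (1 - t) ^ j \<and> (1 - t) ^ j \<le> (1::real)"
  by (simp add: power_le_one)

text \<open>Expand \<open>t\<^sup>k = (1 - (1 - t))\<^sup>k\<close>: the moments of \<open>(1 - t)\<^sup>j\<close> are those which the section function
  determines.\<close>

lemma axial_moment_power_expansion:
  fixes e :: "'a::euclidean_space"
  assumes dim: "DIM('a) \<ge> 2" and e: "norm e = 1" and F: "F \<in> sets borel" "bounded F"
  shows "axial_moment e F (\<lambda>t. t ^ k) = (\<Sum>j\<le>k. (real (k choose j) * (-1) ^ j) * axial_moment e F (\<lambda>t. (1 - t) ^ j))"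
proof -
  have bin: "t ^ k = (\<Sum>j\<le>k. (real (k choose j) * (-1) ^ j) * (1 - t) ^ j)" for t :: real
  proof -
    have "t ^ k = (- (1 - t) + 1) ^ k" by simp
    also have "\<dots> = (\<Sum>j\<le>k. (real (k choose j) * (-1) ^ j) * (1 - t) ^ j)"
      unfolding binomial_ring by (intro sum.cong refl) (subst power_minus, simp)
    finally show ?thesis .
  qed
  have "axial_moment e F (\<lambda>t. t ^ k) =
      (LINT x|lborel. (\<Sum>j\<le>k. (real (k choose j) * (-1) ^ j) * (indicator F x * ((1 - sq_cos e x) ^ j / norm x))))"
    unfolding axial_moment_def
    by (subst bin) (simp add: sum_divide_distrib sum_distrib_left mult_ac)
  also have "\<dots> = (\<Sum>j\<le>k. (LINT x|lborel. (real (k choose j) * (-1) ^ j) * (indicator F x * ((1 - sq_cos e x) ^ j / norm x))))"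
    using one_minus_power_bounds
    by (intro Bochner_Integration.integral_sum integrable_mult_right integrable_axial[OF dim e F]) auto
  finally show ?thesis unfolding axial_moment_def Bochner_Integration.integral_mult_right_zero .
qed

text \<open>The radial function of \<open>K\<close> is formally the section function of a signed density: a multiple of that of
  the unit ball minus a multiple of that of the elongated ellipsoid \<open>E\<close>. If \<open>K\<close> is approximated by the
  intersection body of \<open>L\<close>, then the moments of \<open>(1 - t)\<^sup>j\<close>, \<open>j \<le> k\<close>, of this density are close to those
  of \<open>L\<close>, hence so is their combination that belongs to \<open>t\<^sup>k\<close>. The latter is nonnegative for \<open>L\<close>, as \<open>L\<close>
  is a genuine body.\<close>

lemma axial_moment_le_if_intersection_body:
  fixes e :: "'a::euclidean_space"
  assumes dim: "DIM('a) \<ge> 2" and e: "norm e = 1" and p: "0 \<le> p" and \<delta>: "0 \<le> \<delta>" "\<delta> < 1"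
    and K: "intersection_body_in UNIV (star_set UNIV (dented_radial \<delta> p e))"
  defines "E \<equiv> {x. (norm x)\<^sup>2 - p / (1 + p) * (x \<bullet> e)\<^sup>2 \<le> 1}"
  assumes E: "bounded E"
  shows "\<delta> / sqrt (1 + p) * axial_moment e E (\<lambda>t. t ^ k) \<le> axial_moment e (cball 0 1) (\<lambda>t. t ^ k)"
proof -
  let ?K = "star_set UNIV (dented_radial \<delta> p e)" and ?B = "cball (0::'a) 1"
  interpret radial_function UNIV "dented_radial \<delta> p e"
    by (rule radial_function_dented) (use \<delta> p in auto)
  define \<tau> where "\<tau> = sqrt (1 + p)"
  have \<tau>: "\<tau> > 0" using p by (simp add: \<tau>_def)
  have Em: "E \<in> sets borel" unfolding E_def by measurable
  define m where "m F j = axial_moment e F (\<lambda>t. (1 - t) ^ j)" for F j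
  have d: "dim (perp_in UNIV e) = DIM('a) - 1"
    using dim_perp_in[OF subspace_UNIV UNIV_I, of e] e by fastforce
  obtain \<kappa> where \<kappa>: "\<kappa> > 0" "ball_volume (DIM('a) - 1) = ennreal \<kappa>"
    using ball_volume_pos_finite[OF subspace_perp_in[OF subspace_UNIV, of e]] unfolding d
    by (cases "ball_volume (DIM('a) - 1)") (auto simp: less_le)
  have mB: "0 \<le> m ?B j" for j
    unfolding m_def by (rule nn_integral_axial_moment(2)[OF dim e]) (use one_minus_power_bounds in auto)
  define M where "M = (\<Sum>j\<le>k. real (k choose j) * m ?B j)"
  have M: "M \<ge> 0" unfolding M_def using mB by (intro sum_nonneg) auto
  have main: "\<delta> / \<tau> * axial_moment e E (\<lambda>t. t ^ k) - axial_moment e ?B (\<lambda>t. t ^ k) \<le> \<epsilon> * M"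
    if \<epsilon>: "\<epsilon> > 0" "\<epsilon> < 1" for \<epsilon>
  proof -
    obtain K' L where KL: "is_intersection_body_of_in UNIV K' L" "radial_dist UNIV ?K K' < \<epsilon>"
      using K \<epsilon> unfolding intersection_body_in_def by meson
    have K': "star_body_in UNIV K'" and L: "star_body_in UNIV L"
      and sec: "\<And>\<xi>. norm \<xi> = 1 \<Longrightarrow> inverse (minkowski_functional K' \<xi>) =
        measure (subspace_lborel (perp_in UNIV \<xi>)) (L \<inter> {x. orthogonal \<xi> x})"
      using KL(1) unfolding is_intersection_body_of_in_def by auto
    have Lc: "compact L" using L unfolding star_body_in_def by blast
    then have Lm: "L \<in> sets borel" "bounded L" by (simp_all add: borel_compact compact_imp_bounded)
    have close: "\<bar>dented_radial \<delta> p e u - measure (subspace_lborel (perp_in UNIV u)) (L \<inter> {x. orthogonal u x})\<bar> \<le> \<epsilon>"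
      if u: "norm u = 1" for u
    proof -
      have u0: "u \<noteq> 0" using u by auto
      have "continuous_on (sphere 0 1) (\<lambda>\<xi>. \<bar>radial ?K \<xi> - radial K' \<xi>\<bar>)"
        using star_body_star_set K' unfolding star_body_in_def
        by (intro continuous_intros) (auto elim!: continuous_on_subset)
      then have "bdd_above ((\<lambda>\<xi>. \<bar>radial ?K \<xi> - radial K' \<xi>\<bar>) ` (sphere 0 1 \<inter> UNIV))"
        by (auto intro!: bounded_imp_bdd_above compact_imp_bounded compact_continuous_image)
      then have "\<bar>radial ?K u - radial K' u\<bar> \<le> radial_dist UNIV ?K K'"
        unfolding radial_dist_def using u by (intro cSUP_upper) auto
      moreover have "radial ?K u = dented_radial \<delta> p e u" using u0 by (simp add: radial_star_set)
      moreover have "radial K' u = measure (subspace_lborel (perp_in UNIV u)) (L \<inter> {x. orthogonal u x})"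
        using inverse_minkowski_functional(1)[OF K' UNIV_I u0] sec[OF u] by simp
      ultimately show ?thesis using KL(2) by simp
    qed
    let ?S = "\<lambda>F. section_transform e (indicator F)"
    have pt: "ennreal ((1 - \<epsilon>)) * ?S ?B \<xi> \<le> ennreal \<kappa> * ?S L \<xi> + ennreal (\<delta> / \<tau>) * ?S E \<xi>"
        "ennreal \<kappa> * ?S L \<xi> + ennreal (\<delta> / \<tau>) * ?S E \<xi> \<le> ennreal (1 + \<epsilon>) * ?S ?B \<xi>"
      if \<xi>: "\<xi> \<bullet> e \<noteq> 0" for \<xi>
    proof -
      have x0: "\<xi> \<noteq> 0" using \<xi> by auto
      define u where "u = \<xi> /\<^sub>R norm \<xi>"
      have u: "norm u = 1" using x0 by (simp add: u_def)
      have orth: "{x. orthogonal \<xi> x} = {x. orthogonal u x}" using x0 by (auto simp: u_def orthogonal_def)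
      let ?P = "perp_in UNIV u"
      have P: "subspace ?P" by (rule subspace_perp_in[OF subspace_UNIV])
      have u0: "u \<noteq> 0" using u by auto
      have dP: "dim ?P = DIM('a) - 1" using dim_perp_in[OF subspace_UNIV UNIV_I u0] by simp
      define r where "r = measure (subspace_lborel ?P) (L \<inter> {x. orthogonal u x})"
      define g where "g = sqrt (1 + p * (u \<bullet> e)\<^sup>2)"
      have g: "g > 0" unfolding g_def using p by (auto intro: add_pos_nonneg)
      have SL: "?S L \<xi> = ennreal (r / norm \<xi>)"
        unfolding r_def section_transform_indicator[OF dim e \<xi> Lm] orth ..
      have "?S ?B \<xi> = ennreal (1 / norm \<xi>) * emeasure (subspace_lborel ?P) ?B"
        using section_transform_eq[OF dim e \<xi> borel_measurable_indicator, of ?B] unfolding orth by simp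
      also have "\<dots> = ennreal (\<kappa> / norm \<xi>)"
        unfolding emeasure_subspace_cball[OF P] dP \<kappa>(2) using \<kappa>(1) by (simp add: ennreal_mult[symmetric])
      finally have SB: "?S ?B \<xi> = ennreal (\<kappa> / norm \<xi>)" .
      have "?S E \<xi> = ennreal (1 / norm \<xi>) * emeasure (subspace_lborel ?P) E"
        using section_transform_eq[OF dim e \<xi> borel_measurable_indicator, of E] Em unfolding orth by simp
      also have "emeasure (subspace_lborel ?P) E = ennreal (\<tau> / g) * ennreal \<kappa>"
        unfolding E_def \<tau>_def g_def \<kappa>(2)[symmetric]
        using emeasure_section_ellipsoid[OF subspace_UNIV UNIV_I u UNIV_I _ p, of e] dim e by simp
      also have "ennreal (1 / norm \<xi>) * (ennreal (\<tau> / g) * ennreal \<kappa>) = ennreal (\<tau> * \<kappa> / g / norm \<xi>)"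
        using \<kappa>(1) \<tau> g by (simp add: ennreal_mult[symmetric])
      finally have SE: "?S E \<xi> = ennreal (\<tau> * \<kappa> / g / norm \<xi>)" .
      have r0: "r \<ge> 0" by (simp add: r_def)
      have cl: "\<bar>(1 - \<delta> / g) - r\<bar> \<le> \<epsilon>"
        using close[OF u] u unfolding r_def g_def dented_radial_def by simp
      have sum: "ennreal \<kappa> * ?S L \<xi> + ennreal (\<delta> / \<tau>) * ?S E \<xi> = ennreal (\<kappa> * (r + \<delta> / g) / norm \<xi>)"
      proof -
        have "\<kappa> * (r / norm \<xi>) + \<delta> / \<tau> * (\<tau> * \<kappa> / g / norm \<xi>) = \<kappa> * (r + \<delta> / g) / norm \<xi>"
          using \<tau> by (simp add: add_divide_distrib distrib_left)
        then show ?thesis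
          unfolding SL SE using \<kappa>(1) \<tau> g r0 \<delta> by (simp add: ennreal_mult[symmetric] ennreal_plus[symmetric] del: ennreal_plus)
      qed
      have "(1 - \<epsilon>) * (\<kappa> / norm \<xi>) \<le> \<kappa> * (r + \<delta> / g) / norm \<xi>"
        "\<kappa> * (r + \<delta> / g) / norm \<xi> \<le> (1 + \<epsilon>) * (\<kappa> / norm \<xi>)"
        using cl \<kappa>(1) x0 by (auto simp: mult.commute[of _ \<kappa>] intro!: divide_right_mono mult_left_mono)
      then show "ennreal ((1 - \<epsilon>)) * ?S ?B \<xi> \<le> ennreal \<kappa> * ?S L \<xi> + ennreal (\<delta> / \<tau>) * ?S E \<xi>"
        "ennreal \<kappa> * ?S L \<xi> + ennreal (\<delta> / \<tau>) * ?S E \<xi> \<le> ennreal (1 + \<epsilon>) * ?S ?B \<xi>"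
        unfolding sum SB using \<epsilon> \<kappa>(1) by (simp_all add: ennreal_mult[symmetric] ennreal_leI del: ennreal_plus)
    qed
    have mom: "\<bar>\<kappa> * m L j + \<delta> / \<tau> * m E j - m ?B j\<bar> \<le> \<epsilon> * m ?B j" for j
    proof -
      let ?C = "moment_const (DIM('a) - 1) j"
      let ?G = "\<lambda>\<xi>. ennreal ((\<xi> \<bullet> e) ^ (2 * j)) * moment_weight ((norm \<xi>)\<^sup>2)"
      have I: "(\<integral>\<^sup>+ \<xi>. ?G \<xi> * ?S F \<xi> \<partial>lborel) = ?C * ennreal (m F j)" "0 \<le> m F j"
        if F: "F \<in> sets borel" "bounded F" for F
        unfolding m_def
        using nn_integral_section_moment[OF dim e, of "indicator F" j] F
          nn_integral_axial_moment[OF dim e F, of "\<lambda>t. (1 - t) ^ j"] one_minus_power_bounds by auto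
      have cm: "(\<integral>\<^sup>+ \<xi>. ?G \<xi> * (ennreal c * ?S F \<xi>) \<partial>lborel) = ?C * ennreal (c * m F j)"
        if F: "F \<in> sets borel" "bounded F" and c: "c \<ge> 0" for F c
      proof -
        have [measurable]: "?S F \<in> borel_measurable borel" using F by simp
        have "(\<integral>\<^sup>+ \<xi>. ?G \<xi> * (ennreal c * ?S F \<xi>) \<partial>lborel) = (\<integral>\<^sup>+ \<xi>. ennreal c * (?G \<xi> * ?S F \<xi>) \<partial>lborel)"
          by (intro nn_integral_cong) (simp add: mult_ac)
        also have "\<dots> = ennreal c * (?C * ennreal (m F j))"
          unfolding I(1)[OF F, symmetric] by (rule nn_integral_cmult) measurable
        finally show ?thesis using c I(2)[OF F] by (simp add: ennreal_mult mult_ac)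
      qed
      have sum: "(\<integral>\<^sup>+ \<xi>. ?G \<xi> * (ennreal \<kappa> * ?S L \<xi> + ennreal (\<delta> / \<tau>) * ?S E \<xi>) \<partial>lborel) =
          ?C * ennreal (\<kappa> * m L j + \<delta> / \<tau> * m E j)"
      proof -
        have [measurable]: "?S L \<in> borel_measurable borel" "?S E \<in> borel_measurable borel" using Lm Em by simp_all
        have "(\<integral>\<^sup>+ \<xi>. ?G \<xi> * (ennreal \<kappa> * ?S L \<xi> + ennreal (\<delta> / \<tau>) * ?S E \<xi>) \<partial>lborel) =
          (\<integral>\<^sup>+ \<xi>. ?G \<xi> * (ennreal \<kappa> * ?S L \<xi>) + ?G \<xi> * (ennreal (\<delta> / \<tau>) * ?S E \<xi>) \<partial>lborel)"
          by (simp add: distrib_left)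
        also have "\<dots> = (\<integral>\<^sup>+ \<xi>. ?G \<xi> * (ennreal \<kappa> * ?S L \<xi>) \<partial>lborel) + (\<integral>\<^sup>+ \<xi>. ?G \<xi> * (ennreal (\<delta> / \<tau>) * ?S E \<xi>) \<partial>lborel)"
          by (rule nn_integral_add) measurable
        also have "\<dots> = ?C * ennreal (\<kappa> * m L j) + ?C * ennreal (\<delta> / \<tau> * m E j)"
          using cm[OF Lm, of \<kappa>] cm[OF Em E, of "\<delta> / \<tau>"] \<kappa>(1) \<delta> \<tau> by simp
        finally show ?thesis
          using I(2)[OF Lm] I(2)[OF Em E] \<kappa>(1) \<delta> \<tau> by (simp add: distrib_left ennreal_plus)
      qed
      have cB: "(\<integral>\<^sup>+ \<xi>. ?G \<xi> * (ennreal c * ?S ?B \<xi>) \<partial>lborel) = ?C * ennreal (c * m ?B j)" if "c \<ge> 0" for c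
        by (rule cm) (use that in auto)
      have C: "?C * ennreal a \<le> ?C * ennreal b \<Longrightarrow> b \<ge> 0 \<Longrightarrow> a \<le> b" for a b
        using moment_const_UNIV[OF dim, of j] by (auto simp: ennreal_mult_le_mult_iff ennreal_le_iff)
      have nn: "0 \<le> \<kappa> * m L j + \<delta> / \<tau> * m E j"
        using I(2)[OF Lm] I(2)[OF Em E] \<kappa>(1) \<delta> \<tau> by simp
      have "?C * ennreal ((1 - \<epsilon>) * m ?B j) \<le> ?C * ennreal (\<kappa> * m L j + \<delta> / \<tau> * m E j)"
        unfolding sum[symmetric] using \<epsilon> AE_inner_nonzero[OF e]
        by (subst cB[symmetric]) (auto intro!: nn_integral_mono_AE mult_left_mono pt(1) elim!: eventually_mono)
      then have 1: "(1 - \<epsilon>) * m ?B j \<le> \<kappa> * m L j + \<delta> / \<tau> * m E j" using nn by (rule C)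
      have "?C * ennreal (\<kappa> * m L j + \<delta> / \<tau> * m E j) \<le> ?C * ennreal ((1 + \<epsilon>) * m ?B j)"
        unfolding sum[symmetric] using \<epsilon> AE_inner_nonzero[OF e]
        by (subst cB[symmetric]) (auto intro!: nn_integral_mono_AE mult_left_mono pt(2) elim!: eventually_mono simp del: ennreal_plus)
      then have 2: "\<kappa> * m L j + \<delta> / \<tau> * m E j \<le> (1 + \<epsilon>) * m ?B j" by (rule C) (use \<epsilon> mB in simp)
      show ?thesis using 1 2 by (simp add: algebra_simps abs_le_iff)
    qed
    define c where "c j = real (k choose j) * (-1) ^ j" for j
    have J: "axial_moment e F (\<lambda>t. t ^ k) = (\<Sum>j\<le>k. c j * m F j)" if "F \<in> sets borel" "bounded F" for F
      unfolding c_def m_def by (rule axial_moment_power_expansion[OF dim e that])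
    have "0 \<le> axial_moment e L (\<lambda>t. t ^ k)"
      by (rule nn_integral_axial_moment(2)[OF dim e Lm]) (auto simp: power_le_one)
    then have "\<delta> / \<tau> * axial_moment e E (\<lambda>t. t ^ k) - axial_moment e ?B (\<lambda>t. t ^ k) \<le>
        \<kappa> * axial_moment e L (\<lambda>t. t ^ k) + \<delta> / \<tau> * axial_moment e E (\<lambda>t. t ^ k) - axial_moment e ?B (\<lambda>t. t ^ k)"
      using \<kappa>(1) by simp
    also have "\<dots> = (\<Sum>j\<le>k. c j * (\<kappa> * m L j + \<delta> / \<tau> * m E j - m ?B j))"
    proof -
      have JB: "axial_moment e ?B (\<lambda>t. t ^ k) = (\<Sum>j\<le>k. c j * m ?B j)" by (rule J) auto
      show ?thesis
        unfolding J[OF Lm] J[OF Em E] JB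
        by (simp add: sum_distrib_left sum.distrib sum_subtractf algebra_simps)
    qed
    also have "\<dots> \<le> (\<Sum>j\<le>k. real (k choose j) * (\<epsilon> * m ?B j))"
    proof (rule sum_mono)
      fix j
      have "c j * (\<kappa> * m L j + \<delta> / \<tau> * m E j - m ?B j) \<le> \<bar>c j\<bar> * \<bar>\<kappa> * m L j + \<delta> / \<tau> * m E j - m ?B j\<bar>"
        by (metis abs_ge_self abs_mult)
      also have "\<dots> \<le> \<bar>c j\<bar> * (\<epsilon> * m ?B j)" by (intro mult_left_mono mom) simp
      also have "\<bar>c j\<bar> = real (k choose j)" by (simp add: c_def abs_mult power_abs)
      finally show "c j * (\<kappa> * m L j + \<delta> / \<tau> * m E j - m ?B j) \<le> real (k choose j) * (\<epsilon> * m ?B j)" .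
    qed
    also have "\<dots> = \<epsilon> * M" by (simp add: M_def sum_distrib_left mult_ac)
    finally show ?thesis .
  qed
  show ?thesis
  proof (rule ccontr)
    assume neg: "\<not> ?thesis"
    define D where "D = \<delta> / \<tau> * axial_moment e E (\<lambda>t. t ^ k) - axial_moment e ?B (\<lambda>t. t ^ k)"
    have D: "D > 0" using neg by (simp add: D_def \<tau>_def)
    \<comment> \<open>any \<open>\<epsilon> < 1\<close> with \<open>\<epsilon> M < D\<close> will do\<close>
    define \<epsilon> where "\<epsilon> = D / (2 * (D + M + 1))"
    have "\<epsilon> > 0" "\<epsilon> < 1" using D M by (auto simp: \<epsilon>_def field_simps)
    then have "D \<le> \<epsilon> * M" unfolding D_def by (rule main)
    also have "\<epsilon> * M < D"
    proof -
      have "D * M < D * (2 * (D + M + 1))" using D M by (intro mult_strict_left_mono) auto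
      then show ?thesis using D M by (simp add: \<epsilon>_def divide_less_eq)
    qed
    finally show False by simp
  qed
qed

section \<open>Concentration near the axis\<close>

lemma axial_moment_scale:
  fixes e :: "'a::euclidean_space"
  assumes dim: "DIM('a) \<ge> 2" and e: "norm e = 1" and F: "F \<in> sets borel" "bounded F" and c: "c > 0"
  shows "axial_moment e F (\<lambda>t. t ^ k) = c ^ (DIM('a) - 1) * axial_moment e {x. c *\<^sub>R x \<in> F} (\<lambda>t. t ^ k)"
proof -
  let ?F = "{x. c *\<^sub>R x \<in> F}"
  have m: "?F \<in> sets borel"
    using measurable_sets[of "\<lambda>x. c *\<^sub>R x" borel borel F] F(1) by (simp add: vimage_def)
  have "?F = (\<lambda>x. (1 / c) *\<^sub>R x) ` F"
  proof (intro set_eqI iffI)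
    fix x assume "x \<in> ?F"
    then show "x \<in> (\<lambda>x. (1 / c) *\<^sub>R x) ` F" using c by (intro image_eqI[of _ _ "c *\<^sub>R x"]) auto
  qed (use c in auto)
  then have b: "bounded ?F" using F(2) by (simp add: bounded_scaling)
  have f: "(\<lambda>t::real. t ^ k) \<in> borel_measurable borel" "0 \<le> t \<Longrightarrow> t \<le> 1 \<Longrightarrow> 0 \<le> t ^ k \<and> t ^ k \<le> 1" for t :: real
    by (auto simp: power_le_one)
  have "ennreal (axial_moment e F (\<lambda>t. t ^ k)) = (\<integral>\<^sup>+ x. indicator F x * ennreal (sq_cos e x ^ k / norm x) \<partial>lborel)"
    using nn_integral_axial_moment(1)[OF dim e F f] by simp
  also have "\<dots> = ennreal (c ^ DIM('a)) * (\<integral>\<^sup>+ x. indicator F (c *\<^sub>R x) * ennreal (sq_cos e (c *\<^sub>R x) ^ k / norm (c *\<^sub>R x)) \<partial>lborel)"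
    using nn_integral_subspace_scale[OF subspace_UNIV _ c, of "\<lambda>x::'a. indicator F x * ennreal (sq_cos e x ^ k / norm x)"] F
    unfolding subspace_lborel_UNIV[where 'a = 'a] by simp
  also have "(\<integral>\<^sup>+ x. indicator F (c *\<^sub>R x) * ennreal (sq_cos e (c *\<^sub>R x) ^ k / norm (c *\<^sub>R x)) \<partial>lborel) =
      (\<integral>\<^sup>+ x. ennreal (1 / c) * (indicator ?F x * ennreal (sq_cos e x ^ k / norm x)) \<partial>lborel)"
  proof (rule nn_integral_cong)
    fix x :: 'a
    have "sq_cos e (c *\<^sub>R x) = sq_cos e x" using c by (simp add: sq_cos_def power_mult_distrib)
    then have "sq_cos e (c *\<^sub>R x) ^ k / norm (c *\<^sub>R x) = 1 / c * (sq_cos e x ^ k / norm x)" using c by simp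
    also have "ennreal \<dots> = ennreal (1 / c) * ennreal (sq_cos e x ^ k / norm x)"
      using c sq_cos_bounds(1)[OF e, of x] by (intro ennreal_mult) auto
    finally show "indicator F (c *\<^sub>R x) * ennreal (sq_cos e (c *\<^sub>R x) ^ k / norm (c *\<^sub>R x)) =
        ennreal (1 / c) * (indicator ?F x * ennreal (sq_cos e x ^ k / norm x))"
      by (simp add: indicator_def)
  qed
  also have "\<dots> = ennreal (1 / c) * ennreal (axial_moment e ?F (\<lambda>t. t ^ k))"
    using nn_integral_axial_moment(1)[OF dim e m b f] m by (subst nn_integral_cmult) auto
  also have "ennreal (c ^ DIM('a)) * (ennreal (1 / c) * ennreal (axial_moment e ?F (\<lambda>t. t ^ k))) =
      ennreal (c ^ (DIM('a) - 1) * axial_moment e ?F (\<lambda>t. t ^ k))"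
  proof -
    have "c ^ DIM('a) * (1 / c * axial_moment e ?F (\<lambda>t. t ^ k)) = c ^ DIM('a) * (1 / c) * axial_moment e ?F (\<lambda>t. t ^ k)"
      by simp
    also have "c ^ DIM('a) * (1 / c) = c ^ (DIM('a) - 1)"
      using c dim by (simp add: power_diff)
    finally show ?thesis
      using c nn_integral_axial_moment(2)[OF dim e m b f] by (simp add: ennreal_mult[symmetric])
  qed
  finally show ?thesis
    using c nn_integral_axial_moment(2)[OF dim e m b f] nn_integral_axial_moment(2)[OF dim e F f] by simp
qed

text \<open>Comparison of moments of different orders; the constant bounds the quotient of the powers on \<open>F\<close>.\<close>

lemma axial_moment_mono:
  fixes e :: "'a::euclidean_space"
  assumes dim: "DIM('a) \<ge> 2" and e: "norm e = 1" and F: "F \<in> sets borel" "bounded F" and G: "G \<in> sets borel" "bounded G"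
    and fg: "\<And>x. x \<in> F \<Longrightarrow> x \<in> G \<and> sq_cos e x ^ j \<le> c * sq_cos e x ^ k" and c: "c \<ge> 0"
  shows "axial_moment e F (\<lambda>t. t ^ j) \<le> c * axial_moment e G (\<lambda>t. t ^ k)"
proof -
  have f: "(\<lambda>t::real. t ^ k) \<in> borel_measurable borel" "0 \<le> t \<Longrightarrow> t \<le> 1 \<Longrightarrow> \<bar>t ^ k\<bar> \<le> 1" for t :: real and k :: nat
    by (auto simp: power_le_one)
  have "axial_moment e F (\<lambda>t. t ^ j) \<le> (LINT x|lborel. c * (indicator G x * (sq_cos e x ^ k / norm x)))"
    unfolding axial_moment_def
  proof (rule integral_mono)
    show "integrable lborel (\<lambda>x. indicator F x * (sq_cos e x ^ j / norm x))"
      by (rule integrable_axial[OF dim e F f])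
    show "integrable lborel (\<lambda>x. c * (indicator G x * (sq_cos e x ^ k / norm x)))"
      by (rule integrable_mult_right[OF integrable_axial[OF dim e G f]])
    fix x
    show "indicator F x * (sq_cos e x ^ j / norm x) \<le> c * (indicator G x * (sq_cos e x ^ k / norm x))"
    proof (cases "x \<in> F")
      case True
      then have "sq_cos e x ^ j / norm x \<le> c * sq_cos e x ^ k / norm x" using fg by (intro divide_right_mono) auto
      then show ?thesis using True fg by simp
    next
      case False
      then show ?thesis using c sq_cos_bounds(1)[OF e, of x] by (simp add: indicator_def)
    qed
  qed
  then show ?thesis unfolding axial_moment_def Bochner_Integration.integral_mult_right_zero .
qed

text \<open>Both the ball and the thin ellipsoid \<open>{a\<^sup>2 |x|\<^sup>2 - p \<langle>x, e\<rangle>\<^sup>2 \<le> 1}\<close>, where \<open>a\<^sup>2 = 1 + p\<close>, contain the unit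
  vector \<open>e\<close> on their boundary, and for large \<open>k\<close> their moments are determined by a narrow cone around
  the axis. In the cone \<open>cos\<^sup>2 \<ge> a\<^sup>2 / (a\<^sup>2 + 3)\<close> the ball is contained in twice the ellipsoid. A
  contribution to the moment of the ellipsoid comes from the narrower cone \<open>cos\<^sup>2 \<ge> a\<^sup>2 / (a\<^sup>2 + 1)\<close>;
  for large \<open>k\<close> it outweighs the part of the ball outside of the first cone.\<close>

lemma axial_moment_ball_le_thin_ellipsoid:
  fixes e :: "'a::euclidean_space"
  assumes dim: "DIM('a) \<ge> 2" and e: "norm e = 1" and p: "0 \<le> p"
  defines "T \<equiv> {x. (1 + p) * (norm x)\<^sup>2 - p * (x \<bullet> e)\<^sup>2 \<le> 1}"
  obtains k where "axial_moment e T (\<lambda>t. t ^ k) > 0"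
    "axial_moment e (cball 0 1) (\<lambda>t. t ^ k) \<le> 2 ^ DIM('a) * axial_moment e T (\<lambda>t. t ^ k)"
proof -
  let ?B = "cball (0::'a) 1"
  have ie: "(x \<bullet> e)\<^sup>2 \<le> (norm x)\<^sup>2" for x
    using Cauchy_Schwarz_ineq[of x e] e by (simp add: power2_norm_eq_inner norm_eq_1)
  have pe: "p * (x \<bullet> e)\<^sup>2 \<le> p * (norm x)\<^sup>2" for x using ie p by (rule mult_left_mono)
  have TB: "T \<subseteq> ?B"
  proof
    fix x assume "x \<in> T"
    then have "(norm x)\<^sup>2 \<le> 1" using pe[of x] by (simp add: T_def distrib_right)
    then show "x \<in> ?B" by (simp add: abs_square_le_1)
  qed
  have Tm: "T \<in> sets borel" unfolding T_def by measurable
  have Tb: "bounded T" using TB bounded_subset[OF bounded_cball] by blast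
  \<comment> \<open>\<open>\<theta>1\<close> and \<open>\<theta>2\<close> bound the squared cosine from below on the wide and on the narrow cone;
    \<open>U\<close> is the interior of the ellipsoid within the narrow one.\<close>
  define \<theta>1 \<theta>2 where "\<theta>1 = (1 + p) / (4 + p)" "\<theta>2 = (1 + p) / (2 + p)"
  have \<theta>: "0 < \<theta>1" "\<theta>1 < \<theta>2" using p by (auto simp: \<theta>1_\<theta>2_def field_simps)
  define U where "U = {x. (1 + p) * (norm x)\<^sup>2 - p * (x \<bullet> e)\<^sup>2 < 1 \<and> (1 + p) * (norm x)\<^sup>2 < (2 + p) * (x \<bullet> e)\<^sup>2}"
  have Uo: "open U"
    unfolding U_def by (intro open_Collect_conj open_Collect_less continuous_intros)
  have Um: "U \<in> sets borel" using Uo by simp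
  have UT: "U \<subseteq> T" by (auto simp: U_def T_def)
  have Ub: "bounded U" using UT Tb bounded_subset by blast
  have "(1 / 2) *\<^sub>R e \<in> U"
    using e p by (simp add: U_def dot_square_norm power2_eq_square add_divide_distrib)
  then have "U \<noteq> {}" by auto
  define b0 b1 where "b0 = axial_moment e ?B (\<lambda>t. t ^ 0)" "b1 = axial_moment e U (\<lambda>t. t ^ 0)"
  have b1: "b1 > 0"
  proof -
    have "emeasure lborel U \<noteq> 0"
      using open_not_negligible[OF Uo \<open>U \<noteq> {}\<close>] Um
      by (auto simp: negligible_iff_null_sets null_sets_def)
    then have "0 < emeasure lborel U" by (simp add: zero_less_iff_neq_zero)
    also have "emeasure lborel U = (\<integral>\<^sup>+ x. indicator U x \<partial>lborel)" using Um by simp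
    also have "\<dots> \<le> (\<integral>\<^sup>+ x. indicator U x * ennreal (1 / norm x) \<partial>lborel)"
    proof (rule nn_integral_mono_AE)
      show "AE x in lborel. indicator U x \<le> indicator U x * ennreal (1 / norm x)"
        using AE_inner_nonzero[OF e]
      proof eventually_elim
        case (elim x)
        then have "x \<noteq> 0" by auto
        show ?case
        proof (cases "x \<in> U")
          case True
          then have "norm x \<le> 1" using UT TB by auto
          then have "1 \<le> 1 / norm x" using \<open>x \<noteq> 0\<close> by simp
          then have "1 \<le> ennreal (1 / norm x)" by (simp add: ennreal_ge_1)
          then show ?thesis using True by simp
        qed simp
      qed
    qed
    also have "\<dots> = ennreal b1"
      using nn_integral_axial_moment(1)[OF dim e Um Ub, of "\<lambda>t. t ^ 0"] by (simp add: b0_b1_def)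
    finally show ?thesis by simp
  qed
  have "(\<lambda>k. (\<theta>1 / \<theta>2) ^ k) \<longlonglongrightarrow> 0" using \<theta> by (intro LIMSEQ_power_zero) auto
  then have "(\<lambda>k. b0 * (\<theta>1 / \<theta>2) ^ k) \<longlonglongrightarrow> b0 * 0" by (rule tendsto_mult_left)
  then have "\<forall>\<^sub>F k in sequentially. b0 * (\<theta>1 / \<theta>2) ^ k < b1"
    using b1 by (intro order_tendstoD(2)) auto
  then obtain k where k: "b0 * (\<theta>1 / \<theta>2) ^ k < b1" by (meson eventually_sequentially order_refl)
  let ?J = "\<lambda>F. axial_moment e F (\<lambda>t. t ^ k)"
  have sq: "sq_cos e x < \<theta> \<longleftrightarrow> (x \<bullet> e)\<^sup>2 < \<theta> * (norm x)\<^sup>2" if "x \<noteq> 0" for x \<theta>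
    using that by (simp add: sq_cos_def divide_less_eq)
  have JT: "\<theta>2 ^ k * b1 \<le> ?J T"
  proof -
    have "b1 \<le> (1 / \<theta>2 ^ k) * ?J T"
      unfolding b0_b1_def
    proof (rule axial_moment_mono[OF dim e Um Ub Tm Tb])
      fix x assume x: "x \<in> U"
      then have "x \<noteq> 0" by (auto simp: U_def)
      have "\<theta>2 * (norm x)\<^sup>2 < (x \<bullet> e)\<^sup>2"
        using x p by (simp add: U_def \<theta>1_\<theta>2_def divide_less_eq mult.commute)
      then have "\<theta>2 \<le> sq_cos e x" using sq[OF \<open>x \<noteq> 0\<close>, of \<theta>2] by linarith
      then have "\<theta>2 ^ k \<le> sq_cos e x ^ k" using \<theta> by (intro power_mono) auto
      then show "x \<in> T \<and> sq_cos e x ^ 0 \<le> 1 / \<theta>2 ^ k * sq_cos e x ^ k"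
        using x UT \<theta> by (auto simp: field_simps)
    qed (use \<theta> in simp)
    then show ?thesis using \<theta> by (simp add: field_simps)
  qed
  have "0 < \<theta>2 ^ k * b1" using b1 \<theta> by (intro mult_pos_pos zero_less_power) auto
  then have JTpos: "?J T > 0" using JT by linarith
  define C where "C = {x. \<theta>1 \<le> sq_cos e x}"
  have Cm: "C \<in> sets borel" unfolding C_def by measurable
  have 1: "?J (?B \<inter> C) \<le> 2 ^ (DIM('a) - 1) * ?J T"
  proof -
    let ?T2 = "{x. (1/2) *\<^sub>R x \<in> T}"
    have sc: "{x. 2 *\<^sub>R x \<in> ?T2} = T" by simp
    have "?T2 = (\<lambda>x. 2 *\<^sub>R x) ` T"
    proof (intro set_eqI iffI)
      fix x assume "x \<in> ?T2"
      then show "x \<in> (\<lambda>x. 2 *\<^sub>R x) ` T" by (intro image_eqI[of _ _ "(1/2) *\<^sub>R x"]) auto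
    qed auto
    then have b: "bounded ?T2" using Tb by (simp add: bounded_scaling)
    have m: "?T2 \<in> sets borel"
      using measurable_sets[of "\<lambda>x. (1/2) *\<^sub>R x" borel borel T] Tm by (simp add: vimage_def)
    have "?J (?B \<inter> C) \<le> 1 * ?J ?T2"
    proof (rule axial_moment_mono[OF dim e _ _ m b])
      fix x assume x: "x \<in> ?B \<inter> C"
      have "(1 + p) * (norm x)\<^sup>2 \<le> (4 + p) * (x \<bullet> e)\<^sup>2"
      proof (cases "x = 0")
        case False
        then have "\<theta>1 * (norm x)\<^sup>2 \<le> (x \<bullet> e)\<^sup>2" using x sq[OF False, of \<theta>1] by (auto simp: C_def not_less)
        then show ?thesis using p by (simp add: \<theta>1_\<theta>2_def field_simps)
      qed simp
      moreover have "(norm x)\<^sup>2 \<le> 1" using x by (simp add: abs_square_le_1)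
      then have "(x \<bullet> e)\<^sup>2 \<le> 1" using ie[of x] by linarith
      ultimately have "(1 + p) * (norm x)\<^sup>2 - p * (x \<bullet> e)\<^sup>2 \<le> 4" by (simp add: distrib_right)
      then show "x \<in> ?T2 \<and> sq_cos e x ^ k \<le> 1 * sq_cos e x ^ k"
        by (simp add: T_def power_divide field_simps)
    qed (use Cm in \<open>auto simp: bounded_Int\<close>)
    also have "1 * ?J ?T2 = 2 ^ (DIM('a) - 1) * ?J T"
      using axial_moment_scale[OF dim e m b, of 2 k] unfolding sc by simp
    finally show ?thesis .
  qed
  have "?J (?B - C) \<le> \<theta>1 ^ k * b0"
    unfolding b0_b1_def
  proof (rule axial_moment_mono[OF dim e])
    fix x assume "x \<in> ?B - C"
    then have "sq_cos e x ^ k \<le> \<theta>1 ^ k"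
      using sq_cos_bounds(1)[OF e, of x] by (intro power_mono) (auto simp: C_def)
    then show "x \<in> ?B \<and> sq_cos e x ^ k \<le> \<theta>1 ^ k * sq_cos e x ^ 0" using \<open>x \<in> ?B - C\<close> by simp
  qed (use Cm \<theta> in auto)
  also have "\<dots> = \<theta>2 ^ k * (b0 * (\<theta>1 / \<theta>2) ^ k)" using \<theta> by (simp add: power_divide)
  also have "\<dots> \<le> \<theta>2 ^ k * b1" using k \<theta> by (intro mult_left_mono) auto
  also have "\<dots> \<le> ?J T" by (rule JT)
  finally have 2: "?J (?B - C) \<le> ?J T" .
  have "?J ?B = ?J (?B \<inter> C) + ?J (?B - C)"
  proof -
    have f: "(\<lambda>t::real. t ^ k) \<in> borel_measurable borel" "0 \<le> t \<Longrightarrow> t \<le> 1 \<Longrightarrow> \<bar>t ^ k\<bar> \<le> 1" for t :: real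
      by (auto simp: power_le_one)
    have "?J (?B \<inter> C) + ?J (?B - C) =
        (LINT x|lborel. indicator (?B \<inter> C) x * (sq_cos e x ^ k / norm x) + indicator (?B - C) x * (sq_cos e x ^ k / norm x))"
      unfolding axial_moment_def using Cm
      by (intro Bochner_Integration.integral_add[symmetric] integrable_axial[OF dim e _ _ f]) (auto simp: bounded_Int)
    also have "\<dots> = ?J ?B"
      unfolding axial_moment_def by (intro Bochner_Integration.integral_cong) (auto simp: indicator_def)
    finally show ?thesis ..
  qed
  also have "\<dots> \<le> 2 ^ (DIM('a) - 1) * ?J T + ?J T" using 1 2 by simp
  also have "\<dots> \<le> 2 ^ DIM('a) * ?J T"
  proof -
    have "(2::real) ^ DIM('a) = 2 * 2 ^ (DIM('a) - 1)" using dim by (simp flip: power_Suc)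
    moreover have "1 * ?J T \<le> 2 ^ (DIM('a) - 1) * ?J T"
      using JTpos by (intro mult_right_mono) auto
    ultimately show ?thesis by (simp add: mult.commute)
  qed
  finally have "?J ?B \<le> 2 ^ DIM('a) * ?J T" .
  with JTpos show thesis using that by blast
qed

text \<open>The thin ellipsoid of the previous lemma is the elongated ellipsoid \<open>E\<close> shrunk by the factor \<open>a\<close>. At the
  pole the density of \<open>K\<close> is proportional to \<open>1 - \<delta> a\<^sup>n\<^sup>-\<^sup>2\<close>, which the hypothesis makes negative with a
  margin that absorbs the constant \<open>2\<^sup>n\<close> of the comparison.\<close>

lemma dented_not_intersection_body:
  fixes e :: "'a::euclidean_space"
  assumes dim: "DIM('a) \<ge> 2" and e: "norm e = 1" and a: "a \<ge> 1"
    and \<delta>: "0 \<le> \<delta>" "\<delta> < 1" "\<delta> * a ^ (DIM('a) - 2) > 2 ^ DIM('a)"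
  shows "\<not> intersection_body_in UNIV (star_set UNIV (dented_radial \<delta> (a\<^sup>2 - 1) e))"
proof
  let ?p = "a\<^sup>2 - 1"
  assume K: "intersection_body_in UNIV (star_set UNIV (dented_radial \<delta> ?p e))"
  have p: "0 \<le> ?p" using a by (simp add: one_le_power)
  let ?T = "{x. (1 + ?p) * (norm x)\<^sup>2 - ?p * (x \<bullet> e)\<^sup>2 \<le> 1}"
  let ?E = "{x. (norm x)\<^sup>2 - ?p / (1 + ?p) * (x \<bullet> e)\<^sup>2 \<le> 1}"
  obtain k where k: "axial_moment e ?T (\<lambda>t. t ^ k) > 0"
    "axial_moment e (cball 0 1) (\<lambda>t. t ^ k) \<le> 2 ^ DIM('a) * axial_moment e ?T (\<lambda>t. t ^ k)"
    using axial_moment_ball_le_thin_ellipsoid[OF dim e p] .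
  have a0: "a > 0" "a \<noteq> 0" using a by auto
  have "(norm (a *\<^sub>R x))\<^sup>2 - ?p / (1 + ?p) * (a *\<^sub>R x \<bullet> e)\<^sup>2 = (1 + ?p) * (norm x)\<^sup>2 - ?p * (x \<bullet> e)\<^sup>2" for x
    using a0 by (simp add: power_mult_distrib)
  then have ET: "{x. a *\<^sub>R x \<in> ?E} = ?T" by simp
  have Em: "?E \<in> sets borel" by measurable
  have Eb: "bounded ?E"
  proof -
    have "norm x \<le> a" if "x \<in> ?E" for x
    proof -
      have ie: "(x \<bullet> e)\<^sup>2 \<le> (norm x)\<^sup>2"
        using Cauchy_Schwarz_ineq[of x e] e by (simp add: power2_norm_eq_inner norm_eq_1)
      have "a\<^sup>2 * ((norm x)\<^sup>2 - ?p / (1 + ?p) * (x \<bullet> e)\<^sup>2) \<le> a\<^sup>2 * 1"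
        using that by (intro mult_left_mono) auto
      moreover have "a\<^sup>2 * ((norm x)\<^sup>2 - ?p / (1 + ?p) * (x \<bullet> e)\<^sup>2) = a\<^sup>2 * (norm x)\<^sup>2 - ?p * (x \<bullet> e)\<^sup>2"
        using a0 by (simp add: right_diff_distrib)
      ultimately have "a\<^sup>2 * (norm x)\<^sup>2 - ?p * (x \<bullet> e)\<^sup>2 \<le> a\<^sup>2" by linarith
      moreover have "?p * (x \<bullet> e)\<^sup>2 \<le> ?p * (norm x)\<^sup>2" using ie p by (rule mult_left_mono)
      moreover have "a\<^sup>2 * (norm x)\<^sup>2 - ?p * (norm x)\<^sup>2 = (norm x)\<^sup>2" by (simp add: left_diff_distrib)
      ultimately have "(norm x)\<^sup>2 \<le> a\<^sup>2" by linarith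
      then show ?thesis by (rule power2_le_imp_le) (use a0 in simp)
    qed
    then show ?thesis unfolding bounded_iff by blast
  qed
  have s: "sqrt (1 + ?p) = a" using a0 by simp
  have "\<delta> / a * axial_moment e ?E (\<lambda>t. t ^ k) \<le> axial_moment e (cball 0 1) (\<lambda>t. t ^ k)"
    using axial_moment_le_if_intersection_body[OF dim e p \<delta>(1,2) K Eb, of k] unfolding s .
  also have "axial_moment e ?E (\<lambda>t. t ^ k) = a ^ (DIM('a) - 1) * axial_moment e ?T (\<lambda>t. t ^ k)"
    using axial_moment_scale[OF dim e Em Eb a0(1), of k] unfolding ET .
  finally have "\<delta> / a * (a ^ (DIM('a) - 1) * axial_moment e ?T (\<lambda>t. t ^ k)) \<le> 2 ^ DIM('a) * axial_moment e ?T (\<lambda>t. t ^ k)"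
    using k(2) by linarith
  moreover have "\<delta> / a * a ^ (DIM('a) - 1) = \<delta> * a ^ (DIM('a) - 2)"
  proof -
    have "DIM('a) - 1 = Suc (DIM('a) - 2)" using dim by simp
    then show ?thesis using a0 by simp
  qed
  ultimately have "(\<delta> * a ^ (DIM('a) - 2)) * axial_moment e ?T (\<lambda>t. t ^ k) \<le> 2 ^ DIM('a) * axial_moment e ?T (\<lambda>t. t ^ k)"
    by (simp only: mult.assoc[symmetric])
  then have "\<delta> * a ^ (DIM('a) - 2) \<le> 2 ^ DIM('a)"
    using k(1) by (rule mult_right_le_imp_le)
  then show False using \<delta>(3) by simp
qed

section \<open>Choice of the parameters\<close>

theorem theorem2p1:
  assumes "CARD('n::finite) \<ge> 5"
  shows "\<exists>K :: (real ^ 'n) set.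
    convex_body K \<and> origin_symmetric K \<and>
    \<not> intersection_body_in UNIV K \<and>
    (\<forall>V. subspace V \<and> dim V = CARD('n) - 1 \<longrightarrow> intersection_body_in V (K \<inter> V))"
proof -
  define n where "n = CARD('n)"
  have n: "n \<ge> 5" using assms by (simp add: n_def)
  have D: "DIM(real ^ 'n) = n" by (simp add: n_def)
  obtain e :: "real ^ 'n" where "e \<in> Basis" using nonempty_Basis by blast
  then have e: "norm e = 1" by simp
  \<comment> \<open>\<open>\<delta> a\<^sup>n\<^sup>-\<^sup>2\<close> has to exceed \<open>2\<^sup>n\<close>; \<open>a\<close> is then taken so large that \<open>\<delta> a\<^sup>n\<^sup>-\<^sup>3\<close> is small. Since \<open>n \<ge> 5\<close>,
    this bounds \<open>\<delta> a\<^sup>2\<close>, too.\<close>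
  define a :: real where "a = 2 ^ (n + 3)"
  define \<delta> where "\<delta> = 2 ^ (n + 1) / a ^ (n - 2)"
  have a: "a \<ge> 1" "a > 0" by (simp_all add: a_def)
  have \<delta>a: "\<delta> * a ^ (n - 2) = 2 ^ (n + 1)" using a by (simp add: \<delta>_def)
  have \<delta>a3: "\<delta> * a ^ (n - 3) = 1 / 4"
  proof -
    have "n - 2 = Suc (n - 3)" using n by simp
    then have "a ^ (n - 2) = a * a ^ (n - 3)" by simp
    then have "a * (\<delta> * a ^ (n - 3)) = a * (1 / 4)" using \<delta>a by (simp add: a_def power_add mult_ac)
    then show ?thesis using a by simp
  qed
  have \<delta>0: "\<delta> > 0" using a by (simp add: \<delta>_def)
  have a2: "\<delta> * a\<^sup>2 \<le> 1 / 4"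
  proof -
    have "a\<^sup>2 \<le> a ^ (n - 3)" using a n by (intro power_increasing) auto
    then have "\<delta> * a\<^sup>2 \<le> \<delta> * a ^ (n - 3)" using \<delta>0 by (intro mult_left_mono) auto
    then show ?thesis using \<delta>a3 by simp
  qed
  have "\<delta> * 1 \<le> \<delta> * a\<^sup>2" using \<delta>0 a by (intro mult_left_mono) (auto simp: one_le_power)
  then have \<delta>1: "\<delta> \<le> 1 / 4" using a2 by simp
  have p: "0 \<le> a\<^sup>2 - 1" using a by (simp add: one_le_power)
  have \<delta>2: "\<delta> * (2 + (a\<^sup>2 - 1)) \<le> 1" using a2 \<delta>1 by (simp add: algebra_simps)
  let ?K = "star_set UNIV (dented_radial \<delta> (a\<^sup>2 - 1) e)"
  interpret radial_function UNIV "dented_radial \<delta> (a\<^sup>2 - 1) e"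
    by (rule radial_function_dented) (use \<delta>0 \<delta>1 p in auto)
  have "convex_body ?K"
    by (rule convex_body_dented[OF e p]) (use \<delta>0 \<delta>1 \<delta>2 in auto)
  moreover have "origin_symmetric ?K" by (rule origin_symmetric_star_set) (rule dented_radial_minus)
  moreover have "\<not> intersection_body_in UNIV ?K"
    by (rule dented_not_intersection_body[OF _ e a(1)]) (use n \<delta>0 \<delta>1 \<delta>a D in \<open>simp_all add: power_add\<close>)
  moreover have "intersection_body_in V (?K \<inter> V)" if V: "subspace V" "dim V = CARD('n) - 1" for V
  proof (rule dented_section_intersection_body[OF V(1) _ _ e p])
    show "dim V = Suc (n - 2)" "1 \<le> n - 2" using V(2) n by (simp_all add: n_def)
    have "n - 2 - 1 = n - 3" by simp
    then show "\<delta> * sqrt (1 + (a\<^sup>2 - 1)) ^ (n - 2 - 1) < 1" using \<delta>a3 a by simp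
  qed (use \<delta>0 in simp)
  ultimately show ?thesis by blast
qed

end
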